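(* Let $D$ be the open unit disc in $\mathbb{R}^2$ and let $g=\rho\, g_e$ be a conformal metric on $D$, where $g_e$ is the Euclidean metric and $\rho\in C^2(D)$, $\rho>0$. Let $g_h=\left(\frac{2}{1-|x|^2}\right)^2 g_e$ be the hyperbolic (Poincaré) metric on $D$. Then $$\sup_{u\in C_0^\infty(D),\ \int_D|\nabla u|^2\,dx\le 1}\ \int_D\left(e^{4\pi u^2}-1\right)dV_g<\infty$$ if and only if there is a constant $c>0$ such that $g\le c\,g_h$ on $D$.
   Context: $dV_g=\rho\,dx$ denotes the volume form of $g=\rho g_e$. The inequality $g\le c\,g_h$ means $\rho(x)\le c\left(\frac{2}{1-|x|^2}\right)^2$ for all $x\in D$. $C_0^\infty(D)$ is the space of smooth real-valued functions with compact support in $D$, and $\nabla u$ is the Euclidean gradient. *)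

theory Defs
  imports "HOL-Analysis.Analysis"
begin

text \<open>Only meant for open \<open>S\<close>: the derivatives are taken at \<open>x\<close>, not within \<open>S\<close>, and the values
  of \<open>f\<close> away from \<open>S\<close> are irrelevant.\<close>
primrec Ck_on ::
  "nat \<Rightarrow> ('a::euclidean_space \<Rightarrow> 'b::real_normed_vector) \<Rightarrow> 'a set \<Rightarrow> bool" where
  "Ck_on 0 f S \<longleftrightarrow> continuous_on S f"
| "Ck_on (Suc k) f S \<longleftrightarrow>
     (\<forall>x\<in>S. f differentiable (at x)) \<and>
     (\<forall>v. Ck_on k (\<lambda>x. frechet_derivative f (at x) v) S)"

definition smooth_on :: "('a::euclidean_space \<Rightarrow> 'b::real_normed_vector) \<Rightarrow> 'a set \<Rightarrow> bool" where
  "smooth_on f S \<longleftrightarrow> (\<forall>k. Ck_on k f S)"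

text \<open>A test function on \<open>S\<close> is represented by its extension by zero to the whole space, so the
  support is taken in the whole space.\<close>
definition test_functions :: "'a::euclidean_space set \<Rightarrow> ('a \<Rightarrow> real) set" where
  "test_functions S =
     {u. smooth_on u S \<and> compact (closure (support_on UNIV u)) \<and> closure (support_on UNIV u) \<subseteq> S}"

definition grad :: "('a::euclidean_space \<Rightarrow> real) \<Rightarrow> 'a \<Rightarrow> 'a" where
  "grad u x = (THE d. GDERIV u x :> d)"

definition unit_disc :: "(real^2) set" where
  "unit_disc = ball 0 1"

text \<open>A conformal metric \<open>\<rho> g\<^sub>e\<close> on \<open>S\<close> is represented by its conformal factor \<open>\<rho>\<close>; only the values
  of \<open>\<rho>\<close> on \<open>S\<close> matter. In dimension two the volume form of \<open>\<rho> g\<^sub>e\<close> is \<open>\<rho> dx\<close>.\<close>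
definition conformal_volume :: "(real^2) set \<Rightarrow> (real^2 \<Rightarrow> real) \<Rightarrow> (real^2) measure" where
  "conformal_volume S \<rho> = density (restrict_space lborel S) (\<lambda>x. ennreal (\<rho> x))"

definition hyperbolic_factor :: "real^2 \<Rightarrow> real" where
  "hyperbolic_factor x = (2 / (1 - (norm x)\<^sup>2))\<^sup>2"

end

theory Submission
  imports Defs
begin

text \<open>
  Write \<open>\<mu>\<close> for the area of the hyperbolic metric. The functional is invariant under the
  Moebius group of the disc as soon as \<open>dV\<^sub>g\<close> is replaced by \<open>\<mu>\<close>, because the Dirichlet
  integral is conformally invariant. So the theorem has two halves: the supremum is finite for \<open>\<mu>\<close>
  itself, and finiteness for \<open>g\<close> can be tested at every point of the disc with one and the same
  bound, by moving a concentrating function to that point.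

  \<^bold>\<open>Sufficiency.\<close> No rearrangement of functions and no isoperimetric inequality are used.
  Integrating \<open>u\<close> along the images of Euclidean rays under a Moebius map and averaging over the rays
  (\<open>truncation_le_potential\<close>) bounds the truncation of \<open>\<bar>u\<bar>\<close> between two heights \<open>a < b\<close> by a potential:
  \<open>min (\<bar>u\<bar> - a)\<^sup>+ (b - a) \<le> \<integral> k(x,y) \<bar>\<nabla>u\<bar> 1\<^bsub>a<\<bar>u\<bar><b\<^esub> d\<mu>\<close>, where the length of the gradient is hyperbolic
  and \<open>k = 1 / (2 \<pi> sinh d)\<close> is the length of the gradient of the Green function.
  Now integrate this over the set \<open>B = {\<bar>u\<bar> \<ge> b}\<close>. By Cauchy-Schwarz only the \<open>L\<^sup>2\<close> norm of the potential
  of \<open>B\<close> over \<open>A = {\<bar>u\<bar> > a}\<close> matters. If \<open>\<mu>(A) \<le> 1\<close>, its square is at most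
  \<open>\<mu>(B)\<^sup>2 (ln (\<mu>(A)/\<mu>(B)) / (4 \<pi>) + O(1))\<close>, with the optimal leading constant
  (\<open>potential_estimate\<close>). The outcome (\<open>level_set_capacity\<close>) is
  \<open>4 \<pi> (b - a)\<^sup>2 \<le> (\<integral> \<bar>\<nabla>u\<bar>\<^sup>2 1\<^bsub>a<\<bar>u\<bar><b\<^esub>) (ln (\<mu>(A)/\<mu>(B)) + O(1))\<close>.
  Inequalities of this kind between any two levels are enough for the sharp constant, in spite of the
  error term: taken at the heights where \<open>\<mu>{\<bar>u\<bar> \<ge> l}\<close> crosses \<open>1, e\<^sup>-\<^sup>1, e\<^sup>-\<^sup>2, \<dots>\<close> they turn the claim
  into a statement on sequences (\<open>moser_sequence\<close>), a discrete form of Moser's one-dimensional lemma.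
  The part of the disc where \<open>u\<close> is bounded may have large area; there \<open>exp (4 \<pi> u\<^sup>2) - 1\<close> is
  comparable to \<open>u\<^sup>2\<close>, which the spectral gap of the hyperbolic plane controls (\<open>poincare\<close>).

  \<^bold>\<open>Necessity.\<close> For a point \<open>a\<close> and small \<open>e\<close>, a smooth version of Moser's function, composed with the
  Moebius map that exchanges \<open>a\<close> and \<open>0\<close>, has energy at most \<open>1\<close>, and \<open>exp (4 \<pi> u\<^sup>2)\<close> is of order
  \<open>1/e\<close> on a ball around \<open>a\<close> of Euclidean area of order \<open>e (1 - \<bar>a\<bar>\<^sup>2)\<^sup>2\<close>. Hence
  \<open>\<rho>(a) (1 - \<bar>a\<bar>\<^sup>2)\<^sup>2\<close> is bounded by a multiple of the supremum (\<open>sup_finite_imp_bound\<close>).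
\<close>

section \<open>Moebius maps and hyperbolic area\<close>

text \<open>Moebius maps are most easily differentiated as complex functions, while the change of variables
  formula is about \<open>real^2\<close>; this isometry and its inverse pass between the two.\<close>
definition to_C :: "real^2 \<Rightarrow> complex" where
  "to_C x = Complex (x $ 1) (x $ 2)"

definition of_C :: "complex \<Rightarrow> real^2" where
  "of_C z = vector [Re z, Im z]"

text \<open>The involution \<open>z \<mapsto> (a - z) / (1 - cnj a z)\<close> of the disc, which exchanges \<open>a\<close> and \<open>0\<close>.\<close>
definition disc_moebius :: "real^2 \<Rightarrow> real^2 \<Rightarrow> real^2" where
  "disc_moebius a x = of_C ((to_C a - to_C x) / (1 - cnj (to_C a) * to_C x))"

text \<open>The square of the pseudohyperbolic distance, equal to \<open>(tanh (d/2))\<^sup>2\<close> for the hyperbolic distance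
  \<open>d\<close>. The formula is that of \<open>\<bar>x - y\<bar>\<^sup>2 / \<bar>1 - cnj x y\<bar>\<^sup>2\<close> with the denominator rewritten, so that
  symmetry and smoothness can be read off.\<close>
definition psd :: "real^2 \<Rightarrow> real^2 \<Rightarrow> real" where
  "psd x y = (norm (x - y))\<^sup>2 / ((norm (x - y))\<^sup>2 + (1 - (norm x)\<^sup>2) * (1 - (norm y)\<^sup>2))"

text \<open>Hyperbolic area, extended by zero outside the disc.\<close>
definition hvol :: "(real^2) measure" where
  "hvol = density lborel (\<lambda>x. indicator unit_disc x * ennreal (hyperbolic_factor x))"

lemma of_C_to_C [simp]: "of_C (to_C x) = x"
  by (simp add: of_C_def to_C_def vec_eq_iff forall_2)

lemma to_C_of_C [simp]: "to_C (of_C z) = z"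
  by (simp add: of_C_def to_C_def complex_eq_iff)

lemma norm_to_C [simp]: "cmod (to_C x) = norm x"
  by (simp add: to_C_def norm_eq_sqrt_inner[of x] inner_vec_def sum_2 power2_eq_square cmod_def)

lemma norm_of_C [simp]: "norm (of_C z) = cmod z"
  by (metis norm_to_C to_C_of_C)

lemma bounded_linear_to_C: "bounded_linear to_C"
  by (rule bounded_linear_intro[where K=1]) (auto simp: to_C_def complex_eq_iff norm_to_C[unfolded to_C_def])

lemma bounded_linear_of_C: "bounded_linear of_C"
  by (rule bounded_linear_intro[where K=1])
     (auto simp: of_C_def vec_eq_iff forall_2 norm_of_C[unfolded of_C_def])

lemma to_C_diff: "to_C (x - y) = to_C x - to_C y"
  by (simp add: to_C_def complex_eq_iff)

lemma to_C_0 [simp]: "to_C 0 = 0"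
  by (simp add: to_C_def complex_eq_iff)

lemma mem_unit_disc: "x \<in> unit_disc \<longleftrightarrow> norm x < 1"
  by (simp add: unit_disc_def)

lemma mem_unit_disc2: "x \<in> unit_disc \<longleftrightarrow> (norm x)\<^sup>2 < 1"
  by (simp add: mem_unit_disc power_less_one_iff)

lemma cmod2_denominator:
  "(cmod (1 - cnj a * z))\<^sup>2 = (cmod (a - z))\<^sup>2 + (1 - (cmod a)\<^sup>2) * (1 - (cmod z)\<^sup>2)"
  unfolding cmod_power2 by (simp add: power2_eq_square algebra_simps)

lemma denominator_pos:
  assumes "a \<in> unit_disc" "x \<in> unit_disc"
  shows "(norm (a - x))\<^sup>2 + (1 - (norm a)\<^sup>2) * (1 - (norm x)\<^sup>2) > 0"
proof -
  have "(1 - (norm a)\<^sup>2) * (1 - (norm x)\<^sup>2) > 0"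
    using assms by (simp add: mem_unit_disc2)
  then show ?thesis by (simp add: add_nonneg_pos)
qed

lemma denominator_nonzero:
  assumes "a \<in> unit_disc" "x \<in> unit_disc"
  shows "1 - cnj (to_C a) * to_C x \<noteq> 0"
proof -
  have "(cmod (1 - cnj (to_C a) * to_C x))\<^sup>2 > 0"
    using denominator_pos[OF assms] unfolding cmod2_denominator to_C_diff[symmetric] norm_to_C .
  then show ?thesis by auto
qed

lemma norm_moebius_sq: "(norm (disc_moebius a x))\<^sup>2 = psd a x"
  unfolding disc_moebius_def psd_def norm_of_C norm_divide power_divide cmod2_denominator
  by (simp add: to_C_diff[symmetric])

lemma psd_commute: "psd x y = psd y x"
  by (simp add: psd_def norm_minus_commute mult.commute)

lemma psd_nonneg: 
  assumes "x \<in> unit_disc" "y \<in> unit_disc" shows "0 \<le> psd x y"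
  using norm_moebius_sq[of x y] by (metis zero_le_power2)

lemma one_minus_psd:
  assumes "x \<in> unit_disc" "y \<in> unit_disc"
  shows "1 - psd x y = (1 - (norm x)\<^sup>2) * (1 - (norm y)\<^sup>2) /
           ((norm (x - y))\<^sup>2 + (1 - (norm x)\<^sup>2) * (1 - (norm y)\<^sup>2))"
  using denominator_pos[OF assms] by (simp add: psd_def field_simps)

lemma psd_less_1:
  assumes "x \<in> unit_disc" "y \<in> unit_disc" shows "psd x y < 1"
proof -
  have "0 < 1 - psd x y"
    unfolding one_minus_psd[OF assms]
    using assms denominator_pos[OF assms] by (intro divide_pos_pos) (auto simp: mem_unit_disc2)
  then show ?thesis by simp
qed

lemma moebius_in_disc:
  assumes "a \<in> unit_disc" "x \<in> unit_disc" shows "disc_moebius a x \<in> unit_disc"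
  using psd_less_1[OF assms] by (simp add: mem_unit_disc2 norm_moebius_sq)

lemma moebius_moebius:
  assumes "a \<in> unit_disc" "x \<in> unit_disc" shows "disc_moebius a (disc_moebius a x) = x"
proof -
  let ?a = "to_C a" and ?x = "to_C x"
  have d: "1 - cnj ?a * ?x \<noteq> 0" by (rule denominator_nonzero[OF assms])
  have d2: "1 - cnj ?a * ?a \<noteq> 0" by (rule denominator_nonzero[OF assms(1) assms(1)])
  have *: "?a - (?a - ?x) / (1 - cnj ?a * ?x) = ?x * (1 - cnj ?a * ?a) / (1 - cnj ?a * ?x)"
    using d by (simp add: field_simps)
  have **: "1 - cnj ?a * ((?a - ?x) / (1 - cnj ?a * ?x)) = (1 - cnj ?a * ?a) / (1 - cnj ?a * ?x)"
    using d by (simp add: field_simps)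
  show ?thesis
    unfolding disc_moebius_def to_C_of_C * ** using d d2 by simp
qed

lemma moebius_0 [simp]: "disc_moebius a 0 = a"
  by (simp add: disc_moebius_def)

definition moebius_deriv :: "real^2 \<Rightarrow> real^2 \<Rightarrow> real^2 \<Rightarrow> real^2" where
  "moebius_deriv a x h =
     of_C (((cmod (to_C a))\<^sup>2 - 1) / (1 - cnj (to_C a) * to_C x)\<^sup>2 * to_C h)"

lemma has_derivative_moebius:
  assumes "a \<in> unit_disc" "x \<in> unit_disc"
  shows "(disc_moebius a has_derivative moebius_deriv a x) (at x within S)"
proof -
  let ?a = "to_C a" and ?x = "to_C x"
  have d: "1 - cnj ?a * ?x \<noteq> 0" by (rule denominator_nonzero[OF assms])
  have n: "(complex_of_real (cmod ?a))\<^sup>2 = ?a * cnj ?a"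
    using complex_norm_square[of ?a] by (simp only: of_real_power)
  have "((\<lambda>z. (?a - z) / (1 - cnj ?a * z)) has_field_derivative
      ((- 1) * (1 - cnj ?a * ?x) - (?a - ?x) * (- cnj ?a)) / ((1 - cnj ?a * ?x) * (1 - cnj ?a * ?x))) (at ?x)"
    using d by (auto intro!: derivative_eq_intros simp: field_simps)
  also have "((- 1) * (1 - cnj ?a * ?x) - (?a - ?x) * (- cnj ?a)) / ((1 - cnj ?a * ?x) * (1 - cnj ?a * ?x))
      = ((cmod ?a)\<^sup>2 - 1) / (1 - cnj ?a * ?x)\<^sup>2"
    unfolding of_real_diff of_real_1 of_real_power n by (simp add: power2_eq_square algebra_simps)
  finally have "((\<lambda>z. (?a - z) / (1 - cnj ?a * z)) has_derivative
      (*) (((cmod ?a)\<^sup>2 - 1) / (1 - cnj ?a * ?x)\<^sup>2)) (at ?x)"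
    by (simp add: has_field_derivative_def)
  then have "((\<lambda>z. (?a - z) / (1 - cnj ?a * z)) has_derivative
      (*) (((cmod ?a)\<^sup>2 - 1) / (1 - cnj ?a * ?x)\<^sup>2)) (at ?x within to_C ` S)"
    by (rule has_derivative_at_withinI)
  from has_derivative_in_compose[OF bounded_linear_imp_has_derivative[OF bounded_linear_to_C] this]
  show ?thesis
    unfolding disc_moebius_def[abs_def] moebius_deriv_def[abs_def]
    by (rule bounded_linear.has_derivative[OF bounded_linear_of_C])
qed

text \<open>A holomorphic map acts on tangent vectors by a similarity. That its ratio is the quotient of
  \<open>1 - \<bar>z\<bar>\<^sup>2\<close> at the image and at the point says that the map is a hyperbolic isometry.\<close>
lemma moebius_scale:
  assumes "a \<in> unit_disc" "x \<in> unit_disc"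
  shows "cmod (((cmod (to_C a))\<^sup>2 - 1) / (1 - cnj (to_C a) * to_C x)\<^sup>2)
       = (1 - (norm (disc_moebius a x))\<^sup>2) / (1 - (norm x)\<^sup>2)"
proof -
  have a: "(norm a)\<^sup>2 < 1" and x: "(norm x)\<^sup>2 < 1" using assms by (auto simp: mem_unit_disc2)
  have "cmod (((cmod (to_C a))\<^sup>2 - 1) / (1 - cnj (to_C a) * to_C x)\<^sup>2)
      = cmod (of_real ((norm a)\<^sup>2 - 1)) / (cmod (1 - cnj (to_C a) * to_C x))\<^sup>2"
    by (simp add: norm_divide norm_power)
  also have "cmod (of_real ((norm a)\<^sup>2 - 1)) = 1 - (norm a)\<^sup>2"
    using a unfolding norm_of_real by simp
  also have "(1 - (norm a)\<^sup>2) / (cmod (1 - cnj (to_C a) * to_C x))\<^sup>2 = (1 - (norm (disc_moebius a x))\<^sup>2) / (1 - (norm x)\<^sup>2)"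
    unfolding norm_moebius_sq one_minus_psd[OF assms] cmod2_denominator to_C_diff[symmetric] norm_to_C
    using x by simp
  finally show ?thesis .
qed

lemma norm_moebius_deriv:
  assumes "a \<in> unit_disc" "x \<in> unit_disc"
  shows "norm (moebius_deriv a x h) = (1 - (norm (disc_moebius a x))\<^sup>2) / (1 - (norm x)\<^sup>2) * norm h"
  unfolding moebius_deriv_def norm_of_C norm_mult moebius_scale[OF assms] by simp

lemma det_moebius_deriv:
  assumes "a \<in> unit_disc" "x \<in> unit_disc"
  shows "det (matrix (moebius_deriv a x)) = ((1 - (norm (disc_moebius a x))\<^sup>2) / (1 - (norm x)\<^sup>2))\<^sup>2"
proof -
  define c where "c = ((cmod (to_C a))\<^sup>2 - 1) / (1 - cnj (to_C a) * to_C x)\<^sup>2"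
  have "det (matrix (\<lambda>h. of_C (c * to_C h))) = (cmod c)\<^sup>2"
    unfolding cmod_power2 by (simp add: det_2 matrix_def of_C_def to_C_def axis_def power2_eq_square)
  then show ?thesis
    unfolding moebius_deriv_def[abs_def] c_def moebius_scale[OF assms] .
qed

lemma measurable_to_C [measurable]: "to_C \<in> borel_measurable borel"
  by (intro borel_measurable_continuous_onI linear_continuous_on bounded_linear_to_C)

lemma measurable_of_C [measurable]: "of_C \<in> borel_measurable borel"
  by (intro borel_measurable_continuous_onI linear_continuous_on bounded_linear_of_C)

lemma measurable_moebius [measurable]: "disc_moebius a \<in> borel_measurable borel"
  unfolding disc_moebius_def[abs_def] by measurable

lemma sets_unit_disc [measurable]: "unit_disc \<in> sets borel"
  by (simp add: unit_disc_def)

lemma emeasure_unit_disc_finite: "A \<subseteq> unit_disc \<Longrightarrow> emeasure lborel A < \<infinity>"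
  using emeasure_mono[of A unit_disc lborel] emeasure_lborel_ball_finite[of 0 1]
  by (fastforce simp: unit_disc_def intro: le_less_trans)

text \<open>Applying the change of variables formula to indicator functions only leaves the integrals
  below without any integrability condition.\<close>
lemma nn_integral_moebius_Jacobian:
  assumes a: "a \<in> unit_disc" and [measurable]: "B \<in> sets borel"
  shows "(\<integral>\<^sup>+x. ennreal (((1 - (norm (disc_moebius a x))\<^sup>2) / (1 - (norm x)\<^sup>2))\<^sup>2)
            * indicator (disc_moebius a -` B \<inter> unit_disc) x \<partial>lborel) = emeasure lborel (B \<inter> unit_disc)"
proof -
  let ?J = "\<lambda>x. ((1 - (norm (disc_moebius a x))\<^sup>2) / (1 - (norm x)\<^sup>2))\<^sup>2"
  let ?A = "disc_moebius a -` B \<inter> unit_disc"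
  have A: "?A \<in> sets borel"
    using measurable_sets[OF measurable_moebius[of a], of B] by auto
  have im: "disc_moebius a ` ?A = B \<inter> unit_disc"
  proof
    show "disc_moebius a ` ?A \<subseteq> B \<inter> unit_disc"
      using moebius_in_disc[OF a] by auto
    show "B \<inter> unit_disc \<subseteq> disc_moebius a ` ?A"
    proof
      fix y assume y: "y \<in> B \<inter> unit_disc"
      then have "disc_moebius a y \<in> ?A" using moebius_in_disc[OF a] moebius_moebius[OF a] by auto
      then show "y \<in> disc_moebius a ` ?A" using moebius_moebius[OF a, of y] y
        by (metis IntD2 image_eqI)
    qed
  qed
  have inj: "inj_on (disc_moebius a) ?A"
    by (rule inj_on_inverseI[where g="disc_moebius a"]) (auto simp: moebius_moebius[OF a])
  have lm: "B \<inter> unit_disc \<in> lmeasurable"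
    using emeasure_unit_disc_finite[of "B \<inter> unit_disc"]
    by (intro fmeasurableI) (auto intro: sets_completionI_sets)
  have "((\<lambda>x. \<bar>det (matrix (moebius_deriv a x))\<bar>) has_integral measure lebesgue (B \<inter> unit_disc)) ?A"
    using has_measure_differentiable_image[of ?A "disc_moebius a" "moebius_deriv a" "measure lebesgue (B \<inter> unit_disc)"]
      A has_derivative_moebius[OF a] inj im lm by auto
  then have "(?J has_integral measure lebesgue (B \<inter> unit_disc)) ?A"
    by (rule has_integral_eq[rotated]) (auto simp: det_moebius_deriv[OF a])
  then have "(\<integral>\<^sup>+x. ennreal (?J x) * indicator ?A x \<partial>lborel) = ennreal (measure lebesgue (B \<inter> unit_disc))"
    by (intro nn_integral_has_integral_lebesgue') auto
  also have "measure lebesgue (B \<inter> unit_disc) = measure lborel (B \<inter> unit_disc)" by simp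
  also have "ennreal (measure lborel (B \<inter> unit_disc)) = emeasure lborel (B \<inter> unit_disc)"
    using emeasure_unit_disc_finite[of "B \<inter> unit_disc"] by (intro emeasure_eq_ennreal_measure[symmetric]) auto
  finally show ?thesis .
qed

lemma space_hvol [simp]: "space hvol = UNIV" and sets_hvol [simp, measurable_cong]: "sets hvol = sets borel"
  by (auto simp: hvol_def)

lemma measurable_hyperbolic_factor [measurable]: "hyperbolic_factor \<in> borel_measurable borel"
  unfolding hyperbolic_factor_def[abs_def] by measurable

lemma nn_integral_hvol:
  assumes [measurable]: "F \<in> borel_measurable borel"
  shows "(\<integral>\<^sup>+x. F x \<partial>hvol) = (\<integral>\<^sup>+x. indicator unit_disc x * ennreal (hyperbolic_factor x) * F x \<partial>lborel)"
  unfolding hvol_def by (subst nn_integral_density) auto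

text \<open>The Jacobian of the map is exactly the quotient of the hyperbolic densities at a point and at
  its image.\<close>
lemma nn_integral_hvol_moebius:
  assumes a: "a \<in> unit_disc" and [measurable]: "F \<in> borel_measurable borel"
  shows "(\<integral>\<^sup>+x. F (disc_moebius a x) \<partial>hvol) = (\<integral>\<^sup>+x. F x \<partial>hvol)"
proof -
  let ?J = "\<lambda>x. ((1 - (norm (disc_moebius a x))\<^sup>2) / (1 - (norm x)\<^sup>2))\<^sup>2"
  let ?M = "distr (density lborel (\<lambda>x. indicator unit_disc x * ennreal (?J x))) borel (disc_moebius a)"
  let ?N = "density lborel (indicator unit_disc :: real^2 \<Rightarrow> ennreal)"
  have eq: "?M = ?N"
  proof (rule measure_eqI)
    fix B :: "(real^2) set" assume "B \<in> sets ?M"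
    then have [measurable]: "B \<in> sets borel" by simp
    have "emeasure ?M B = (\<integral>\<^sup>+x. ennreal (?J x) * indicator (disc_moebius a -` B \<inter> unit_disc) x \<partial>lborel)"
      using measurable_sets[OF measurable_moebius[of a], of B]
      by (subst emeasure_distr, simp, simp, subst emeasure_density)
         (auto intro!: nn_integral_cong split: split_indicator)
    also have "\<dots> = emeasure ?N B"
      by (subst nn_integral_moebius_Jacobian[OF a])
         (auto simp: emeasure_density indicator_inter_arith[symmetric] Int_commute)
    finally show "emeasure ?M B = emeasure ?N B" .
  qed simp
  let ?G = "\<lambda>x. ennreal (hyperbolic_factor x) * F x"
  have "(\<integral>\<^sup>+x. F (disc_moebius a x) \<partial>hvol)
      = (\<integral>\<^sup>+x. indicator unit_disc x * ennreal (hyperbolic_factor x) * F (disc_moebius a x) \<partial>lborel)"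
    by (rule nn_integral_hvol) measurable
  also have "\<dots> = (\<integral>\<^sup>+x. (indicator unit_disc x * ennreal (?J x)) * ?G (disc_moebius a x) \<partial>lborel)"
  proof (intro nn_integral_cong)
    fix x :: "real^2"
    show "indicator unit_disc x * ennreal (hyperbolic_factor x) * F (disc_moebius a x) =
          indicator unit_disc x * ennreal (?J x) * ?G (disc_moebius a x)"
    proof (cases "x \<in> unit_disc")
      case True
      then have "1 - (norm x)\<^sup>2 > 0" "1 - (norm (disc_moebius a x))\<^sup>2 > 0"
        using moebius_in_disc[OF a] by (auto simp: mem_unit_disc2)
      then have "hyperbolic_factor x = ?J x * hyperbolic_factor (disc_moebius a x)"
        by (simp add: hyperbolic_factor_def power_divide)
      then show ?thesis by (simp add: ennreal_mult' mult.assoc)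
    qed simp
  qed
  also have "\<dots> = (\<integral>\<^sup>+x. ?G x \<partial>?M)"
    by (subst nn_integral_distr, simp, simp, subst nn_integral_density) auto
  also have "\<dots> = (\<integral>\<^sup>+x. F x \<partial>hvol)"
    unfolding eq by (subst nn_integral_density) (auto simp: nn_integral_hvol mult.assoc)
  finally show ?thesis .
qed

section \<open>Polar coordinates\<close>

lemma nn_integral_scale_plane:
  fixes H :: "real^2 \<Rightarrow> ennreal"
  assumes [measurable]: "H \<in> borel_measurable borel" and c: "c > 0"
  shows "(\<integral>\<^sup>+z. H (c *\<^sub>R z) \<partial>lborel) = ennreal (1 / c\<^sup>2) * (\<integral>\<^sup>+z. H z \<partial>lborel)"
proof -
  have "(\<integral>\<^sup>+z. H z \<partial>lborel) = ennreal (c\<^sup>2) * (\<integral>\<^sup>+z. H (c *\<^sub>R z) \<partial>lborel)"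
    using c by (subst lborel_affine[of c 0]) (simp_all add: nn_integral_density nn_integral_distr nn_integral_cmult)
  then show ?thesis using c
    by (simp add: mult.assoc[symmetric] ennreal_mult'[symmetric])
qed

lemma distr_norm_square_lborel:
  "distr (lborel :: (real^2) measure) borel (\<lambda>z. (norm z)\<^sup>2) = density lborel (\<lambda>t. ennreal pi * indicator {0..} t)"
  (is "?M = ?N")
proof (rule measure_eqI_generator_eq[where E="range atMost" and \<Omega>=UNIV and A="\<lambda>n. {..real n}"])
  have eq: "emeasure ?M {..c} = ennreal (if c \<ge> 0 then pi * c else 0) \<and> 
            emeasure ?N {..c} = ennreal (if c \<ge> 0 then pi * c else 0)" for c :: real
  proof (cases "c \<ge> 0")
    case True
    have "(\<lambda>z::real^2. (norm z)\<^sup>2) -` {..c} = cball 0 (sqrt c)"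
      using True by (auto simp: real_le_rsqrt sqrt_ge_absD)
    then have "emeasure ?M {..c} = emeasure lborel (cball (0::real^2) (sqrt c))"
      by (simp add: emeasure_distr)
    also have "\<dots> = ennreal (pi * c)"
      using True by (subst emeasure_cball) (simp_all add: unit_ball_vol_2)
    finally have 1: "emeasure ?M {..c} = ennreal (pi * c)" .
    have "emeasure ?N {..c} = ennreal pi * emeasure lborel {0..c}"
      by (simp add: emeasure_density nn_integral_cmult_indicator[symmetric])
         (auto intro!: nn_integral_cong split: split_indicator)
    also have "\<dots> = ennreal (pi * c)" using True by (simp add: ennreal_mult')
    finally show ?thesis using 1 True by simp
  next
    case False
    then have "(\<lambda>z::real^2. (norm z)\<^sup>2) -` {..c} = {}"
      by (auto simp: not_le) (metis le_less_trans not_less zero_le_power2)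
    then have 1: "emeasure ?M {..c} = 0"
      by (simp add: emeasure_distr)
    have "emeasure ?N {..c} = (\<integral>\<^sup>+t. ennreal pi * indicator {0..} t * indicator {..c} t \<partial>lborel)"
      by (rule emeasure_density) measurable
    also have "\<dots> = (\<integral>\<^sup>+t. 0 \<partial>(lborel :: real measure))"
      by (rule nn_integral_cong) (use False in \<open>auto split: split_indicator\<close>)
    finally have "emeasure ?N {..c} = 0" by simp
    then show ?thesis using 1 False by simp
  qed
  show "emeasure ?M X = emeasure ?N X" if "X \<in> range atMost" for X
    using that eq by auto
  show "emeasure ?M {..real n} \<noteq> \<infinity>" for n using eq[of "real n"] by simp
  show "Int_stable (range (atMost :: real \<Rightarrow> _))" by (auto simp: Int_stable_def)
  show "sets ?M = sigma_sets UNIV (range atMost)" "sets ?N = sigma_sets UNIV (range atMost)"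
    by (simp_all add: borel_eq_atMost)
  show "(\<Union>i. {..real i}) = UNIV" using real_arch_simple by auto
qed auto

lemma nn_integral_radial:
  assumes [measurable]: "g \<in> borel_measurable borel"
  shows "(\<integral>\<^sup>+z. g ((norm (z::real^2))\<^sup>2) \<partial>lborel) = ennreal pi * (\<integral>\<^sup>+t. g t * indicator {0..} t \<partial>lborel)"
proof -
  have "(\<integral>\<^sup>+z. g ((norm (z::real^2))\<^sup>2) \<partial>lborel) = (\<integral>\<^sup>+t. g t \<partial>distr (lborel :: (real^2) measure) borel (\<lambda>z. (norm z)\<^sup>2))"
    by (subst nn_integral_distr) auto
  also have "\<dots> = (\<integral>\<^sup>+t. ennreal pi * (g t * indicator {0..} t) \<partial>lborel)"
    unfolding distr_norm_square_lborel by (subst nn_integral_density) (auto simp: mult_ac)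
  also have "\<dots> = ennreal pi * (\<integral>\<^sup>+t. g t * indicator {0..} t \<partial>lborel)"
    by (rule nn_integral_cmult) measurable
  finally show ?thesis .
qed

text \<open>After moving \<open>x\<close> to the origin, the integrand depends on \<open>\<bar>y\<bar>\<^sup>2\<close> only. All estimates of the kernel are
  one-dimensional integrals because of this formula.\<close>
lemma nn_integral_hvol_psd:
  assumes x: "x \<in> unit_disc" and [measurable]: "g \<in> borel_measurable borel"
  shows "(\<integral>\<^sup>+y. g (psd x y) \<partial>hvol) = (\<integral>\<^sup>+t. g t * ennreal (4 * pi / (1 - t)\<^sup>2) * indicator {0..<1} t \<partial>lborel)"
proof -
  have "(\<integral>\<^sup>+y. g (psd x y) \<partial>hvol) = (\<integral>\<^sup>+y. g ((norm y)\<^sup>2) \<partial>hvol)"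
    unfolding norm_moebius_sq[symmetric]
    by (rule nn_integral_hvol_moebius[OF x, where F="\<lambda>y. g ((norm y)\<^sup>2)"]) measurable
  also have "\<dots> = (\<integral>\<^sup>+y. indicator unit_disc y * ennreal (hyperbolic_factor y) * g ((norm y)\<^sup>2) \<partial>lborel)"
    by (rule nn_integral_hvol) measurable
  also have "\<dots> = (\<integral>\<^sup>+y. (\<lambda>t. indicator {..<1} t * ennreal ((2 / (1 - t))\<^sup>2) * g t) ((norm (y::real^2))\<^sup>2) \<partial>lborel)"
    by (intro nn_integral_cong) (simp add: hyperbolic_factor_def mem_unit_disc2 indicator_def)
  also have "\<dots> = ennreal pi * (\<integral>\<^sup>+t. (indicator {..<1} t * ennreal ((2 / (1 - t))\<^sup>2) * g t) * indicator {0..} t \<partial>lborel)"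
    by (rule nn_integral_radial) measurable
  also have "\<dots> = (\<integral>\<^sup>+t. ennreal pi * ((indicator {..<1} t * ennreal ((2 / (1 - t))\<^sup>2) * g t) * indicator {0..} t) \<partial>lborel)"
    by (rule nn_integral_cmult[symmetric]) measurable
  also have "\<dots> = (\<integral>\<^sup>+t. g t * ennreal (4 * pi / (1 - t)\<^sup>2) * indicator {0..<1} t \<partial>lborel)"
  proof (rule nn_integral_cong)
    fix t :: real
    have "ennreal (4 * pi / (1 - t)\<^sup>2) = ennreal pi * ennreal ((2 / (1 - t))\<^sup>2)"
      by (subst ennreal_mult'[symmetric]) (auto simp: power_divide mult_ac)
    then show "ennreal pi * ((indicator {..<1} t * ennreal ((2 / (1 - t))\<^sup>2) * g t) * indicator {0..} t)
       = g t * ennreal (4 * pi / (1 - t)\<^sup>2) * indicator {0..<1} t"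
      by (auto simp: mult_ac split: split_indicator)
  qed
  finally show ?thesis .
qed

definition annulus :: "(real^2) set" where
  "annulus = cball 0 1 - ball 0 (1/2)"

lemma sets_annulus [measurable]: "annulus \<in> sets borel"
  by (simp add: annulus_def)

lemma mem_annulus: "z \<in> annulus \<longleftrightarrow> 1/2 \<le> norm z \<and> norm z \<le> 1"
  by (auto simp: annulus_def)

lemma nn_integral_inverse:
  assumes "0 < a" "a \<le> b"
  shows "(\<integral>\<^sup>+s. ennreal (1 / s) * indicator {a..b} s \<partial>lborel) = ennreal (ln (b / a))"
proof -
  have "(\<integral>\<^sup>+s. ennreal (1 / s) * indicator {a..b} s \<partial>lborel) = ennreal (ln b - ln a)"
    using assms by (intro nn_integral_FTC_Icc) (auto intro!: derivative_eq_intros)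
  then show ?thesis using assms by (simp add: ln_div)
qed

text \<open>A substitute for polar coordinates that avoids the circle: the directions are parametrised by the
  points of an annulus, over which every point of the plane is counted with the same total weight
  \<open>ln 2\<close>.\<close>
lemma nn_integral_rays:
  fixes H :: "real^2 \<Rightarrow> ennreal"
  assumes [measurable]: "H \<in> borel_measurable borel"
  shows "(\<integral>\<^sup>+z. indicator annulus z * (\<integral>\<^sup>+s. indicator {0<..} s * ennreal s * H (s *\<^sub>R z) \<partial>lborel) \<partial>lborel)
       = ennreal (ln 2) * (\<integral>\<^sup>+w. H w \<partial>lborel)"
proof -
  have psf: "pair_sigma_finite (lborel :: (real^2) measure) (lborel :: real measure)" ..
  have "(\<integral>\<^sup>+z. indicator annulus z * (\<integral>\<^sup>+s. indicator {0<..} s * ennreal s * H (s *\<^sub>R z) \<partial>lborel) \<partial>lborel)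
      = (\<integral>\<^sup>+z. (\<integral>\<^sup>+s. indicator annulus z * (indicator {0<..} s * ennreal s * H (s *\<^sub>R z)) \<partial>lborel) \<partial>lborel)"
    by (intro nn_integral_cong nn_integral_cmult[symmetric]) measurable
  also have "\<dots> = (\<integral>\<^sup>+s. (\<integral>\<^sup>+z. indicator annulus z * (indicator {0<..} s * ennreal s * H (s *\<^sub>R z)) \<partial>lborel) \<partial>lborel)"
    by (rule pair_sigma_finite.Fubini'[OF psf, symmetric]) measurable
  also have "\<dots> = (\<integral>\<^sup>+s. (\<integral>\<^sup>+w. H w * (indicator {norm w..2 * norm w} s * indicator {0<..} s * ennreal (1 / s)) \<partial>lborel) \<partial>lborel)"
  proof (rule nn_integral_cong)
    fix s :: real
    show "(\<integral>\<^sup>+z. indicator annulus z * (indicator {0<..} s * ennreal s * H (s *\<^sub>R z)) \<partial>lborel) =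
          (\<integral>\<^sup>+w. H w * (indicator {norm w..2 * norm w} s * indicator {0<..} s * ennreal (1 / s)) \<partial>lborel)"
    proof (cases "s > 0")
      case True
      let ?K = "\<lambda>w. indicator {norm w..2 * norm w} s * (ennreal s * H w)"
      have [measurable]: "(\<lambda>w::real^2. indicator {norm w..2 * norm w} s :: ennreal) \<in> borel_measurable borel"
        by (simp add: indicator_def) measurable
      have "(\<integral>\<^sup>+z. indicator annulus z * (indicator {0<..} s * ennreal s * H (s *\<^sub>R z)) \<partial>lborel)
          = (\<integral>\<^sup>+z. ?K (s *\<^sub>R z) \<partial>lborel)"
        using True by (intro nn_integral_cong) (auto simp: mem_annulus field_simps split: split_indicator)
      also have "\<dots> = ennreal (1 / s\<^sup>2) * (\<integral>\<^sup>+w. ?K w \<partial>lborel)"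
        by (rule nn_integral_scale_plane[OF _ True]) measurable
      also have "\<dots> = (\<integral>\<^sup>+w. ennreal (1 / s\<^sup>2) * ?K w \<partial>lborel)"
        by (rule nn_integral_cmult[symmetric]) measurable
      also have "\<dots> = (\<integral>\<^sup>+w. H w * (indicator {norm w..2 * norm w} s * indicator {0<..} s * ennreal (1 / s)) \<partial>lborel)"
      proof (rule nn_integral_cong)
        fix w :: "real^2"
        have "ennreal (1 / s) = ennreal (1 / s\<^sup>2) * ennreal s"
          using True by (subst ennreal_mult'[symmetric]) (auto simp: power2_eq_square)
        then show "ennreal (1 / s\<^sup>2) * ?K w = H w * (indicator {norm w..2 * norm w} s * indicator {0<..} s * ennreal (1 / s))"
          using True by (simp add: mult_ac)
      qed
      finally show ?thesis .
    qed simp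
  qed
  also have "\<dots> = (\<integral>\<^sup>+w. (\<integral>\<^sup>+s. H w * (indicator {norm w..2 * norm w} s * indicator {0<..} s * ennreal (1 / s)) \<partial>lborel) \<partial>lborel)"
    by (rule pair_sigma_finite.Fubini'[OF psf]) (simp add: indicator_def, measurable)
  also have "\<dots> = (\<integral>\<^sup>+w. ennreal (ln 2) * H w \<partial>lborel)"
  proof (rule nn_integral_cong_AE)
    have "AE w in lborel. w \<noteq> (0::real^2)" by (rule AE_lborel_singleton)
    then show "AE w in lborel. (\<integral>\<^sup>+s. H w * (indicator {norm w..2 * norm w} s * indicator {0<..} s * ennreal (1 / s)) \<partial>lborel)
        = ennreal (ln 2) * H w"
    proof eventually_elim
      case (elim w)
      then have "norm w > 0" by simp
      have "(\<integral>\<^sup>+s. H w * (indicator {norm w..2 * norm w} s * indicator {0<..} s * ennreal (1 / s)) \<partial>lborel)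
          = H w * (\<integral>\<^sup>+s. (indicator {norm w..2 * norm w} s * indicator {0<..} s * ennreal (1 / s)) \<partial>lborel)"
        by (rule nn_integral_cmult) measurable
      also have "(\<integral>\<^sup>+s. (indicator {norm w..2 * norm w} s * indicator {0<..} s * ennreal (1 / s)) \<partial>lborel)
         = (\<integral>\<^sup>+s. ennreal (1 / s) * indicator {norm w..2 * norm w} s \<partial>lborel)"
        using \<open>norm w > 0\<close> by (intro nn_integral_cong) (auto split: split_indicator)
      also have "\<dots> = ennreal (ln 2)"
        using \<open>norm w > 0\<close> by (subst nn_integral_inverse) auto
      finally show ?case by (simp add: mult.commute)
    qed
  qed
  also have "\<dots> = ennreal (ln 2) * (\<integral>\<^sup>+w. H w \<partial>lborel)"
    by (rule nn_integral_cmult) measurable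
  finally show ?thesis .
qed

lemma nn_integral_annulus_inverse_square:
  "(\<integral>\<^sup>+z. indicator annulus z * ennreal (1 / (norm z)\<^sup>2) \<partial>lborel) = ennreal (2 * pi * ln 2)"
proof -
  have "(\<integral>\<^sup>+z. indicator annulus z * ennreal (1 / (norm z)\<^sup>2) \<partial>lborel)
      = (\<integral>\<^sup>+z. (\<lambda>t. ennreal (1 / t) * indicator {1/4..1} t) ((norm (z::real^2))\<^sup>2) \<partial>lborel)"
  proof (rule nn_integral_cong)
    fix z :: "real^2"
    have "z \<in> annulus \<longleftrightarrow> (norm z)\<^sup>2 \<in> {1/4..1}"
      using abs_le_square_iff[of "1/2" "norm z"] abs_le_square_iff[of "norm z" 1]
      by (simp add: mem_annulus power_divide)
    then show "indicator annulus z * ennreal (1 / (norm z)\<^sup>2) = ennreal (1 / (norm z)\<^sup>2) * indicator {1/4..1} ((norm z)\<^sup>2)"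
      by (auto split: split_indicator)
  qed
  also have "\<dots> = ennreal pi * (\<integral>\<^sup>+t. (ennreal (1 / t) * indicator {1/4..1} t) * indicator {0..} t \<partial>lborel)"
    by (rule nn_integral_radial) measurable
  also have "(\<integral>\<^sup>+t. (ennreal (1 / t) * indicator {1/4..1} t) * indicator {0..} t \<partial>lborel)
     = (\<integral>\<^sup>+t. ennreal (1 / t) * indicator {1/4..1} t \<partial>lborel)"
    by (intro nn_integral_cong) (auto split: split_indicator)
  also have "\<dots> = ennreal (ln 4)" by (subst nn_integral_inverse) auto
  also have "ln (4::real) = 2 * ln 2" using ln_realpow[of 2 2] by simp
  finally show ?thesis by (simp add: ennreal_mult'[symmetric] mult_ac)
qed

section \<open>Functions on the disc and their variation along curves\<close>

lemma nn_integral_continuous_interval: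
  fixes f :: "real \<Rightarrow> real"
  assumes "continuous_on {p..q} f" "\<And>s. s \<in> {p..q} \<Longrightarrow> 0 \<le> f s"
  shows "(\<integral>\<^sup>+s. ennreal (f s) * indicator {p..q} s \<partial>lborel) = ennreal (integral {p..q} f)"
  using integrable_continuous_real[OF assms(1)] assms(2)
  by (intro nn_integral_has_integral_lebesgue') (auto simp: has_integral_integral)

text \<open>Between the last point where \<open>w\<close> has the height \<open>min (w 0) b\<close> and the first point after it where
  it has the height \<open>a\<close>, the values of \<open>w\<close> stay strictly between the two heights, and the variation of
  \<open>w\<close> there already pays for the difference. The truncated function is never differentiated.\<close>
lemma truncation_le_variation_nonneg:
  fixes w w' :: "real \<Rightarrow> real"
  assumes S: "0 \<le> S"
    and der: "\<And>s. s \<in> {0..S} \<Longrightarrow> (w has_real_derivative w' s) (at s)"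
    and cont: "continuous_on {0..S} w'"
    and zero: "w S = 0" and ab: "0 \<le> a" "a < b"
  shows "ennreal (min (max (w 0 - a) 0) (b - a))
      \<le> (\<integral>\<^sup>+s. indicator {s \<in> {0..S}. a < \<bar>w s\<bar> \<and> \<bar>w s\<bar> < b} s * ennreal \<bar>w' s\<bar> \<partial>lborel)"
proof (cases "w 0 > a")
  case False
  then have "min (max (w 0 - a) 0) (b - a) = 0" using ab by auto
  then show ?thesis by simp
next
  case True
  define \<beta> where "\<beta> = min (w 0) b"
  have \<beta>: "a < \<beta>" "\<beta> \<le> w 0" "\<beta> \<le> b" using True ab by (auto simp: \<beta>_def)
  have cw: "continuous_on {0..S} w"
    using der by (meson DERIV_isCont continuous_at_imp_continuous_on)
  have lvl: "compact {s \<in> {0..T}. w s = c}" if "T \<le> S" for T c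
  proof -
    have "continuous_on {0..T} w" using cw that by (auto intro: continuous_on_subset)
    then have "closed {s \<in> {0..T}. w s = c}"
      by (intro continuous_closed_preimage_constant) auto
    moreover have "bounded {s \<in> {0..T}. w s = c}"
      by (rule bounded_subset[OF bounded_closed_interval[of 0 T]]) auto
    ultimately show ?thesis by (simp add: compact_eq_bounded_closed)
  qed
  have "\<exists>s\<ge>0. s \<le> S \<and> w s = a"
    using IVT2'[of w S a 0] True zero ab S cw by auto
  then have ne: "{s \<in> {0..S}. w s = a} \<noteq> {}" by auto
  have "compact {s \<in> {0..S}. w s = a}"
    using lvl[of S a] S by simp
  then obtain q where q: "q \<in> {0..S}" "w q = a" and qmin: "\<And>s. s \<in> {0..S} \<Longrightarrow> w s = a \<Longrightarrow> q \<le> s"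
    using compact_attains_inf[OF _ ne] by auto
  have "\<exists>s\<ge>0. s \<le> q \<and> w s = \<beta>"
    by (rule IVT2') (use \<beta> q in \<open>simp_all add: continuous_on_subset[OF cw]\<close>)
  then have ne2: "{s \<in> {0..q}. w s = \<beta>} \<noteq> {}" by auto
  obtain p where p: "p \<in> {0..q}" "w p = \<beta>" and pmax: "\<And>s. s \<in> {0..q} \<Longrightarrow> w s = \<beta> \<Longrightarrow> s \<le> p"
    using compact_attains_sup[OF lvl ne2] q by auto
  have sub: "{p..q} \<subseteq> {0..S}" using p q by auto
  have between: "a < w s \<and> w s < \<beta>" if s: "s \<in> {p<..<q}" for s
  proof
    show "a < w s"
    proof (rule ccontr)
      assume "\<not> a < w s"
      then have "\<exists>t\<ge>0. t \<le> s \<and> w t = a"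
        by (intro IVT2' continuous_on_subset[OF cw]) (use True s p q in simp_all)
      then obtain t where "0 \<le> t" "t \<le> s" "w t = a" by auto
      then show False using qmin[of t] s p q by simp
    qed
    show "w s < \<beta>"
    proof (rule ccontr)
      assume "\<not> w s < \<beta>"
      then have "\<exists>t\<ge>s. t \<le> q \<and> w t = \<beta>"
        by (intro IVT2' continuous_on_subset[OF cw]) (use \<beta> s p q in simp_all)
      then obtain t where "s \<le> t" "t \<le> q" "w t = \<beta>" by auto
      then show False using pmax[of t] s p q by simp
    qed
  qed
  have cw': "continuous_on {p..q} w'" using cont sub by (rule continuous_on_subset)
  have "(w' has_integral (w q - w p)) {p..q}"
    using p q der sub
    by (intro fundamental_theorem_of_calculus)
       (auto simp: has_real_derivative_iff_has_vector_derivative[symmetric] intro: has_field_derivative_at_within)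
  then have "\<beta> - a = - integral {p..q} w'" using p q by (simp add: integral_unique)
  also have "\<dots> \<le> integral {p..q} (\<lambda>s. \<bar>w' s\<bar>)"
  proof -
    have "norm (integral {p..q} w') \<le> integral {p..q} (\<lambda>s. \<bar>w' s\<bar>)"
      using cw' by (intro integral_norm_bound_integral integrable_continuous_real continuous_intros) auto
    then show ?thesis by simp
  qed
  finally have "ennreal (\<beta> - a) \<le> ennreal (integral {p..q} (\<lambda>s. \<bar>w' s\<bar>))"
    by (rule ennreal_leI)
  also have "\<dots> = (\<integral>\<^sup>+s. ennreal \<bar>w' s\<bar> * indicator {p..q} s \<partial>lborel)"
    using cw' by (intro nn_integral_continuous_interval[symmetric]) (auto intro!: continuous_intros)
  also have "\<dots> \<le> (\<integral>\<^sup>+s. indicator {s \<in> {0..S}. a < \<bar>w s\<bar> \<and> \<bar>w s\<bar> < b} s * ennreal \<bar>w' s\<bar> \<partial>lborel)"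
  proof (rule nn_integral_mono_AE)
    have "AE s in lborel. s \<noteq> p" "AE s in lborel. s \<noteq> q" by (rule AE_lborel_singleton)+
    then show "AE s in lborel. ennreal \<bar>w' s\<bar> * indicator {p..q} s
        \<le> indicator {s \<in> {0..S}. a < \<bar>w s\<bar> \<and> \<bar>w s\<bar> < b} s * ennreal \<bar>w' s\<bar>"
    proof eventually_elim
      case (elim s)
      show ?case
      proof (cases "s \<in> {p..q}")
        case True
        then have "a < w s \<and> w s < \<beta>" using between elim by auto
        then show ?thesis using True sub \<beta> ab by (auto split: split_indicator)
      qed simp
    qed
  qed
  finally show ?thesis
    using True ab by (simp add: \<beta>_def min_def max_def split: if_splits)
qed

lemma truncation_le_variation:
  fixes w w' :: "real \<Rightarrow> real"
  assumes S: "0 \<le> S"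
    and der: "\<And>s. s \<in> {0..S} \<Longrightarrow> (w has_real_derivative w' s) (at s)"
    and cont: "continuous_on {0..S} w'"
    and zero: "w S = 0" and ab: "0 \<le> a" "a < b"
  shows "ennreal (min (max (\<bar>w 0\<bar> - a) 0) (b - a))
      \<le> (\<integral>\<^sup>+s. indicator {s \<in> {0..S}. a < \<bar>w s\<bar> \<and> \<bar>w s\<bar> < b} s * ennreal \<bar>w' s\<bar> \<partial>lborel)"
proof (cases "w 0 \<ge> 0")
  case True
  then show ?thesis using truncation_le_variation_nonneg[OF assms] by simp
next
  case False
  have "((\<lambda>s. - w s) has_real_derivative - w' s) (at s)" if "s \<in> {0..S}" for s
    using der[OF that] by (rule DERIV_minus)
  from truncation_le_variation_nonneg[OF S this _ _ ab] False cont zero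
  show ?thesis by (simp add: continuous_on_minus)
qed

lemma GDERIV_grad:
  fixes u :: "'a::euclidean_space \<Rightarrow> real"
  assumes "u differentiable (at x)"
  shows "GDERIV u x :> grad u x"
proof -
  obtain L where L: "(u has_derivative L) (at x)" using assms by (auto simp: differentiable_def)
  have "L h = h \<bullet> adjoint L 1" for h
    using adjoint_works[OF has_derivative_linear[OF L], of h 1] by simp
  then have "L = (\<lambda>h. h \<bullet> adjoint L 1)" by (rule ext)
  then obtain d where d: "L = (\<lambda>h. h \<bullet> d)" by (rule that)
  then have D: "GDERIV u x :> d" using L by (simp add: gderiv_def)
  have "e = d" if "GDERIV u x :> e" for e
  proof -
    have "(\<lambda>h. h \<bullet> e) = (\<lambda>h. h \<bullet> d)"
      using has_derivative_unique[OF that[unfolded gderiv_def] D[unfolded gderiv_def]] .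
    then have "h \<bullet> e = h \<bullet> d" for h by (rule fun_cong)
    then show ?thesis using vector_eq_ldot[of e d] vector_eq_rdot[of e d] by blast
  qed
  with D have "grad u x = d" unfolding grad_def by (rule the_equality)
  with D show ?thesis by simp
qed

text \<open>What the estimates use of a test function: a continuous gradient, and zeros near the boundary.\<close>
locale disc_function =
  fixes u :: "real^2 \<Rightarrow> real" and R :: real
  assumes GDERIV: "x \<in> unit_disc \<Longrightarrow> GDERIV u x :> grad u x"
    and continuous_grad: "continuous_on unit_disc (grad u)"
    and R: "0 \<le> R" "R < 1"
    and vanishes: "R \<le> norm x \<Longrightarrow> u x = 0"

lemma test_function_disc_function:
  assumes "u \<in> test_functions unit_disc"
  obtains R where "disc_function u R"
proof -
  have sm: "smooth_on u unit_disc" and c: "compact (closure (support_on UNIV u))"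
    and sub: "closure (support_on UNIV u) \<subseteq> unit_disc"
    using assms by (auto simp: test_functions_def)
  have 1: "Ck_on (Suc 0) u unit_disc" using sm by (auto simp: smooth_on_def)
  have G: "GDERIV u x :> grad u x" if "x \<in> unit_disc" for x
    using 1 that by (intro GDERIV_grad) auto
  have "continuous_on unit_disc (\<lambda>x. grad u x \<bullet> v)" for v
  proof -
    have "continuous_on unit_disc (\<lambda>x. frechet_derivative u (at x) v)" using 1 by auto
    then show ?thesis
    proof (rule continuous_on_eq)
      fix x assume "x \<in> unit_disc"
      then have "(u has_derivative (\<lambda>h. h \<bullet> grad u x)) (at x)" using G by (simp add: gderiv_def)
      then have "frechet_derivative u (at x) = (\<lambda>h. h \<bullet> grad u x)" by (rule frechet_derivative_at[symmetric])
      then show "frechet_derivative u (at x) v = grad u x \<bullet> v" by (simp add: inner_commute)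
    qed
  qed
  then have cg: "continuous_on unit_disc (grad u)"
    by (subst continuous_on_componentwise) auto
  have "\<exists>R\<in>{0..<1}. \<forall>x. R \<le> norm x \<longrightarrow> u x = 0"
  proof (cases "closure (support_on UNIV u) = {}")
    case True
    then have "u x = 0" for x by (auto simp: support_on_def)
    then show ?thesis by (intro bexI[of _ 0]) auto
  next
    case False
    obtain y where y: "y \<in> closure (support_on UNIV u)"
      and ymax: "\<And>x. x \<in> closure (support_on UNIV u) \<Longrightarrow> norm x \<le> norm y"
      using continuous_attains_sup[OF c False, of norm] by (auto intro: continuous_intros)
    have "norm y < 1" using y sub by (auto simp: mem_unit_disc)
    moreover have "u x = 0" if "(norm y + 1) / 2 \<le> norm x" for x
    proof (rule ccontr)
      assume "u x \<noteq> 0"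
      then have "x \<in> support_on UNIV u" by (simp add: support_on_def)
      then have "x \<in> closure (support_on UNIV u)" by (rule subsetD[OF closure_subset])
      then show False using ymax[of x] that calculation by simp
    qed
    ultimately show ?thesis by (intro bexI[of _ "(norm y + 1) / 2"]) (auto simp: add_nonneg_nonneg)
  qed
  then obtain R where "0 \<le> R" "R < 1" "\<And>x. R \<le> norm x \<Longrightarrow> u x = 0" by auto
  then have "disc_function u R" using G cg by unfold_locales auto
  then show thesis by (rule that)
qed

text \<open>The length of the gradient in the hyperbolic metric.\<close>
definition hgrad :: "(real^2 \<Rightarrow> real) \<Rightarrow> real^2 \<Rightarrow> real" where
  "hgrad u y = indicator unit_disc y * (norm (grad u y) * (1 - (norm y)\<^sup>2) / 2)"

text \<open>The length of the hyperbolic gradient of the Green function, \<open>1 / (2 \<pi> sinh d)\<close> in terms of the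
  hyperbolic distance \<open>d\<close>.\<close>
definition hkernel :: "real^2 \<Rightarrow> real^2 \<Rightarrow> real" where
  "hkernel x y = (1 - psd x y) / (4 * pi * sqrt (psd x y))"

lemma measurable_psd [measurable (raw)]:
  assumes [measurable]: "f \<in> borel_measurable M" "g \<in> borel_measurable M"
  shows "(\<lambda>z. psd (f z) (g z)) \<in> borel_measurable M"
  unfolding psd_def by measurable

lemma measurable_hkernel [measurable (raw)]:
  assumes [measurable]: "f \<in> borel_measurable M" "g \<in> borel_measurable M"
  shows "(\<lambda>z. hkernel (f z) (g z)) \<in> borel_measurable M"
  unfolding hkernel_def by measurable

context disc_function begin

lemma in_disc_if_nonzero: "u x \<noteq> 0 \<Longrightarrow> x \<in> unit_disc"
  using vanishes[of x] R by (force simp: mem_unit_disc)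

lemma continuous_on_disc: "continuous_on unit_disc u"
  using GDERIV by (meson continuous_at_imp_continuous_on gderiv_def has_derivative_continuous)

lemma measurable_u [measurable]: "u \<in> borel_measurable borel"
proof -
  have "(\<lambda>x. indicator unit_disc x *\<^sub>R u x) \<in> borel_measurable borel"
    by (rule borel_measurable_continuous_on_indicator[OF _ continuous_on_disc]) simp
  moreover have "(\<lambda>x. indicator unit_disc x *\<^sub>R u x) = u"
    using in_disc_if_nonzero by (auto simp: indicator_def fun_eq_iff)
  ultimately show ?thesis by simp
qed

lemma measurable_hgrad [measurable]: "hgrad u \<in> borel_measurable borel"
proof -
  have g: "(\<lambda>x. indicator unit_disc x *\<^sub>R grad u x) \<in> borel_measurable borel"
    by (rule borel_measurable_continuous_on_indicator[OF _ continuous_grad]) simp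
  have eq: "hgrad u = (\<lambda>y. norm (indicator unit_disc y *\<^sub>R grad u y) * (1 - (norm y)\<^sup>2) / 2)"
    by (auto simp: hgrad_def indicator_def fun_eq_iff)
  have "(\<lambda>y. norm (g y) * (1 - (norm y)\<^sup>2) / 2) \<in> borel_measurable borel"
    if [measurable]: "g \<in> borel_measurable borel" for g :: "real^2 \<Rightarrow> real^2"
    by measurable
  from this[OF g] show ?thesis unfolding eq .
qed

lemma hgrad_nonneg: "0 \<le> hgrad u y"
  by (auto simp: hgrad_def mem_unit_disc2 indicator_def)

end

text \<open>Conformal invariance of the Dirichlet integral.\<close>
lemma nn_integral_hgrad_square:
  "(\<integral>\<^sup>+x. ennreal ((hgrad u x)\<^sup>2) \<partial>hvol) = (\<integral>\<^sup>+x\<in>unit_disc. ennreal ((norm (grad u x))\<^sup>2) \<partial>lborel)"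
  if "hgrad u \<in> borel_measurable borel"
proof -
  note [measurable] = that
  have "(\<integral>\<^sup>+x. ennreal ((hgrad u x)\<^sup>2) \<partial>hvol)
      = (\<integral>\<^sup>+x. indicator unit_disc x * ennreal (hyperbolic_factor x) * ennreal ((hgrad u x)\<^sup>2) \<partial>lborel)"
    by (rule nn_integral_hvol) measurable
  also have "\<dots> = (\<integral>\<^sup>+x\<in>unit_disc. ennreal ((norm (grad u x))\<^sup>2) \<partial>lborel)"
  proof (rule nn_integral_cong)
    fix x :: "real^2"
    show "indicator unit_disc x * ennreal (hyperbolic_factor x) * ennreal ((hgrad u x)\<^sup>2)
        = ennreal ((norm (grad u x))\<^sup>2) * indicator unit_disc x"
    proof (cases "x \<in> unit_disc")
      case True
      then have "1 - (norm x)\<^sup>2 \<noteq> 0" by (auto simp: mem_unit_disc2)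
      then have "hyperbolic_factor x * (hgrad u x)\<^sup>2 = (norm (grad u x))\<^sup>2"
        using True by (simp add: hyperbolic_factor_def hgrad_def power_mult_distrib power_divide)
      then show ?thesis using True by (simp add: ennreal_mult'[symmetric] hyperbolic_factor_def)
    qed simp
  qed
  finally show ?thesis .
qed

lemma linear_of_C: "linear of_C" and linear_to_C: "linear to_C"
  using bounded_linear_of_C bounded_linear_to_C by (auto intro: bounded_linear.linear)

context disc_function begin

lemma has_real_derivative_ray:
  assumes "(\<gamma> has_vector_derivative v) (at s)" "\<gamma> s \<in> unit_disc"
  shows "((\<lambda>s. u (\<gamma> s)) has_real_derivative (v \<bullet> grad u (\<gamma> s))) (at s)"
proof -
  have "((\<lambda>s. u (\<gamma> s)) has_derivative (\<lambda>h. (h *\<^sub>R v) \<bullet> grad u (\<gamma> s))) (at s)"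
    using has_derivative_compose[OF assms(1)[unfolded has_vector_derivative_def] GDERIV[OF assms(2), unfolded gderiv_def]] .
  then show ?thesis unfolding has_field_derivative_def by (simp add: mult_commute_abs)
qed

text \<open>Integrate the derivative of \<open>w(s)\<^sup>2 s\<^sup>2 / (1 - s\<^sup>2\<bar>z\<bar>\<^sup>2)\<close> along the ray: it vanishes at both ends, so the
  integral is zero. The mixed term \<open>2 w w\<^sup>\<prime>\<close> is absorbed by completing a square, which produces
  exactly the two sides of the claim.\<close>
lemma hardy_ray:
  assumes z: "z \<in> annulus"
  defines "H1 \<equiv> \<lambda>y. indicator unit_disc y * ennreal ((u y)\<^sup>2 / (1 - (norm y)\<^sup>2)\<^sup>2)"
    and "H2 \<equiv> \<lambda>y. indicator unit_disc y * ennreal ((norm (grad u y))\<^sup>2)"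
  shows "(\<integral>\<^sup>+s. indicator {0<..} s * ennreal s * H1 (s *\<^sub>R z) \<partial>lborel)
       \<le> (\<integral>\<^sup>+s. indicator {0<..} s * ennreal s * H2 (s *\<^sub>R z) \<partial>lborel)"
proof -
  define \<rho> where "\<rho> = norm z"
  have \<rho>: "1/2 \<le> \<rho>" "\<rho> \<le> 1" using z by (auto simp: mem_annulus \<rho>_def)
  \<comment> \<open>Beyond the parameter \<open>S\<close> the ray has left the support.\<close>
  define S where "S = R / \<rho>"
  have S: "0 \<le> S" "S * \<rho> = R" using \<rho> R by (auto simp: S_def)
  define w where "w = (\<lambda>s. u (s *\<^sub>R z))"
  define w' where "w' = (\<lambda>s. z \<bullet> grad u (s *\<^sub>R z))"
  have sd: "s * \<rho> \<le> R" if "s \<in> {0..S}" for s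
    using that \<rho> mult_right_mono[of s S \<rho>] S by simp
  have sd1: "s * \<rho> < 1" if "s \<in> {0..S}" for s using sd[OF that] R by simp
  have sd2: "(s * \<rho>)\<^sup>2 < 1" if "s \<in> {0..S}" for s
    using sd1[OF that] that \<rho> by (auto simp: power_less_one_iff)
  have disc: "s *\<^sub>R z \<in> unit_disc" if "s \<in> {0..S}" for s
    using sd1[OF that] that by (simp add: mem_unit_disc \<rho>_def)
  have der: "(w has_real_derivative w' s) (at s)" if "s \<in> {0..S}" for s
    unfolding w_def w'_def
    by (rule has_real_derivative_ray[where \<gamma>="\<lambda>s. s *\<^sub>R z", OF _ disc[OF that]]) (auto intro!: derivative_eq_intros)
  have cw: "continuous_on {0..S} w" using der by (meson DERIV_isCont continuous_at_imp_continuous_on)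
  have cw': "continuous_on {0..S} w'"
    unfolding w'_def using disc
    by (intro continuous_intros continuous_on_compose2[OF continuous_grad]) auto
  \<comment> \<open>\<open>f1\<close> and \<open>f2\<close> are the integrands of the two sides, and \<open>F\<close> is the function to be differentiated.\<close>
  define f1 where "f1 = (\<lambda>s. s * (w s)\<^sup>2 / (1 - (s * \<rho>)\<^sup>2)\<^sup>2)"
  define f2 where "f2 = (\<lambda>s. s ^ 3 * (w' s)\<^sup>2)"
  define F where "F = (\<lambda>s. (w s)\<^sup>2 * (s\<^sup>2 / (1 - (s * \<rho>)\<^sup>2)))"
  define F' where "F' = (\<lambda>s. 2 * w s * w' s * (s\<^sup>2 / (1 - (s * \<rho>)\<^sup>2)) + (w s)\<^sup>2 * (2 * s / (1 - (s * \<rho>)\<^sup>2)\<^sup>2))"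
  have "(F has_real_derivative F' s) (at s)" if "s \<in> {0..S}" for s
  proof -
    have n: "1 - (s * \<rho>)\<^sup>2 \<noteq> 0" using sd2[OF that] by simp
    have "((\<lambda>s. s\<^sup>2 / (1 - (s * \<rho>)\<^sup>2)) has_real_derivative (2 * s / (1 - (s * \<rho>)\<^sup>2)\<^sup>2)) (at s)"
    proof -
      have "((\<lambda>s. s\<^sup>2 / (1 - (s * \<rho>)\<^sup>2)) has_real_derivative
          ((2 * s) * (1 - (s * \<rho>)\<^sup>2) - s\<^sup>2 * (- (2 * (s * \<rho>) * \<rho>))) / ((1 - (s * \<rho>)\<^sup>2) * (1 - (s * \<rho>)\<^sup>2))) (at s)"
        using n by (auto intro!: derivative_eq_intros)
      moreover have "(2 * s) * (1 - (s * \<rho>)\<^sup>2) - s\<^sup>2 * (- (2 * (s * \<rho>) * \<rho>)) = 2 * s"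
        by (simp add: power2_eq_square algebra_simps)
      ultimately show ?thesis by (simp add: power2_eq_square)
    qed
    from DERIV_mult[OF DERIV_mult[OF der[OF that] der[OF that]] this]
    show ?thesis unfolding F_def F'_def power2_eq_square[of "w _"] by (simp add: algebra_simps)
  qed
  then have "(F' has_integral (F S - F 0)) {0..S}"
    using S by (intro fundamental_theorem_of_calculus)
       (auto simp: has_real_derivative_iff_has_vector_derivative[symmetric] intro: has_field_derivative_at_within)
  moreover have "F S - F 0 = 0"
  proof -
    have "w S = 0" unfolding w_def using S R by (intro vanishes) (simp add: \<rho>_def[symmetric])
    then show ?thesis by (simp add: F_def)
  qed
  ultimately have F': "(F' has_integral 0) {0..S}" by simp
  have nz: "1 - (s * \<rho>)\<^sup>2 \<noteq> 0" if "s \<in> {0..S}" for s using sd2[OF that] by simp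
  have i1: "continuous_on {0..S} f1" unfolding f1_def
    using nz by (intro continuous_intros cw) auto
  have i2: "continuous_on {0..S} f2" unfolding f2_def by (intro continuous_intros cw')
  have "f1 s - f2 s \<le> F' s" if s: "s \<in> {0..S}" for s
  proof -
    define i where "i = 1 / (1 - (s * \<rho>)\<^sup>2)"
    have "0 \<le> s * (w s * i + s * w' s)\<^sup>2" using s by simp
    also have "\<dots> = (2 * w s * w' s * (s\<^sup>2 * i) + (w s)\<^sup>2 * (2 * s * i\<^sup>2)) - (s * (w s)\<^sup>2 * i\<^sup>2 - s ^ 3 * (w' s)\<^sup>2)"
      by (simp add: algebra_simps power2_eq_square power3_eq_cube)
    also have "\<dots> = F' s - (f1 s - f2 s)"
      by (simp add: F'_def f1_def f2_def i_def power_divide)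
    finally show ?thesis by simp
  qed
  moreover have i12: "(\<lambda>s. f1 s - f2 s) integrable_on {0..S}"
    by (intro integrable_continuous_real continuous_intros i1 i2)
  ultimately have "integral {0..S} (\<lambda>s. f1 s - f2 s) \<le> 0"
    using has_integral_le[OF integrable_integral[OF i12] F'] by blast
  then have le: "integral {0..S} f1 \<le> integral {0..S} f2"
    using i1 i2 by (simp add: integral_diff integrable_continuous_real)
  have "(\<integral>\<^sup>+s. indicator {0<..} s * ennreal s * H1 (s *\<^sub>R z) \<partial>lborel)
      \<le> (\<integral>\<^sup>+s. ennreal (f1 s) * indicator {0..S} s \<partial>lborel)"
  proof (rule nn_integral_mono)
    fix s :: real
    show "indicator {0<..} s * ennreal s * H1 (s *\<^sub>R z) \<le> ennreal (f1 s) * indicator {0..S} s"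
    proof (cases "s \<in> {0..S}")
      case True
      then have "ennreal s * H1 (s *\<^sub>R z) = ennreal (f1 s)"
        using disc[OF True] by (simp add: H1_def f1_def w_def \<rho>_def ennreal_mult'[symmetric])
      then show ?thesis using True by (auto split: split_indicator)
    next
      case False
      show ?thesis
      proof (cases "s > 0")
        case True
        then have "S \<le> s" using False by auto
        then have "R \<le> s * \<rho>" using S \<rho> mult_right_mono[of S s \<rho>] by simp
        then have "u (s *\<^sub>R z) = 0" using True by (intro vanishes) (simp add: \<rho>_def)
        then show ?thesis by (simp add: H1_def)
      qed simp
    qed
  qed
  also have "\<dots> = ennreal (integral {0..S} f1)"
    by (rule nn_integral_continuous_interval[OF i1]) (auto simp: f1_def)
  also have "\<dots> \<le> ennreal (integral {0..S} f2)" using le by (rule ennreal_leI)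
  also have "\<dots> = (\<integral>\<^sup>+s. ennreal (f2 s) * indicator {0..S} s \<partial>lborel)"
    by (rule nn_integral_continuous_interval[OF i2, symmetric]) (auto simp: f2_def)
  also have "\<dots> \<le> (\<integral>\<^sup>+s. indicator {0<..} s * ennreal s * H2 (s *\<^sub>R z) \<partial>lborel)"
  proof (rule nn_integral_mono)
    fix s :: real
    show "ennreal (f2 s) * indicator {0..S} s \<le> indicator {0<..} s * ennreal s * H2 (s *\<^sub>R z)"
    proof (cases "s \<in> {0..S} \<and> s > 0")
      case True
      then have s: "s \<in> {0..S}" "s > 0" by auto
      have "\<bar>w' s\<bar> \<le> \<rho> * norm (grad u (s *\<^sub>R z))"
        unfolding w'_def \<rho>_def by (rule Cauchy_Schwarz_ineq2)
      then have "(w' s)\<^sup>2 \<le> (\<rho> * norm (grad u (s *\<^sub>R z)))\<^sup>2"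
        using power_mono[of "\<bar>w' s\<bar>" _ 2] by simp
      then have "s\<^sup>2 * (w' s)\<^sup>2 \<le> s\<^sup>2 * (\<rho> * norm (grad u (s *\<^sub>R z)))\<^sup>2"
        by (rule mult_left_mono) simp
      also have "\<dots> = (s * \<rho>)\<^sup>2 * (norm (grad u (s *\<^sub>R z)))\<^sup>2" by (simp add: power_mult_distrib)
      also have "\<dots> \<le> 1 * (norm (grad u (s *\<^sub>R z)))\<^sup>2"
        using sd2[OF s(1)] by (intro mult_right_mono) auto
      finally have "s * (s\<^sup>2 * (w' s)\<^sup>2) \<le> s * (norm (grad u (s *\<^sub>R z)))\<^sup>2"
        using s by (intro mult_left_mono) auto
      then have "f2 s \<le> s * (norm (grad u (s *\<^sub>R z)))\<^sup>2"
        by (simp add: f2_def power3_eq_cube power2_eq_square mult_ac)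
      then show ?thesis using s disc[OF s(1)]
        by (simp add: H2_def ennreal_mult'[symmetric] ennreal_leI)
    qed (auto simp: f2_def split: split_indicator)
  qed
  finally show ?thesis .
qed

text \<open>The bottom of the spectrum of the hyperbolic plane is \<open>1/4\<close>; it suffices to sum the one-dimensional
  inequality over all rays.\<close>
lemma poincare:
  "(\<integral>\<^sup>+x. ennreal ((u x)\<^sup>2) \<partial>hvol) \<le> 4 * (\<integral>\<^sup>+x\<in>unit_disc. ennreal ((norm (grad u x))\<^sup>2) \<partial>lborel)"
proof -
  define H1 where "H1 = (\<lambda>y. indicator unit_disc y * ennreal ((u y)\<^sup>2 / (1 - (norm y)\<^sup>2)\<^sup>2))"
  define H2 where "H2 = (\<lambda>y. indicator unit_disc y * ennreal ((norm (grad u y))\<^sup>2))"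
  have [measurable]: "H1 \<in> borel_measurable borel" unfolding H1_def by measurable
  have [measurable]: "H2 \<in> borel_measurable borel"
  proof -
    have *: "H2 = (\<lambda>y. ennreal ((norm (indicator unit_disc y *\<^sub>R grad u y))\<^sup>2))"
      by (auto simp: H2_def fun_eq_iff indicator_def)
    have "(\<lambda>x. indicator unit_disc x *\<^sub>R grad u x) \<in> borel_measurable borel"
      by (rule borel_measurable_continuous_on_indicator[OF _ continuous_grad]) simp
    then show ?thesis unfolding * by (rule measurable_compose) measurable
  qed
  have "ennreal (ln 2) * (\<integral>\<^sup>+w. H1 w \<partial>lborel) \<le> ennreal (ln 2) * (\<integral>\<^sup>+w. H2 w \<partial>lborel)"
    unfolding nn_integral_rays[OF \<open>H1 \<in> _\<close>, symmetric] nn_integral_rays[OF \<open>H2 \<in> _\<close>, symmetric]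
  proof (rule nn_integral_mono)
    fix z :: "real^2"
    show "indicator annulus z * (\<integral>\<^sup>+s. indicator {0<..} s * ennreal s * H1 (s *\<^sub>R z) \<partial>lborel)
        \<le> indicator annulus z * (\<integral>\<^sup>+s. indicator {0<..} s * ennreal s * H2 (s *\<^sub>R z) \<partial>lborel)"
      using hardy_ray[of z] unfolding H1_def H2_def by (auto split: split_indicator)
  qed
  then have "ennreal (1 / ln 2) * (ennreal (ln 2) * (\<integral>\<^sup>+w. H1 w \<partial>lborel)) \<le> ennreal (1 / ln 2) * (ennreal (ln 2) * (\<integral>\<^sup>+w. H2 w \<partial>lborel))"
    by (rule mult_left_mono) simp
  then have le: "(\<integral>\<^sup>+w. H1 w \<partial>lborel) \<le> (\<integral>\<^sup>+w. H2 w \<partial>lborel)"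
    by (simp add: mult.assoc[symmetric] ennreal_mult'[symmetric])
  have "(\<integral>\<^sup>+x. ennreal ((u x)\<^sup>2) \<partial>hvol)
      = (\<integral>\<^sup>+x. indicator unit_disc x * ennreal (hyperbolic_factor x) * ennreal ((u x)\<^sup>2) \<partial>lborel)"
    by (rule nn_integral_hvol) measurable
  also have "\<dots> = (\<integral>\<^sup>+x. 4 * H1 x \<partial>lborel)"
  proof (rule nn_integral_cong)
    fix x :: "real^2"
    have "hyperbolic_factor x * (u x)\<^sup>2 = 4 * ((u x)\<^sup>2 / (1 - (norm x)\<^sup>2)\<^sup>2)"
      by (simp add: hyperbolic_factor_def power_divide)
    then have "ennreal (hyperbolic_factor x) * ennreal ((u x)\<^sup>2) = ennreal 4 * ennreal ((u x)\<^sup>2 / (1 - (norm x)\<^sup>2)\<^sup>2)"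
      by (subst (1 2) ennreal_mult'[symmetric]) (simp_all add: hyperbolic_factor_def)
    then show "indicator unit_disc x * ennreal (hyperbolic_factor x) * ennreal ((u x)\<^sup>2) = 4 * H1 x"
      by (auto simp: H1_def split: split_indicator)
  qed
  also have "\<dots> = 4 * (\<integral>\<^sup>+x. H1 x \<partial>lborel)" by (rule nn_integral_cmult) measurable
  also have "\<dots> \<le> 4 * (\<integral>\<^sup>+x. H2 x \<partial>lborel)" using le by (rule mult_left_mono) simp
  finally show ?thesis by (simp add: H2_def mult.commute)
qed

lemma nonzero_bound_moebius:
  assumes x: "x \<in> unit_disc"
  obtains R' where "0 \<le> R'" "R' < 1" "\<And>y. y \<in> unit_disc \<Longrightarrow> R' \<le> norm y \<Longrightarrow> u (disc_moebius x y) = 0"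
proof -
  have sub: "cball 0 R \<subseteq> unit_disc" using R by (auto simp: mem_unit_disc)
  have "continuous_on (cball 0 R) (disc_moebius x)"
    using has_derivative_moebius[OF x] sub by (meson continuous_on_eq_continuous_within has_derivative_continuous subsetD)
  then have "compact (disc_moebius x ` cball 0 R)" by (rule compact_continuous_image) simp
  moreover have "disc_moebius x ` cball 0 R \<noteq> {}" using R by simp
  ultimately obtain y0 where y0: "y0 \<in> disc_moebius x ` cball 0 R"
    and max: "\<And>y. y \<in> disc_moebius x ` cball 0 R \<Longrightarrow> norm y \<le> norm y0"
    using continuous_attains_sup[of "disc_moebius x ` cball 0 R" norm] by (auto intro: continuous_intros)
  have lt: "norm y0 < 1" using y0 sub moebius_in_disc[OF x] by (auto simp: mem_unit_disc[symmetric])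
  have "u (disc_moebius x y) = 0" if "y \<in> unit_disc" "(norm y0 + 1) / 2 \<le> norm y" for y
  proof (rule ccontr)
    assume "u (disc_moebius x y) \<noteq> 0"
    then have "norm (disc_moebius x y) \<le> R" using vanishes[of "disc_moebius x y"] by force
    then have "disc_moebius x (disc_moebius x y) \<in> disc_moebius x ` cball 0 R" by auto
    then have "norm y \<le> norm y0" using max moebius_moebius[OF x that(1)] by metis
    then show False using that lt by simp
  qed
  then show thesis using lt by (intro that[of "(norm y0 + 1) / 2"]) auto
qed

text \<open>The curve is the image of a Euclidean ray under the Moebius map that takes \<open>0\<close> to \<open>x\<close>. The weights
  are arranged so that the right-hand side is the integrand of \<open>nn_integral_rays\<close>.\<close>
lemma truncation_le_ray:
  assumes x: "x \<in> unit_disc" and z: "z \<in> annulus" and ab: "0 \<le> a" "a < b"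
  defines "G \<equiv> \<lambda>y. indicator {y. a < \<bar>u y\<bar> \<and> \<bar>u y\<bar> < b} y * ennreal (hgrad u y)"
  shows "ennreal (1 / (norm z)\<^sup>2) * ennreal (min (max (\<bar>u x\<bar> - a) 0) (b - a)) \<le>
     (\<integral>\<^sup>+s. indicator {0<..} s * ennreal s * (indicator unit_disc (s *\<^sub>R z)
         * ennreal (2 / ((1 - (norm (s *\<^sub>R z))\<^sup>2) * norm (s *\<^sub>R z))) * G (disc_moebius x (s *\<^sub>R z))) \<partial>lborel)"
proof -
  define \<rho> where "\<rho> = norm z"
  have \<rho>: "1/2 \<le> \<rho>" "\<rho> \<le> 1" using z by (auto simp: mem_annulus \<rho>_def)
  obtain R' where R': "0 \<le> R'" "R' < 1" "\<And>y. y \<in> unit_disc \<Longrightarrow> R' \<le> norm y \<Longrightarrow> u (disc_moebius x y) = 0"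
    using nonzero_bound_moebius[OF x] by metis
  \<comment> \<open>Beyond the parameter \<open>S\<close> the curve has left the support.\<close>
  define S where "S = R' / \<rho>"
  have S: "0 \<le> S" "S * \<rho> = R'" using \<rho> R' by (auto simp: S_def)
  have disc: "s *\<^sub>R z \<in> unit_disc" if "s \<in> {0..S}" for s
  proof -
    have "s * \<rho> \<le> S * \<rho>" using that \<rho> by (intro mult_right_mono) auto
    then show ?thesis using S R' that by (simp add: mem_unit_disc \<rho>_def)
  qed
  define w where "w = (\<lambda>s. u (disc_moebius x (s *\<^sub>R z)))"
  define w' where "w' = (\<lambda>s. moebius_deriv x (s *\<^sub>R z) z \<bullet> grad u (disc_moebius x (s *\<^sub>R z)))"
  have path: "((\<lambda>s. disc_moebius x (s *\<^sub>R z)) has_vector_derivative moebius_deriv x (s *\<^sub>R z) z) (at s)" if "s \<in> {0..S}" for s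
  proof -
    have "((\<lambda>s. s *\<^sub>R z) has_vector_derivative z) (at s)" by (auto intro!: derivative_eq_intros)
    from vector_derivative_diff_chain_within[OF this has_derivative_moebius[OF x disc[OF that]]]
    show ?thesis by (simp add: o_def)
  qed
  have der: "(w has_real_derivative w' s) (at s)" if "s \<in> {0..S}" for s
    unfolding w_def w'_def
    by (rule has_real_derivative_ray[OF path[OF that] moebius_in_disc[OF x disc[OF that]]])
  have cw: "continuous_on {0..S} w" using der by (meson DERIV_isCont continuous_at_imp_continuous_on)
  have cpath: "continuous_on {0..S} (\<lambda>s. disc_moebius x (s *\<^sub>R z))"
    using path by (meson continuous_at_imp_continuous_on has_vector_derivative_continuous)
  have cw': "continuous_on {0..S} w'"
  proof -
    have "continuous_on {0..S} (\<lambda>s. moebius_deriv x (s *\<^sub>R z) z)"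
      unfolding moebius_deriv_def
      using denominator_nonzero[OF x disc]
      by (intro linear_continuous_on_compose[OF _ linear_of_C] continuous_intros linear_continuous_on_compose[OF _ linear_to_C]) auto
    moreover have "continuous_on {0..S} (\<lambda>s. grad u (disc_moebius x (s *\<^sub>R z)))"
      using moebius_in_disc[OF x disc] by (intro continuous_on_compose2[OF continuous_grad cpath]) auto
    ultimately show ?thesis unfolding w'_def by (intro continuous_intros)
  qed
  have wS: "w S = 0" unfolding w_def using S R' disc[of S] by (intro R'(3)) (auto simp: \<rho>_def[symmetric])
  have w0: "w 0 = u x" by (simp add: w_def)
  have "ennreal (1 / \<rho>\<^sup>2) * ennreal (min (max (\<bar>u x\<bar> - a) 0) (b - a))
     \<le> ennreal (1 / \<rho>\<^sup>2) * (\<integral>\<^sup>+s. indicator {s \<in> {0..S}. a < \<bar>w s\<bar> \<and> \<bar>w s\<bar> < b} s * ennreal \<bar>w' s\<bar> \<partial>lborel)"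
    using truncation_le_variation[OF S(1) der cw' wS ab] unfolding w0
    by (intro mult_left_mono) auto
  also have "\<dots> = (\<integral>\<^sup>+s. ennreal (1 / \<rho>\<^sup>2) * (indicator {s \<in> {0..S}. a < \<bar>w s\<bar> \<and> \<bar>w s\<bar> < b} s * ennreal \<bar>w' s\<bar>) \<partial>lborel)"
  proof (rule nn_integral_cmult[symmetric])
    have *: "(\<lambda>s. indicator {0..S} s *\<^sub>R w' s) \<in> borel_measurable borel"
      "(\<lambda>s. indicator {0..S} s *\<^sub>R w s) \<in> borel_measurable borel"
      by (rule borel_measurable_continuous_on_indicator[OF _ cw'], simp,
          rule borel_measurable_continuous_on_indicator[OF _ cw], simp)
    have "(\<lambda>s. indicator {s \<in> {0..S}. a < \<bar>w s\<bar> \<and> \<bar>w s\<bar> < b} s * ennreal \<bar>w' s\<bar>)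
       = (\<lambda>s. indicator {t. a < \<bar>t\<bar> \<and> \<bar>t\<bar> < b} (indicator {0..S} s *\<^sub>R w s) * ennreal \<bar>indicator {0..S} s *\<^sub>R w' s\<bar>)"
      using ab by (auto simp: fun_eq_iff split: split_indicator)
    moreover have "\<dots> \<in> borel_measurable lborel"
      using * by measurable
    ultimately show "(\<lambda>s. indicator {s \<in> {0..S}. a < \<bar>w s\<bar> \<and> \<bar>w s\<bar> < b} s * ennreal \<bar>w' s\<bar>) \<in> borel_measurable lborel"
      by simp
  qed
  also have "\<dots> \<le> (\<integral>\<^sup>+s. indicator {0<..} s * ennreal s * (indicator unit_disc (s *\<^sub>R z)
         * ennreal (2 / ((1 - (norm (s *\<^sub>R z))\<^sup>2) * norm (s *\<^sub>R z))) * G (disc_moebius x (s *\<^sub>R z))) \<partial>lborel)"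
  proof (rule nn_integral_mono_AE)
    have "AE s in lborel. s \<noteq> (0::real)" by (rule AE_lborel_singleton)
    then show "AE s in lborel. ennreal (1 / \<rho>\<^sup>2) * (indicator {s \<in> {0..S}. a < \<bar>w s\<bar> \<and> \<bar>w s\<bar> < b} s * ennreal \<bar>w' s\<bar>)
      \<le> indicator {0<..} s * ennreal s * (indicator unit_disc (s *\<^sub>R z)
         * ennreal (2 / ((1 - (norm (s *\<^sub>R z))\<^sup>2) * norm (s *\<^sub>R z))) * G (disc_moebius x (s *\<^sub>R z)))"
    proof eventually_elim
      case (elim s)
      show ?case
      proof (cases "s \<in> {0..S} \<and> a < \<bar>w s\<bar> \<and> \<bar>w s\<bar> < b")
        case True
        then have s: "s \<in> {0..S}" "s > 0" using elim by auto
        define y where "y = s *\<^sub>R z"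
        have y: "y \<in> unit_disc" "norm y = s * \<rho>" using disc[OF s(1)] s by (auto simp: y_def \<rho>_def)
        have ny: "1 - (norm y)\<^sup>2 > 0" using y by (simp add: mem_unit_disc2)
        have G: "G (disc_moebius x y) = ennreal (hgrad u (disc_moebius x y))"
          using True by (simp add: G_def w_def y_def)
        have "\<bar>w' s\<bar> \<le> norm (moebius_deriv x y z) * norm (grad u (disc_moebius x y))"
          unfolding w'_def y_def by (rule Cauchy_Schwarz_ineq2)
        also have "\<dots> = (2 * \<rho> / (1 - (norm y)\<^sup>2)) * hgrad u (disc_moebius x y)"
          unfolding norm_moebius_deriv[OF x y(1)] hgrad_def \<rho>_def
          using moebius_in_disc[OF x y(1)] ny by (simp add: divide_simps)
        finally have "1 / \<rho>\<^sup>2 * \<bar>w' s\<bar> \<le> 1 / \<rho>\<^sup>2 * ((2 * \<rho> / (1 - (norm y)\<^sup>2)) * hgrad u (disc_moebius x y))"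
          by (rule mult_left_mono) simp
        also have "\<dots> = s * (2 / ((1 - (norm y)\<^sup>2) * norm y)) * hgrad u (disc_moebius x y)"
          unfolding y(2) using s \<rho> by (simp add: power2_eq_square)
        finally have "ennreal (1 / \<rho>\<^sup>2 * \<bar>w' s\<bar>) \<le> ennreal (s * (2 / ((1 - (norm y)\<^sup>2) * norm y)) * hgrad u (disc_moebius x y))"
          by (rule ennreal_leI)
        also have "\<dots> = ennreal s * (ennreal (2 / ((1 - (norm y)\<^sup>2) * norm y)) * ennreal (hgrad u (disc_moebius x y)))"
        proof -
          have mult3: "ennreal (A * B * C) = ennreal A * (ennreal B * ennreal C)" if "0 \<le> A" "0 \<le> B" "0 \<le> C" for A B C
            using that by (simp add: ennreal_mult mult.assoc)
          show ?thesis by (rule mult3) (use s ny hgrad_nonneg in auto)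
        qed
        also have "ennreal (1 / \<rho>\<^sup>2 * \<bar>w' s\<bar>) = ennreal (1 / \<rho>\<^sup>2) * ennreal \<bar>w' s\<bar>"
          by (rule ennreal_mult') simp
        finally show ?thesis using True s y(1) G unfolding y_def[symmetric]
          by (simp add: mult.assoc)
      qed simp
    qed
  qed
  finally show ?thesis unfolding \<rho>_def .
qed

text \<open>Average the estimate along rays over all directions and carry the resulting integral from the
  origin to \<open>x\<close>. Bounding the truncation rather than \<open>u\<close> itself localises the gradient to the region between
  the two level sets; the energy can then be distributed among disjoint ranges of heights.\<close>
lemma truncation_le_potential:
  assumes x: "x \<in> unit_disc" and ab: "0 \<le> a" "a < b"
  shows "ennreal (min (max (\<bar>u x\<bar> - a) 0) (b - a)) \<le>
     (\<integral>\<^sup>+y. ennreal (hkernel x y) * (indicator {y. a < \<bar>u y\<bar> \<and> \<bar>u y\<bar> < b} y * ennreal (hgrad u y)) \<partial>hvol)"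
proof -
  define T where "T = min (max (\<bar>u x\<bar> - a) 0) (b - a)"
  have T: "0 \<le> T" using ab by (simp add: T_def)
  define G where "G = (\<lambda>y. indicator {y. a < \<bar>u y\<bar> \<and> \<bar>u y\<bar> < b} y * ennreal (hgrad u y))"
  have [measurable]: "G \<in> borel_measurable borel" unfolding G_def by measurable
  define H where "H = (\<lambda>y. indicator unit_disc y * ennreal (2 / ((1 - (norm y)\<^sup>2) * norm y)) * G (disc_moebius x y))"
  have [measurable]: "H \<in> borel_measurable borel" unfolding H_def by measurable
  have "ennreal T * ennreal (2 * pi * ln 2) = (\<integral>\<^sup>+z. ennreal T * (indicator annulus z * ennreal (1 / (norm z)\<^sup>2)) \<partial>lborel)"
    by (subst nn_integral_cmult) (simp_all add: nn_integral_annulus_inverse_square)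
  also have "\<dots> \<le> (\<integral>\<^sup>+z. indicator annulus z * (\<integral>\<^sup>+s. indicator {0<..} s * ennreal s * H (s *\<^sub>R z) \<partial>lborel) \<partial>lborel)"
  proof (rule nn_integral_mono)
    fix z :: "real^2"
    show "ennreal T * (indicator annulus z * ennreal (1 / (norm z)\<^sup>2))
       \<le> indicator annulus z * (\<integral>\<^sup>+s. indicator {0<..} s * ennreal s * H (s *\<^sub>R z) \<partial>lborel)"
      using truncation_le_ray[OF x _ ab, of z] unfolding H_def G_def T_def
      by (auto simp: mult.commute split: split_indicator)
  qed
  also have "\<dots> = ennreal (ln 2) * (\<integral>\<^sup>+y. H y \<partial>lborel)" by (rule nn_integral_rays) measurable
  also have "(\<integral>\<^sup>+y. H y \<partial>lborel) = (\<integral>\<^sup>+y. ennreal (2 * pi) * (\<lambda>y. ennreal (hkernel x y) * G y) (disc_moebius x y) \<partial>hvol)"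
  proof -
    have "(\<integral>\<^sup>+y. ennreal (2 * pi) * (\<lambda>y. ennreal (hkernel x y) * G y) (disc_moebius x y) \<partial>hvol) =
      (\<integral>\<^sup>+y. indicator unit_disc y * ennreal (hyperbolic_factor y) * 
         (ennreal (2 * pi) * (\<lambda>y. ennreal (hkernel x y) * G y) (disc_moebius x y)) \<partial>lborel)"
      by (rule nn_integral_hvol) measurable
    also have "\<dots> = (\<integral>\<^sup>+y. H y \<partial>lborel)"
    proof (rule nn_integral_cong)
      fix y :: "real^2"
      show "indicator unit_disc y * ennreal (hyperbolic_factor y) * 
         (ennreal (2 * pi) * (\<lambda>y. ennreal (hkernel x y) * G y) (disc_moebius x y)) = H y"
      proof (cases "y \<in> unit_disc")
        case True
        have k: "hkernel x (disc_moebius x y) = (1 - (norm y)\<^sup>2) / (4 * pi * norm y)"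
          unfolding hkernel_def norm_moebius_sq[symmetric] moebius_moebius[OF x True] by simp
        have ny: "1 - (norm y)\<^sup>2 > 0" using True by (simp add: mem_unit_disc2)
        have "hyperbolic_factor y * (2 * pi * hkernel x (disc_moebius x y)) = 2 / ((1 - (norm y)\<^sup>2) * norm y)"
        proof -
          have "(2 / d)\<^sup>2 * (2 * pi * (d / (4 * pi * r))) = 2 / (d * r)" if "d > 0" for d r :: real
            using that by (cases "r = 0") (simp_all add: divide_simps power2_eq_square)
          from this[OF ny] show ?thesis unfolding k hyperbolic_factor_def .
        qed
        moreover have "0 \<le> hkernel x (disc_moebius x y)" unfolding k using ny by simp
        moreover have "0 \<le> hyperbolic_factor y" by (simp add: hyperbolic_factor_def)
        moreover have "ennreal A * (ennreal B * ennreal C) = ennreal (A * (B * C))" if "0 \<le> A" "0 \<le> B" "0 \<le> C" for A B C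
          using that by (simp add: ennreal_mult)
        ultimately have "ennreal (hyperbolic_factor y) * (ennreal (2 * pi) * ennreal (hkernel x (disc_moebius x y)))
          = ennreal (2 / ((1 - (norm y)\<^sup>2) * norm y))"
          by simp
        then show ?thesis using True by (simp add: H_def mult.assoc[symmetric])
      qed (simp add: H_def)
    qed
    finally show ?thesis by simp
  qed
  also have "\<dots> = ennreal (2 * pi) * (\<integral>\<^sup>+y. (\<lambda>y. ennreal (hkernel x y) * G y) (disc_moebius x y) \<partial>hvol)"
    by (rule nn_integral_cmult) measurable
  also have "(\<integral>\<^sup>+y. (\<lambda>y. ennreal (hkernel x y) * G y) (disc_moebius x y) \<partial>hvol) = (\<integral>\<^sup>+y. ennreal (hkernel x y) * G y \<partial>hvol)"
    by (rule nn_integral_hvol_moebius[OF x]) measurable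
  finally have "ennreal (1 / (2 * pi * ln 2)) * (ennreal T * ennreal (2 * pi * ln 2))
     \<le> ennreal (1 / (2 * pi * ln 2)) * (ennreal (ln 2) * (ennreal (2 * pi) * (\<integral>\<^sup>+y. ennreal (hkernel x y) * G y \<partial>hvol)))"
    by (rule mult_left_mono) simp
  moreover have "ennreal (1 / (2 * pi * ln 2)) * (ennreal T * ennreal (2 * pi * ln 2)) = ennreal T"
    using T by (simp add: ennreal_mult'[symmetric])
  moreover have "ennreal (1 / (2 * pi * ln 2)) * (ennreal (ln 2) * (ennreal (2 * pi) * X)) = X" for X
    unfolding mult.assoc[symmetric] by (simp add: ennreal_mult'[symmetric])
  ultimately show ?thesis unfolding T_def G_def by simp
qed

end

section \<open>The potential of a set of given hyperbolic area\<close>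

lemma Cauchy_Schwarz_nn_integral:
  fixes f g :: "'a \<Rightarrow> ennreal"
  assumes [measurable]: "f \<in> borel_measurable M" "g \<in> borel_measurable M"
  shows "(\<integral>\<^sup>+x. f x * g x \<partial>M)\<^sup>2 \<le> (\<integral>\<^sup>+x. (f x)\<^sup>2 \<partial>M) * (\<integral>\<^sup>+x. (g x)\<^sup>2 \<partial>M)"
proof -
  let ?F = "\<integral>\<^sup>+x. (f x)\<^sup>2 \<partial>M" and ?G = "\<integral>\<^sup>+x. (g x)\<^sup>2 \<partial>M"
  consider "?F = 0" | "?G = 0" | "?F = \<infinity>" "?G \<noteq> 0" | "?G = \<infinity>" "?F \<noteq> 0"
    | "?F \<noteq> 0" "?G \<noteq> 0" "?F \<noteq> \<infinity>" "?G \<noteq> \<infinity>" by blast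
  then show ?thesis
  proof cases
    case 1
    then have "AE x in M. (f x)\<^sup>2 = 0" by (subst (asm) nn_integral_0_iff_AE) auto
    then have "(\<integral>\<^sup>+x. f x * g x \<partial>M) = (\<integral>\<^sup>+x. 0 \<partial>M)" by (intro nn_integral_cong_AE) auto
    then show ?thesis by simp
  next
    case 2
    then have "AE x in M. (g x)\<^sup>2 = 0" by (subst (asm) nn_integral_0_iff_AE) auto
    then have "(\<integral>\<^sup>+x. f x * g x \<partial>M) = (\<integral>\<^sup>+x. 0 \<partial>M)" by (intro nn_integral_cong_AE) auto
    then show ?thesis by simp
  next
    case 3 then show ?thesis by (simp add: ennreal_top_mult)
  next
    case 4 then show ?thesis by (simp add: ennreal_mult_top)
  next
    case 5
    define p q where "p = enn2real ?F" and "q = enn2real ?G"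
    have p: "?F = ennreal p" "p > 0" and q: "?G = ennreal q" "q > 0"
      using 5 by (auto simp: p_def q_def less_top enn2real_positive_iff zero_less_iff_neq_zero)
    \<comment> \<open>The weight for which the inequality between the means is an equality after integration.\<close>
    define c where "c = sqrt (q / p)"
    have c: "c > 0" using p q by (simp add: c_def)
    define c' where "c' = 1 / c"
    have c': "c' > 0" "c * c' = 1" using c by (auto simp: c'_def)
    have am_gm: "2 * (a * b) \<le> ennreal c * a\<^sup>2 + ennreal c' * b\<^sup>2" for a b :: ennreal
    proof (cases "a = \<infinity> \<or> b = \<infinity>")
      case True
      then show ?thesis using c c' by (auto simp: ennreal_mult_top power2_eq_square)
    next
      case False
      then obtain a' b' where ab: "a = ennreal a'" "b = ennreal b'" "0 \<le> a'" "0 \<le> b'"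
        by (metis ennreal_cases infinity_ennreal_def)
      have "0 \<le> c' * (c * a' - b')\<^sup>2" using c' by simp
      also have "\<dots> = (c * c') * c * a'\<^sup>2 + c' * b'\<^sup>2 - 2 * (c * c') * (a' * b')"
        by (simp add: power2_eq_square algebra_simps)
      finally have "2 * (a' * b') \<le> c * a'\<^sup>2 + c' * b'\<^sup>2" unfolding c' by simp
      then have "ennreal (2 * (a' * b')) \<le> ennreal (c * a'\<^sup>2 + c' * b'\<^sup>2)"
        by (rule ennreal_leI)
      moreover have "ennreal (2 * (a' * b')) = 2 * (a * b)" using ab by (simp add: ennreal_mult)
      moreover have "ennreal (c * a'\<^sup>2 + c' * b'\<^sup>2) = ennreal c * a\<^sup>2 + ennreal c' * b\<^sup>2"
        using ab c c' by (simp add: ennreal_mult ennreal_power)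
      ultimately show ?thesis by simp
    qed
    have "2 * (\<integral>\<^sup>+x. f x * g x \<partial>M) = (\<integral>\<^sup>+x. 2 * (f x * g x) \<partial>M)"
      by (rule nn_integral_cmult[symmetric]) measurable
    also have "\<dots> \<le> (\<integral>\<^sup>+x. ennreal c * (f x)\<^sup>2 + ennreal c' * (g x)\<^sup>2 \<partial>M)"
      by (intro nn_integral_mono am_gm)
    also have "\<dots> = ennreal c * ?F + ennreal c' * ?G"
      by (subst nn_integral_add) (auto simp: nn_integral_cmult)
    also have "\<dots> = ennreal (c * p + c' * q)"
      using p q c c' by (simp add: ennreal_mult ennreal_plus)
    also have "c * p + c' * q = 2 * sqrt (p * q)"
    proof -
      have "c * p = sqrt (p * q)" "c' * q = sqrt (p * q)"
        using p q unfolding c'_def c_def by (simp_all add: real_sqrt_divide real_sqrt_mult real_div_sqrt field_simps)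
      then show ?thesis by simp
    qed
    also have "ennreal (2 * sqrt (p * q)) = 2 * ennreal (sqrt (p * q))" by (simp add: ennreal_mult')
    finally have "(\<integral>\<^sup>+x. f x * g x \<partial>M) \<le> ennreal (sqrt (p * q))"
      by (simp add: ennreal_mult_le_mult_iff)
    then have "(\<integral>\<^sup>+x. f x * g x \<partial>M)\<^sup>2 \<le> (ennreal (sqrt (p * q)))\<^sup>2" by (intro power_mono) auto
    also have "\<dots> = ?F * ?G" using p q by (simp add: ennreal_power ennreal_mult)
    finally show ?thesis .
  qed
qed

lemma sigma_finite_hvol: "sigma_finite_measure hvol"
  unfolding hvol_def
  by (subst sigma_finite_measure.sigma_finite_iff_density_finite[OF sigma_finite_lborel]) (auto simp: indicator_def)

lemma pair_sigma_finite_hvol: "pair_sigma_finite hvol hvol"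
  by (simp add: pair_sigma_finite_def sigma_finite_hvol)

lemma AE_hvol: "AE x in hvol. x \<in> unit_disc"
  unfolding hvol_def by (subst AE_density) (auto simp: indicator_def)

lemma nn_integral_hvol_mono:
  assumes "\<And>x. x \<in> unit_disc \<Longrightarrow> f x \<le> g x"
  shows "(\<integral>\<^sup>+x. f x \<partial>hvol) \<le> (\<integral>\<^sup>+x. g x \<partial>hvol)"
  using AE_hvol assms by (intro nn_integral_mono_AE) (auto elim!: eventually_mono)

lemma measurable_nn_integral_hvol [measurable (raw)]:
  assumes "case_prod f \<in> borel_measurable (N \<Otimes>\<^sub>M hvol)"
  shows "(\<lambda>x. \<integral>\<^sup>+y. f x y \<partial>hvol) \<in> borel_measurable N"
  by (rule sigma_finite_measure.borel_measurable_nn_integral[OF sigma_finite_hvol assms])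

lemma hkernel_commute: "hkernel x y = hkernel y x"
  by (simp add: hkernel_def psd_commute)

lemma hkernel_nonneg: "x \<in> unit_disc \<Longrightarrow> y \<in> unit_disc \<Longrightarrow> 0 \<le> hkernel x y"
  using psd_nonneg[of x y] psd_less_1[of x y] by (simp add: hkernel_def)

text \<open>The squared kernel times the area element is \<open>dt / (4 \<pi> t)\<close> in the variable \<open>t = psd x y\<close>; this is the
  origin of the constant \<open>4 \<pi>\<close> of the theorem.\<close>
lemma nn_integral_hkernel_square_shell:
  assumes x: "x \<in> unit_disc" and ab: "0 < a" "a \<le> b" "b \<le> 1"
  shows "(\<integral>\<^sup>+y. ennreal ((hkernel x y)\<^sup>2) * indicator {a..b} (psd x y) \<partial>hvol) \<le> ennreal (1 / (4 * pi) * ln (b / a))"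
proof -
  let ?g = "\<lambda>t. ennreal (((1 - t) / (4 * pi * sqrt t))\<^sup>2) * indicator {a..b} t"
  have "(\<integral>\<^sup>+y. ennreal ((hkernel x y)\<^sup>2) * indicator {a..b} (psd x y) \<partial>hvol) = (\<integral>\<^sup>+y. ?g (psd x y) \<partial>hvol)"
    by (simp add: hkernel_def)
  also have "\<dots> = (\<integral>\<^sup>+t. ?g t * ennreal (4 * pi / (1 - t)\<^sup>2) * indicator {0..<1} t \<partial>lborel)"
    by (rule nn_integral_hvol_psd[OF x]) measurable
  also have "\<dots> \<le> (\<integral>\<^sup>+t. ennreal (1 / (4 * pi)) * (ennreal (1 / t) * indicator {a..b} t) \<partial>lborel)"
  proof (rule nn_integral_mono)
    fix t :: real
    show "?g t * ennreal (4 * pi / (1 - t)\<^sup>2) * indicator {0..<1} t \<le> ennreal (1 / (4 * pi)) * (ennreal (1 / t) * indicator {a..b} t)"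
    proof (cases "t \<in> {a..b} \<and> t < 1")
      case True
      then have t: "t > 0" "t < 1" using ab by auto
      have "((1 - t) / (4 * pi * sqrt t))\<^sup>2 * (4 * pi / (1 - t)\<^sup>2) = 1 / (4 * pi) * (1 / t)"
        using t by (simp add: power_divide power_mult_distrib divide_simps) (simp add: power2_eq_square)
      then show ?thesis using True t by (simp add: ennreal_mult'[symmetric])
    qed (auto split: split_indicator)
  qed
  also have "\<dots> = ennreal (1 / (4 * pi)) * (\<integral>\<^sup>+t. ennreal (1 / t) * indicator {a..b} t \<partial>lborel)"
    by (rule nn_integral_cmult) measurable
  also have "\<dots> = ennreal (1 / (4 * pi) * ln (b / a))"
    using ab by (simp add: nn_integral_inverse ennreal_mult'[symmetric])
  finally show ?thesis .
qed

text \<open>The singularity of the kernel is integrable; the remaining factor \<open>1 / (1 - t)\<close> is at most \<open>4/3\<close> because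
  \<open>t < s/4 \<le> 1/4\<close>.\<close>
lemma nn_integral_hkernel_near:
  assumes x: "x \<in> unit_disc" and s: "0 < s" "s \<le> 1"
  shows "(\<integral>\<^sup>+y. ennreal (hkernel x y) * indicator {..<s / 4} (psd x y) \<partial>hvol) \<le> ennreal (4 / 3 * sqrt s)"
proof -
  let ?g = "\<lambda>t. ennreal ((1 - t) / (4 * pi * sqrt t)) * indicator {..<s / 4} t"
  have "(\<integral>\<^sup>+y. ennreal (hkernel x y) * indicator {..<s / 4} (psd x y) \<partial>hvol) = (\<integral>\<^sup>+y. ?g (psd x y) \<partial>hvol)"
    by (simp add: hkernel_def)
  also have "\<dots> = (\<integral>\<^sup>+t. ?g t * ennreal (4 * pi / (1 - t)\<^sup>2) * indicator {0..<1} t \<partial>lborel)"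
    by (rule nn_integral_hvol_psd[OF x]) measurable
  also have "\<dots> \<le> (\<integral>\<^sup>+t. ennreal (4 / 3) * (ennreal (t powr (-1/2)) * indicator {0..s / 4} t) \<partial>lborel)"
  proof (rule nn_integral_mono)
    fix t :: real
    show "?g t * ennreal (4 * pi / (1 - t)\<^sup>2) * indicator {0..<1} t \<le> ennreal (4 / 3) * (ennreal (t powr (-1/2)) * indicator {0..s / 4} t)"
    proof (cases "0 < t \<and> t < s / 4")
      case True
      then have t: "t > 0" "t \<le> 1 / 4" "t < 1" using s by auto
      have "((1 - t) / (4 * pi * sqrt t)) * (4 * pi / (1 - t)\<^sup>2) = 1 / (1 - t) * (1 / sqrt t)"
        using t by (simp add: divide_simps power2_eq_square)
      also have "\<dots> \<le> 4 / 3 * (1 / sqrt t)"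
        using t by (intro mult_right_mono) (auto simp: field_simps)
      also have "1 / sqrt t = t powr (-1/2)"
        using t by (simp add: powr_minus_divide powr_half_sqrt)
      finally have "ennreal (((1 - t) / (4 * pi * sqrt t)) * (4 * pi / (1 - t)\<^sup>2)) \<le> ennreal (4 / 3 * t powr (-1/2))"
        by (rule ennreal_leI)
      also have "ennreal (4 / 3 * t powr (-1/2)) = ennreal (4 / 3) * ennreal (t powr (-1/2))"
        by (rule ennreal_mult') simp
      also have "ennreal (((1 - t) / (4 * pi * sqrt t)) * (4 * pi / (1 - t)\<^sup>2))
          = ennreal ((1 - t) / (4 * pi * sqrt t)) * ennreal (4 * pi / (1 - t)\<^sup>2)"
        using t by (intro ennreal_mult') simp
      finally show ?thesis using True t by simp
    qed (auto split: split_indicator)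
  qed
  also have "\<dots> = ennreal (4 / 3) * (\<integral>\<^sup>+t. ennreal (t powr (-1/2)) * indicator {0..s / 4} t \<partial>lborel)"
    by (rule nn_integral_cmult) measurable
  also have "(\<integral>\<^sup>+t. ennreal (t powr (-1/2)) * indicator {0..s / 4} t \<partial>lborel) = ennreal ((s / 4) powr (-1/2 + 1) / (-1/2 + 1))"
    using s by (intro nn_integral_has_integral_lebesgue' has_integral_powr_from_0) auto
  also have "(s / 4) powr (-1/2 + 1) / (-1/2 + 1) = sqrt s"
    using s by (simp add: powr_half_sqrt real_sqrt_divide)
  finally show ?thesis using s by (simp add: ennreal_mult'[symmetric])
qed

lemma hkernel_far_le:
  assumes "x \<in> unit_disc" "y \<in> unit_disc" "0 < s" "s / 4 \<le> psd x y"
  shows "hkernel x y \<le> 1 / (2 * pi * sqrt s)"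
proof -
  have "sqrt (s / 4) \<le> sqrt (psd x y)" using assms by simp
  then have q: "sqrt s / 2 \<le> sqrt (psd x y)" by (simp add: real_sqrt_divide)
  have "hkernel x y \<le> 1 / (4 * pi * (sqrt s / 2))"
    unfolding hkernel_def using q assms psd_nonneg[of x y] psd_less_1[of x y]
    by (intro frac_le mult_left_mono) auto
  then show ?thesis by simp
qed

lemma ln_4_le: "ln (4::real) \<le> 4 * pi"
proof -
  have "ln (4::real) \<le> 4 - 1" by (rule ln_le_minus_one) simp
  then show ?thesis using pi_ge_two by simp
qed

text \<open>Beyond \<open>t = \<beta>/4\<close> the integral is bounded for one of two reasons: if \<open>A\<close> has area at most \<open>\<beta>\<close>, then
  the kernel is small enough there, and if \<open>\<beta> = 1\<close>, then the whole rest of the disc contributes a bounded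
  amount, since the kernel decays like \<open>exp (- d)\<close>.\<close>
lemma nn_integral_hkernel_square_far:
  assumes x: "x \<in> unit_disc" and s: "0 < s" "s \<le> \<beta>" "\<beta> \<le> 1"
    and [measurable]: "A \<in> sets borel" and A: "emeasure hvol A \<le> ennreal \<beta> \<or> \<beta> = 1"
  shows "(\<integral>\<^sup>+y. ennreal ((hkernel x y)\<^sup>2) * indicator {s / 4..} (psd x y) * indicator A y \<partial>hvol)
      \<le> ennreal (1 / (4 * pi) * ln (\<beta> / s) + 1)"
proof -
  have "(\<integral>\<^sup>+y. ennreal ((hkernel x y)\<^sup>2) * indicator {s / 4..} (psd x y) * indicator A y \<partial>hvol)
     \<le> (\<integral>\<^sup>+y. ennreal ((hkernel x y)\<^sup>2) * indicator {s / 4..\<beta> / 4} (psd x y)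
          + ennreal ((hkernel x y)\<^sup>2) * indicator {\<beta> / 4..} (psd x y) * indicator A y \<partial>hvol)"
    by (intro nn_integral_mono) (auto split: split_indicator)
  also have "\<dots> = (\<integral>\<^sup>+y. ennreal ((hkernel x y)\<^sup>2) * indicator {s / 4..\<beta> / 4} (psd x y) \<partial>hvol)
          + (\<integral>\<^sup>+y. ennreal ((hkernel x y)\<^sup>2) * indicator {\<beta> / 4..} (psd x y) * indicator A y \<partial>hvol)"
    by (rule nn_integral_add) measurable
  also have "\<dots> \<le> ennreal (1 / (4 * pi) * ln (\<beta> / s)) + ennreal 1"
  proof (rule add_mono)
    show "(\<integral>\<^sup>+y. ennreal ((hkernel x y)\<^sup>2) * indicator {s / 4..\<beta> / 4} (psd x y) \<partial>hvol) \<le> ennreal (1 / (4 * pi) * ln (\<beta> / s))"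
      using nn_integral_hkernel_square_shell[OF x, of "s / 4" "\<beta> / 4"] s by simp
    show "(\<integral>\<^sup>+y. ennreal ((hkernel x y)\<^sup>2) * indicator {\<beta> / 4..} (psd x y) * indicator A y \<partial>hvol) \<le> ennreal 1"
    proof (cases "\<beta> = 1")
      case True
      have "(\<integral>\<^sup>+y. ennreal ((hkernel x y)\<^sup>2) * indicator {\<beta> / 4..} (psd x y) * indicator A y \<partial>hvol)
        \<le> (\<integral>\<^sup>+y. ennreal ((hkernel x y)\<^sup>2) * indicator {1 / 4..1} (psd x y) \<partial>hvol)"
        by (rule nn_integral_hvol_mono) (use psd_less_1[OF x] True in \<open>auto split: split_indicator simp: less_imp_le\<close>)
      also have "\<dots> \<le> ennreal (1 / (4 * pi) * ln (1 / (1 / 4)))"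
        by (rule nn_integral_hkernel_square_shell[OF x]) auto
      also have "\<dots> \<le> ennreal 1" using ln_4_le by (intro ennreal_leI) (simp add: field_simps)
      finally show ?thesis .
    next
      case False
      then have V: "emeasure hvol A \<le> ennreal \<beta>" using A by simp
      have \<beta>: "\<beta> > 0" using s by simp
      have "(\<integral>\<^sup>+y. ennreal ((hkernel x y)\<^sup>2) * indicator {\<beta> / 4..} (psd x y) * indicator A y \<partial>hvol)
        \<le> (\<integral>\<^sup>+y. ennreal ((1 / (2 * pi * sqrt \<beta>))\<^sup>2) * indicator A y \<partial>hvol)"
      proof (rule nn_integral_hvol_mono)
        fix y assume elim: "y \<in> unit_disc"
        show "ennreal ((hkernel x y)\<^sup>2) * indicator {\<beta> / 4..} (psd x y) * indicator A y
            \<le> ennreal ((1 / (2 * pi * sqrt \<beta>))\<^sup>2) * indicator A y"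
          using power_mono[OF hkernel_far_le[OF x elim \<beta>] hkernel_nonneg[OF x elim], of 2]
          by (auto intro!: ennreal_leI split: split_indicator)
      qed
      also have "\<dots> = ennreal ((1 / (2 * pi * sqrt \<beta>))\<^sup>2) * emeasure hvol A"
        by (simp add: nn_integral_cmult)
      also have "\<dots> \<le> ennreal ((1 / (2 * pi * sqrt \<beta>))\<^sup>2) * ennreal \<beta>"
        using V by (rule mult_left_mono) simp
      also have "\<dots> = ennreal (1 / (4 * pi\<^sup>2))"
        using \<beta> by (simp add: ennreal_mult'[symmetric] power_divide power_mult_distrib)
      also have "\<dots> \<le> ennreal 1"
      proof (rule ennreal_leI)
        have "1 \<le> pi\<^sup>2" using pi_ge_two by (simp add: one_le_power)
        then show "1 / (4 * pi\<^sup>2) \<le> 1" by (simp add: field_simps)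
      qed
      finally show ?thesis .
    qed
  qed
  also have "\<dots> = ennreal (1 / (4 * pi) * ln (\<beta> / s) + 1)"
    using s by (intro ennreal_plus[symmetric]) auto
  finally show ?thesis .
qed

text \<open>Split the kernel at \<open>psd x y = s/4\<close>. The far part gives the logarithm, by Cauchy-Schwarz over \<open>B\<close>.
  The near part must not be handled by the triangle inequality in \<open>L\<^sup>2\<close>, as the cross term would then be of
  the order of the square root of the logarithm. Instead it is estimated by suprema against an \<open>L\<^sup>1\<close> norm, where
  the powers of \<open>s\<close> cancel.

  Two areas are decoupled from the sets on purpose: \<open>s\<close> may be smaller than the area \<open>t\<close> of \<open>B\<close>, and for
  \<open>\<beta> = 1\<close> the set \<open>A\<close> is arbitrary. So the estimate covers sets of area larger than \<open>1\<close> as well.\<close>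
lemma potential_estimate:
  assumes s: "0 < s" "s \<le> \<beta>" "\<beta> \<le> 1" and t: "s \<le> t" "emeasure hvol B = ennreal t"
    and [measurable]: "A \<in> sets borel" and A: "emeasure hvol A \<le> ennreal \<beta> \<or> \<beta> = 1"
    and [measurable]: "B \<in> sets borel" and B: "B \<subseteq> unit_disc"
  shows "(\<integral>\<^sup>+y. indicator A y * (\<integral>\<^sup>+x. indicator B x * ennreal (hkernel x y) \<partial>hvol)\<^sup>2 \<partial>hvol)
      \<le> ennreal (t\<^sup>2 * (1 / (4 * pi) * ln (\<beta> / s) + 4))"
proof -
  define L where "L = 1 / (4 * pi) * ln (\<beta> / s) + 1"
  have L: "0 \<le> L" using s by (simp add: L_def)
  have t0: "0 < t" using s t by simp
  define Kf where "Kf = (\<lambda>y. \<integral>\<^sup>+x. indicator B x * (ennreal (hkernel x y) * indicator {s / 4..} (psd x y)) \<partial>hvol)"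
  define Kn where "Kn = (\<lambda>y. \<integral>\<^sup>+x. indicator B x * (ennreal (hkernel x y) * indicator {..<s / 4} (psd x y)) \<partial>hvol)"
  have [measurable]: "Kf \<in> borel_measurable borel" "Kn \<in> borel_measurable borel"
    unfolding Kf_def Kn_def by measurable
  have split: "(\<integral>\<^sup>+x. indicator B x * ennreal (hkernel x y) \<partial>hvol) = Kf y + Kn y" for y
    unfolding Kf_def Kn_def
    by (subst nn_integral_add[symmetric]) (auto intro!: nn_integral_cong split: split_indicator)
  have far: "(\<integral>\<^sup>+y. indicator A y * (Kf y)\<^sup>2 \<partial>hvol) \<le> ennreal (t\<^sup>2 * L)"
  proof -
    have "(Kf y)\<^sup>2 \<le> ennreal t * (\<integral>\<^sup>+x. indicator B x * (ennreal ((hkernel x y)\<^sup>2) * indicator {s / 4..} (psd x y)) \<partial>hvol)"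
      if y: "y \<in> unit_disc" for y
    proof -
      have "(Kf y)\<^sup>2 = (\<integral>\<^sup>+x. indicator B x * (indicator B x * (ennreal (hkernel x y) * indicator {s / 4..} (psd x y))) \<partial>hvol)\<^sup>2"
        unfolding Kf_def by (intro arg_cong[where f="\<lambda>x. x\<^sup>2"] nn_integral_cong) (auto split: split_indicator)
      also have "\<dots> \<le> (\<integral>\<^sup>+x. (indicator B x)\<^sup>2 \<partial>hvol) *
          (\<integral>\<^sup>+x. (indicator B x * (ennreal (hkernel x y) * indicator {s / 4..} (psd x y)))\<^sup>2 \<partial>hvol)"
        by (rule Cauchy_Schwarz_nn_integral) measurable
      also have "(\<integral>\<^sup>+x. (indicator B x)\<^sup>2 \<partial>hvol) = (\<integral>\<^sup>+x. indicator B x \<partial>hvol)"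
        by (intro nn_integral_cong) (auto split: split_indicator)
      also have "\<dots> = ennreal t" using t by simp
      also have "(\<integral>\<^sup>+x. (indicator B x * (ennreal (hkernel x y) * indicator {s / 4..} (psd x y)))\<^sup>2 \<partial>hvol)
         = (\<integral>\<^sup>+x. indicator B x * (ennreal ((hkernel x y)\<^sup>2) * indicator {s / 4..} (psd x y)) \<partial>hvol)"
        using B y hkernel_nonneg by (intro nn_integral_cong) (auto simp: ennreal_power subset_iff split: split_indicator)
      finally show ?thesis .
    qed
    then have "(\<integral>\<^sup>+y. indicator A y * (Kf y)\<^sup>2 \<partial>hvol) \<le>
       (\<integral>\<^sup>+y. indicator A y * (ennreal t * (\<integral>\<^sup>+x. indicator B x * (ennreal ((hkernel x y)\<^sup>2) * indicator {s / 4..} (psd x y)) \<partial>hvol)) \<partial>hvol)"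
      by (intro nn_integral_hvol_mono mult_left_mono) auto
    also have "\<dots> = (\<integral>\<^sup>+y. (\<integral>\<^sup>+x. indicator A y * (ennreal t * (indicator B x * (ennreal ((hkernel x y)\<^sup>2) * indicator {s / 4..} (psd x y)))) \<partial>hvol) \<partial>hvol)"
      by (subst nn_integral_cmult[symmetric], measurable)+
    also have "\<dots> = (\<integral>\<^sup>+x. (\<integral>\<^sup>+y. indicator A y * (ennreal t * (indicator B x * (ennreal ((hkernel x y)\<^sup>2) * indicator {s / 4..} (psd x y)))) \<partial>hvol) \<partial>hvol)"
      by (rule pair_sigma_finite.Fubini'[OF pair_sigma_finite_hvol]) measurable
    also have "\<dots> \<le> (\<integral>\<^sup>+x. ennreal (t * L) * indicator B x \<partial>hvol)"
    proof (rule nn_integral_mono)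
      fix x :: "real^2"
      show "(\<integral>\<^sup>+y. indicator A y * (ennreal t * (indicator B x * (ennreal ((hkernel x y)\<^sup>2) * indicator {s / 4..} (psd x y)))) \<partial>hvol)
         \<le> ennreal (t * L) * indicator B x"
      proof (cases "x \<in> B")
        case True
        then have x: "x \<in> unit_disc" using B by auto
        have "(\<integral>\<^sup>+y. indicator A y * (ennreal t * (indicator B x * (ennreal ((hkernel x y)\<^sup>2) * indicator {s / 4..} (psd x y)))) \<partial>hvol)
          = (\<integral>\<^sup>+y. ennreal t * (ennreal ((hkernel x y)\<^sup>2) * indicator {s / 4..} (psd x y) * indicator A y) \<partial>hvol)"
          using True by (intro nn_integral_cong) (simp add: mult_ac)
        also have "\<dots> = ennreal t * (\<integral>\<^sup>+y. ennreal ((hkernel x y)\<^sup>2) * indicator {s / 4..} (psd x y) * indicator A y \<partial>hvol)"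
          by (rule nn_integral_cmult) measurable
        also have "\<dots> \<le> ennreal t * ennreal L"
          unfolding L_def using s A by (intro mult_left_mono nn_integral_hkernel_square_far[OF x]) auto
        finally show ?thesis using True t0 by (simp add: ennreal_mult')
      qed simp
    qed
    also have "\<dots> = ennreal (t * L) * ennreal t" using t by (simp add: nn_integral_cmult)
    also have "\<dots> = ennreal (t * L * t)" using t0 by (intro ennreal_mult''[symmetric]) simp
    also have "t * L * t = t\<^sup>2 * L" by (simp add: power2_eq_square)
    finally show ?thesis .
  qed
  have Kn_le: "Kn y \<le> ennreal (4 / 3 * sqrt s)" if y: "y \<in> unit_disc" for y
  proof -
    have "Kn y \<le> (\<integral>\<^sup>+x. ennreal (hkernel y x) * indicator {..<s / 4} (psd y x) \<partial>hvol)"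
      unfolding Kn_def by (intro nn_integral_mono) (auto simp: hkernel_commute psd_commute split: split_indicator)
    also have "\<dots> \<le> ennreal (4 / 3 * sqrt s)" using s by (intro nn_integral_hkernel_near[OF y]) auto
    finally show ?thesis .
  qed
  have Kf_le: "Kf y \<le> ennreal (t / (2 * pi * sqrt s))" if y: "y \<in> unit_disc" for y
  proof -
    have "Kf y \<le> (\<integral>\<^sup>+x. ennreal (1 / (2 * pi * sqrt s)) * indicator B x \<partial>hvol)"
      unfolding Kf_def using B y hkernel_far_le[OF _ y s(1)]
      by (intro nn_integral_mono) (auto intro!: ennreal_leI split: split_indicator)
    also have "\<dots> = ennreal (1 / (2 * pi * sqrt s)) * ennreal t" using t by (simp add: nn_integral_cmult)
    also have "\<dots> = ennreal (t / (2 * pi * sqrt s))" using t0 s by (simp add: ennreal_mult''[symmetric])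
    finally show ?thesis .
  qed
  have int_Kn: "(\<integral>\<^sup>+y. Kn y \<partial>hvol) \<le> ennreal (4 / 3 * sqrt s * t)"
  proof -
    have "(\<integral>\<^sup>+y. Kn y \<partial>hvol) = (\<integral>\<^sup>+x. (\<integral>\<^sup>+y. indicator B x * (ennreal (hkernel x y) * indicator {..<s / 4} (psd x y)) \<partial>hvol) \<partial>hvol)"
      unfolding Kn_def by (rule pair_sigma_finite.Fubini'[OF pair_sigma_finite_hvol]) measurable
    also have "\<dots> \<le> (\<integral>\<^sup>+x. ennreal (4 / 3 * sqrt s) * indicator B x \<partial>hvol)"
    proof (rule nn_integral_mono)
      fix x :: "real^2"
      show "(\<integral>\<^sup>+y. indicator B x * (ennreal (hkernel x y) * indicator {..<s / 4} (psd x y)) \<partial>hvol) \<le> ennreal (4 / 3 * sqrt s) * indicator B x"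
      proof (cases "x \<in> B")
        case True
        then show ?thesis using nn_integral_hkernel_near[of x s] B s by auto
      qed simp
    qed
    also have "\<dots> = ennreal (4 / 3 * sqrt s) * ennreal t" using t by (simp add: nn_integral_cmult)
    also have "\<dots> = ennreal (4 / 3 * sqrt s * t)" using t0 by (simp add: ennreal_mult''[symmetric])
    finally show ?thesis .
  qed
  define c where "c = 4 / 3 * sqrt s + 2 * (t / (2 * pi * sqrt s))"
  have c0: "0 \<le> c" using s t0 by (simp add: c_def)
  have near: "(\<integral>\<^sup>+y. Kn y * (Kn y + 2 * Kf y) \<partial>hvol) \<le> ennreal (3 * t\<^sup>2)"
  proof -
    have "(\<integral>\<^sup>+y. Kn y * (Kn y + 2 * Kf y) \<partial>hvol) \<le> (\<integral>\<^sup>+y. ennreal c * Kn y \<partial>hvol)"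
    proof (rule nn_integral_hvol_mono)
      fix y assume elim: "y \<in> unit_disc"
      have "Kn y + 2 * Kf y \<le> ennreal (4 / 3 * sqrt s) + 2 * ennreal (t / (2 * pi * sqrt s))"
        using Kn_le[OF elim] Kf_le[OF elim] by (intro add_mono mult_left_mono) auto
      also have "2 * ennreal (t / (2 * pi * sqrt s)) = ennreal (2 * (t / (2 * pi * sqrt s)))"
        using ennreal_mult'[of 2 "t / (2 * pi * sqrt s)"] by (simp only: ennreal_numeral)
      also have "ennreal (4 / 3 * sqrt s) + \<dots> = ennreal c" unfolding c_def using s t0
        by (intro ennreal_plus[symmetric]) auto
      finally show "Kn y * (Kn y + 2 * Kf y) \<le> ennreal c * Kn y" by (subst mult.commute) (rule mult_right_mono, auto)
    qed
    also have "\<dots> = ennreal c * (\<integral>\<^sup>+y. Kn y \<partial>hvol)" by (rule nn_integral_cmult) measurable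
    also have "\<dots> \<le> ennreal c * ennreal (4 / 3 * sqrt s * t)" using int_Kn by (rule mult_left_mono) simp
    also have "\<dots> = ennreal (c * (4 / 3 * sqrt s * t))" using c0 by (intro ennreal_mult'[symmetric]) simp
    also have "\<dots> \<le> ennreal (3 * t\<^sup>2)"
    proof (rule ennreal_leI)
      have "sqrt s * sqrt s = s" using s by simp
      then have "c * (4 / 3 * sqrt s * t) = 16 / 9 * (s * t) + 4 / (3 * pi) * t\<^sup>2"
        unfolding c_def using s by (simp add: field_simps power2_eq_square)
      also have "\<dots> \<le> 16 / 9 * t\<^sup>2 + 1 * t\<^sup>2"
      proof (intro add_mono mult_left_mono mult_right_mono)
        show "s * t \<le> t\<^sup>2" using t t0 by (simp add: power2_eq_square)
        show "4 / (3 * pi) \<le> 1" using pi_ge_two by (simp add: field_simps)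
      qed auto
      also have "\<dots> \<le> 3 * t\<^sup>2" by simp
      finally show "c * (4 / 3 * sqrt s * t) \<le> 3 * t\<^sup>2" .
    qed
    finally show ?thesis .
  qed
  have "(\<integral>\<^sup>+y. indicator A y * (\<integral>\<^sup>+x. indicator B x * ennreal (hkernel x y) \<partial>hvol)\<^sup>2 \<partial>hvol)
      \<le> (\<integral>\<^sup>+y. indicator A y * (Kf y)\<^sup>2 + Kn y * (Kn y + 2 * Kf y) \<partial>hvol)"
  proof (rule nn_integral_mono)
    fix y :: "real^2"
    have "(Kf y + Kn y)\<^sup>2 = (Kf y)\<^sup>2 + Kn y * (Kn y + 2 * Kf y)"
      by (simp add: power2_eq_square distrib_left distrib_right mult_2 mult_2_right ac_simps)
    then show "indicator A y * (\<integral>\<^sup>+x. indicator B x * ennreal (hkernel x y) \<partial>hvol)\<^sup>2 \<le> indicator A y * (Kf y)\<^sup>2 + Kn y * (Kn y + 2 * Kf y)"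
      unfolding split by (auto split: split_indicator)
  qed
  also have "\<dots> = (\<integral>\<^sup>+y. indicator A y * (Kf y)\<^sup>2 \<partial>hvol) + (\<integral>\<^sup>+y. Kn y * (Kn y + 2 * Kf y) \<partial>hvol)"
    by (rule nn_integral_add) measurable
  also have "\<dots> \<le> ennreal (t\<^sup>2 * L) + ennreal (3 * t\<^sup>2)" using far near by (rule add_mono)
  also have "\<dots> = ennreal (t\<^sup>2 * L + 3 * t\<^sup>2)" using L by (intro ennreal_plus[symmetric]) auto
  also have "t\<^sup>2 * L + 3 * t\<^sup>2 = t\<^sup>2 * (1 / (4 * pi) * ln (\<beta> / s) + 4)"
    by (simp add: L_def algebra_simps)
  finally show ?thesis .
qed

context disc_function begin

text \<open>A lower bound, sharp up to the additive error \<open>16 \<pi>\<close>, for the energy needed to climb from the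
  height \<open>a\<close> to the height \<open>b\<close>.\<close>
lemma level_set_capacity:
  assumes ab: "0 \<le> a" "a < b" and s: "0 < s" "s \<le> \<beta>" "\<beta> \<le> 1"
    and A: "emeasure hvol {y. a < \<bar>u y\<bar>} \<le> ennreal \<beta> \<or> \<beta> = 1"
    and B: "ennreal s \<le> emeasure hvol {y. b \<le> \<bar>u y\<bar>}" "emeasure hvol {y. b \<le> \<bar>u y\<bar>} \<noteq> \<infinity>"
  shows "ennreal (4 * pi * (b - a)\<^sup>2) \<le>
    (\<integral>\<^sup>+y. indicator {y. a < \<bar>u y\<bar> \<and> \<bar>u y\<bar> < b} y * ennreal ((hgrad u y)\<^sup>2) \<partial>hvol) * ennreal (ln (\<beta> / s) + 16 * pi)"
proof -
  define t where "t = enn2real (emeasure hvol {y. b \<le> \<bar>u y\<bar>})"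
  have t: "emeasure hvol {y. b \<le> \<bar>u y\<bar>} = ennreal t" using B by (simp add: t_def less_top)
  then have st: "s \<le> t" using B s by (simp add: ennreal_le_iff2)
  then have t0: "0 < t" using s by simp
  let ?A = "{y. a < \<bar>u y\<bar>}" and ?B = "{y. b \<le> \<bar>u y\<bar>}" and ?I = "{y. a < \<bar>u y\<bar> \<and> \<bar>u y\<bar> < b}"
  let ?E = "\<integral>\<^sup>+y. indicator ?I y * ennreal ((hgrad u y)\<^sup>2) \<partial>hvol"
  let ?K = "\<lambda>y. \<integral>\<^sup>+x. indicator ?B x * ennreal (hkernel x y) \<partial>hvol"
  define L where "L = 1 / (4 * pi) * ln (\<beta> / s) + 4"
  have L: "0 \<le> L" using s by (simp add: L_def)
  have Bd: "?B \<subseteq> unit_disc" using ab in_disc_if_nonzero by fastforce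
  have "ennreal ((b - a) * t) = (\<integral>\<^sup>+x. ennreal (b - a) * indicator ?B x \<partial>hvol)"
    using ab t t0 by (simp add: nn_integral_cmult ennreal_mult')
  also have "\<dots> \<le> (\<integral>\<^sup>+x. indicator ?B x * (\<integral>\<^sup>+y. ennreal (hkernel x y) * (indicator ?I y * ennreal (hgrad u y)) \<partial>hvol) \<partial>hvol)"
  proof (rule nn_integral_mono)
    fix x :: "real^2"
    show "ennreal (b - a) * indicator ?B x \<le> indicator ?B x * (\<integral>\<^sup>+y. ennreal (hkernel x y) * (indicator ?I y * ennreal (hgrad u y)) \<partial>hvol)"
    proof (cases "x \<in> ?B")
      case True
      then have "x \<in> unit_disc" "min (max (\<bar>u x\<bar> - a) 0) (b - a) = b - a" using Bd ab by auto
      with truncation_le_potential[OF this(1) ab] show ?thesis using True by simp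
    qed simp
  qed
  also have "\<dots> = (\<integral>\<^sup>+x. (\<integral>\<^sup>+y. indicator ?B x * (ennreal (hkernel x y) * (indicator ?I y * ennreal (hgrad u y))) \<partial>hvol) \<partial>hvol)"
    by (intro nn_integral_cong nn_integral_cmult[symmetric]) measurable
  also have "\<dots> = (\<integral>\<^sup>+y. (\<integral>\<^sup>+x. indicator ?B x * (ennreal (hkernel x y) * (indicator ?I y * ennreal (hgrad u y))) \<partial>hvol) \<partial>hvol)"
    by (rule pair_sigma_finite.Fubini'[OF pair_sigma_finite_hvol, symmetric]) measurable
  also have "\<dots> = (\<integral>\<^sup>+y. (\<integral>\<^sup>+x. (indicator ?I y * ennreal (hgrad u y)) * (indicator ?B x * ennreal (hkernel x y)) \<partial>hvol) \<partial>hvol)"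
    by (simp add: mult_ac)
  also have "\<dots> = (\<integral>\<^sup>+y. (indicator ?I y * ennreal (hgrad u y)) * ?K y \<partial>hvol)"
    by (intro nn_integral_cong nn_integral_cmult) measurable
  also have "\<dots> = (\<integral>\<^sup>+y. (indicator ?I y * ennreal (hgrad u y)) * (indicator ?A y * ?K y) \<partial>hvol)"
    by (intro nn_integral_cong) (auto split: split_indicator)
  finally have "(ennreal ((b - a) * t))\<^sup>2 \<le> (\<integral>\<^sup>+y. (indicator ?I y * ennreal (hgrad u y)) * (indicator ?A y * ?K y) \<partial>hvol)\<^sup>2"
    by (intro power_mono) auto
  also have "\<dots> \<le> (\<integral>\<^sup>+y. (indicator ?I y * ennreal (hgrad u y))\<^sup>2 \<partial>hvol) * (\<integral>\<^sup>+y. (indicator ?A y * ?K y)\<^sup>2 \<partial>hvol)"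
    by (rule Cauchy_Schwarz_nn_integral) measurable
  also have "(\<integral>\<^sup>+y. (indicator ?I y * ennreal (hgrad u y))\<^sup>2 \<partial>hvol) = ?E"
    using hgrad_nonneg by (intro nn_integral_cong) (auto simp: ennreal_power split: split_indicator)
  also have "(\<integral>\<^sup>+y. (indicator ?A y * ?K y)\<^sup>2 \<partial>hvol) = (\<integral>\<^sup>+y. indicator ?A y * (?K y)\<^sup>2 \<partial>hvol)"
    by (intro nn_integral_cong) (auto split: split_indicator)
  also have "?E * \<dots> \<le> ?E * ennreal (t\<^sup>2 * L)"
    unfolding L_def using s st t A Bd by (intro mult_left_mono potential_estimate) auto
  finally have "ennreal (4 * pi / t\<^sup>2) * (ennreal ((b - a) * t))\<^sup>2 \<le> ennreal (4 * pi / t\<^sup>2) * (?E * ennreal (t\<^sup>2 * L))"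
    by (rule mult_left_mono) simp
  moreover have "ennreal (4 * pi / t\<^sup>2) * (ennreal ((b - a) * t))\<^sup>2 = ennreal (4 * pi * (b - a)\<^sup>2)"
    using ab t0 by (simp add: ennreal_power ennreal_mult'[symmetric] power_mult_distrib)
  moreover have "ennreal (4 * pi / t\<^sup>2) * (?E * ennreal (t\<^sup>2 * L)) = ?E * ennreal (ln (\<beta> / s) + 16 * pi)"
  proof -
    have "ennreal (4 * pi / t\<^sup>2) * ennreal (t\<^sup>2 * L) = ennreal (ln (\<beta> / s) + 16 * pi)"
      using t0 by (simp add: ennreal_mult'[symmetric]) (simp add: L_def algebra_simps)
    then show ?thesis by (subst mult.left_commute) simp
  qed
  ultimately show ?thesis by simp
qed

end

section \<open>A discrete form of Moser's one-dimensional lemma\<close>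

definition moser_bound :: "real \<Rightarrow> real" where
  "moser_bound C = exp (C / 2) * (\<Sum>k. exp (- real k / 2)) + 2 * exp (2 * C) * (\<Sum>k. exp (- real k / 8))"

lemma summable_exp_neg: "q > 0 \<Longrightarrow> summable (\<lambda>k. exp (- real k / q))"
proof -
  assume "q > 0"
  then have "summable (\<lambda>k. exp (- 1 / q) ^ k)" by (intro summable_geometric) simp
  then show ?thesis by (simp add: exp_of_nat_mult[symmetric])
qed

lemma moser_bound_nonneg: "0 \<le> moser_bound C"
  unfolding moser_bound_def
  by (intro add_nonneg_nonneg mult_nonneg_nonneg suminf_nonneg summable_exp_neg) auto

text \<open>With \<open>X = i + C\<close> and \<open>Y = j - i + C\<close> the hypotheses give \<open>a\<^sup>\<prime> \<le> \<surd>(\<phi> X) + \<surd>((1 - \<phi>) Y)\<close>, and the square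
  of the right-hand side is \<open>X + Y - (\<surd>((1 - \<phi>) X) - \<surd>(\<phi> Y))\<^sup>2\<close>. So if \<open>a\<^sup>\<prime>\<close> is nearly as large as it can be, then
  \<open>\<phi> Y\<close> is nearly \<open>(1 - \<phi>) X\<close>, which in turn is small if \<open>a\<close> is nearly as large as it can be.\<close>
lemma moser_deficit:
  fixes a \<phi> C i j a' :: real
  assumes \<phi>: "0 \<le> \<phi>" "\<phi> \<le> 1" and C: "0 \<le> C" and ij: "0 \<le> i" "i \<le> j" and a: "0 \<le> a" "a \<le> a'"
    and h1: "a\<^sup>2 \<le> \<phi> * (i + C)" and h2: "(a' - a)\<^sup>2 \<le> (1 - \<phi>) * (j - i + C)"
    and N: "i - a\<^sup>2 + C \<le> N" "j - a'\<^sup>2 + 2 * C \<le> N"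
  shows "\<phi> * (j - i + C) \<le> 4 * N"
proof -
  \<comment> \<open>The numbers \<open>p\<close>, \<open>q\<close>, \<open>r\<close>, \<open>s\<close> satisfy \<open>r s = p q\<close>, which turns \<open>(r + s)\<^sup>2\<close> into \<open>X + Y - (p - q)\<^sup>2\<close>.\<close>
  define X Y where "X = i + C" and "Y = j - i + C"
  have XY: "0 \<le> X" "0 \<le> Y" using C ij by (auto simp: X_def Y_def)
  define p q r s where "p = sqrt ((1 - \<phi>) * X)" and "q = sqrt (\<phi> * Y)" and "r = sqrt (\<phi> * X)" and "s = sqrt ((1 - \<phi>) * Y)"
  have sq: "p\<^sup>2 = (1 - \<phi>) * X" "q\<^sup>2 = \<phi> * Y" "r\<^sup>2 = \<phi> * X" "s\<^sup>2 = (1 - \<phi>) * Y"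
    using XY \<phi> by (auto simp: p_def q_def r_def s_def)
  have pos: "0 \<le> p" "0 \<le> q" "0 \<le> r" "0 \<le> s" using XY \<phi> by (auto simp: p_def q_def r_def s_def)
  have rs: "r * s = p * q"
    unfolding p_def q_def r_def s_def real_sqrt_mult[symmetric] by (simp add: mult_ac)
  have "a \<le> r" unfolding r_def X_def using h1 by (intro real_le_rsqrt)
  moreover have "a' - a \<le> s" unfolding s_def Y_def using h2 by (intro real_le_rsqrt)
  ultimately have "a' \<le> r + s" by simp
  then have "a'\<^sup>2 \<le> (r + s)\<^sup>2" using a by (intro power_mono) auto
  also have "\<dots> = (p\<^sup>2 + q\<^sup>2 + r\<^sup>2 + s\<^sup>2) - (p - q)\<^sup>2"
    using rs by (simp add: power2_eq_square algebra_simps)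
  also have "p\<^sup>2 + q\<^sup>2 + r\<^sup>2 + s\<^sup>2 = X + Y" unfolding sq by (simp add: algebra_simps)
  finally have "(q - p)\<^sup>2 \<le> N"
    using N(2) by (simp add: X_def Y_def power2_commute)
  then have 1: "q - p \<le> sqrt N" by (rule real_le_rsqrt)
  have "p\<^sup>2 \<le> N" using N(1) h1 unfolding sq by (simp add: X_def algebra_simps)
  then have 2: "p \<le> sqrt N" by (rule real_le_rsqrt)
  from 1 2 have "q \<le> 2 * sqrt N" by simp
  then have "q\<^sup>2 \<le> (2 * sqrt N)\<^sup>2" using pos by (intro power_mono) auto
  moreover have "0 \<le> N" using \<open>p\<^sup>2 \<le> N\<close> by (meson order_trans zero_le_power2)
  ultimately show ?thesis unfolding sq by (simp add: Y_def power_mult_distrib)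
qed

lemma sum_inj_le_suminf:
  fixes g :: "nat \<Rightarrow> real"
  assumes "summable g" "\<And>k. 0 \<le> g k" "finite I" "inj_on h I"
  shows "(\<Sum>i\<in>I. g (h i)) \<le> suminf g"
proof -
  have "(\<Sum>i\<in>I. g (h i)) = (\<Sum>k\<in>h ` I. g k)" using assms by (simp add: sum.reindex)
  also have "\<dots> \<le> suminf g" using assms by (intro sum_le_suminf) auto
  finally show ?thesis .
qed

text \<open>Let \<open>d i = i - (a i)\<^sup>2\<close>, so that the sum is over \<open>exp (- d i)\<close>. As long as less than half of the energy is spent,
  \<open>d i\<close> grows like \<open>i/2\<close>. Among the other indices choose \<open>m\<close> with \<open>d m\<close> minimal: by \<open>moser_deficit\<close> two indices
  with small \<open>d\<close> must be close to each other, so \<open>d\<close> grows linearly with the distance from \<open>m\<close>. Both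
  parts of the sum are then dominated by geometric series whose sums do not depend on \<open>m\<close> or \<open>n\<close>.\<close>
lemma moser_sequence:
  fixes a \<phi> :: "nat \<Rightarrow> real"
  assumes C: "0 \<le> C" and \<phi>: "\<And>i. 0 \<le> \<phi> i" "\<And>i. \<phi> i \<le> 1"
    and a: "\<And>i. 0 \<le> a i" "mono a"
    and h1: "\<And>i. (a i)\<^sup>2 \<le> \<phi> i * (real i + C)"
    and h2: "\<And>i j. i < j \<Longrightarrow> (a j - a i)\<^sup>2 \<le> (1 - \<phi> i) * (real j - real i + C)"
  shows "(\<Sum>i<n. exp ((a i)\<^sup>2 - real i)) \<le> moser_bound C"
proof -
  define d where "d = (\<lambda>i. real i - (a i)\<^sup>2)"
  define I1 I2 where "I1 = {i \<in> {..<n}. \<phi> i < 1 / 2}" and "I2 = {i \<in> {..<n}. 1 / 2 \<le> \<phi> i}"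
  have fin: "finite I1" "finite I2" by (auto simp: I1_def I2_def)
  have "(\<Sum>i<n. exp ((a i)\<^sup>2 - real i)) = (\<Sum>i\<in>I1 \<union> I2. exp (- d i))"
    by (rule sum.cong) (auto simp: I1_def I2_def d_def)
  also have "\<dots> = (\<Sum>i\<in>I1. exp (- d i)) + (\<Sum>i\<in>I2. exp (- d i))"
    using fin by (intro sum.union_disjoint) (auto simp: I1_def I2_def)
  also have "(\<Sum>i\<in>I1. exp (- d i)) \<le> exp (C / 2) * (\<Sum>k. exp (- real k / 2))"
  proof -
    have "exp (- d i) \<le> exp (C / 2) * exp (- real i / 2)" if "i \<in> I1" for i
    proof -
      have "\<phi> i * (real i + C) \<le> 1 / 2 * (real i + C)"
        using that C by (intro mult_right_mono) (auto simp: I1_def)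
      then have "- d i \<le> C / 2 + - real i / 2" using h1[of i] by (simp add: d_def)
      then show ?thesis unfolding exp_add[symmetric] by simp
    qed
    then have "(\<Sum>i\<in>I1. exp (- d i)) \<le> (\<Sum>i\<in>I1. exp (C / 2) * exp (- real i / 2))"
      by (rule sum_mono)
    also have "\<dots> = exp (C / 2) * (\<Sum>i\<in>I1. exp (- real i / 2))" by (simp add: sum_distrib_left)
    also have "\<dots> \<le> exp (C / 2) * (\<Sum>k. exp (- real k / 2))"
      using sum_inj_le_suminf[of "\<lambda>k. exp (- real k / 2)" I1 id] summable_exp_neg[of 2] fin
      by (intro mult_left_mono) auto
    finally show ?thesis .
  qed
  also have "(\<Sum>i\<in>I2. exp (- d i)) \<le> 2 * exp (2 * C) * (\<Sum>k. exp (- real k / 8))"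
  proof (cases "I2 = {}")
    case True
    then show ?thesis using suminf_nonneg[OF summable_exp_neg[of 8]] by simp
  next
    case False
    obtain m where m: "m \<in> I2" and min: "\<And>i. i \<in> I2 \<Longrightarrow> d m \<le> d i"
      using ex_min_if_finite[of "d ` I2"] fin False by (metis (mono_tags) arg_min_if_finite(1) arg_min_least)
    have key: "real j - real i \<le> 8 * (d k + 2 * C)"
      if "i < j" "i \<in> I2" "j \<in> I2" "d i \<le> d k" "d j \<le> d k" for i j k
    proof -
      have "1 / 2 * (real j - real i) \<le> \<phi> i * (real j - real i + C)"
        using that C by (intro mult_mono) (auto simp: I2_def)
      also have "\<dots> \<le> 4 * (d k + 2 * C)"
        using that C \<phi> a h1[of i] h2[of i j] monoD[OF a(2), of i j]
        by (intro moser_deficit[of _ _ _ _ "a i" "a j"]) (auto simp: d_def)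
      finally show ?thesis by simp
    qed
    have dm: "d i \<ge> - C" for i
    proof -
      have "\<phi> i * (real i + C) \<le> 1 * (real i + C)" using \<phi> C by (intro mult_right_mono) auto
      then show ?thesis using h1[of i] by (simp add: d_def)
    qed
    have bound: "exp (- d j) \<le> exp (2 * C) * exp (- real k / 8)"
      if "j \<in> I2" and k: "real k = \<bar>real j - real m\<bar>" for j k
    proof -
      have "\<bar>real j - real m\<bar> \<le> 8 * (d j + 2 * C)"
      proof (cases j m rule: linorder_cases)
        case less then show ?thesis using key[of j m j] min m that by simp
      next
        case equal then show ?thesis using dm[of j] C by simp
      next
        case greater then show ?thesis using key[of m j j] min m that by simp
      qed
      then have "- d j \<le> 2 * C + - real k / 8" using k by simp
      then show ?thesis unfolding exp_add[symmetric] by simp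
    qed
    have "(\<Sum>j\<in>I2. exp (- d j)) = (\<Sum>j\<in>{j\<in>I2. j \<le> m}. exp (- d j)) + (\<Sum>j\<in>{j\<in>I2. m < j}. exp (- d j))"
      using fin by (subst sum.union_disjoint[symmetric]) (auto intro!: sum.cong)
    also have "\<dots> \<le> (\<Sum>j\<in>{j\<in>I2. j \<le> m}. exp (2 * C) * exp (- real (m - j) / 8))
                + (\<Sum>j\<in>{j\<in>I2. m < j}. exp (2 * C) * exp (- real (j - m) / 8))"
      by (intro add_mono sum_mono bound) auto
    also have "\<dots> = exp (2 * C) * ((\<Sum>j\<in>{j\<in>I2. j \<le> m}. exp (- real (m - j) / 8)) + (\<Sum>j\<in>{j\<in>I2. m < j}. exp (- real (j - m) / 8)))"
      by (simp add: sum_distrib_left distrib_left)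
    also have "\<dots> \<le> exp (2 * C) * ((\<Sum>k. exp (- real k / 8)) + (\<Sum>k. exp (- real k / 8)))"
      using fin summable_exp_neg[of 8]
      by (intro mult_left_mono add_mono
           sum_inj_le_suminf[where g="\<lambda>k. exp (- real k / 8)" and h="\<lambda>j. m - j"]
           sum_inj_le_suminf[where g="\<lambda>k. exp (- real k / 8)" and h="\<lambda>j. j - m"])
         (auto simp: inj_on_def)
    finally show ?thesis by simp
  qed
  finally show ?thesis unfolding moser_bound_def by simp
qed

section \<open>The sharp inequality for hyperbolic area\<close>

locale unit_energy_function = disc_function +
  assumes energy: "(\<integral>\<^sup>+y. ennreal ((hgrad u y)\<^sup>2) \<partial>hvol) \<le> 1"
begin

text \<open>The largest height whose superlevel set still has area at least \<open>exp (- i)\<close>. The element \<open>0\<close> makes the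
  supremum \<open>0\<close> for functions whose support has smaller area.\<close>
definition level :: "nat \<Rightarrow> real" where
  "level i = Sup (insert 0 {l. 0 \<le> l \<and> ennreal (exp (- real i)) \<le> emeasure hvol {y. l \<le> \<bar>u y\<bar>}})"

lemma square_integral: "(\<integral>\<^sup>+x. ennreal ((u x)\<^sup>2) \<partial>hvol) \<le> 4"
proof -
  have "(\<integral>\<^sup>+x. ennreal ((u x)\<^sup>2) \<partial>hvol) \<le> 4 * (\<integral>\<^sup>+y. ennreal ((hgrad u y)\<^sup>2) \<partial>hvol)"
    using poincare by (simp add: nn_integral_hgrad_square)
  also have "\<dots> \<le> 4 * 1" using energy by (rule mult_left_mono) simp
  finally show ?thesis by simp
qed

lemma chebyshev:
  assumes "0 \<le> l"
  shows "ennreal (l\<^sup>2) * emeasure hvol {y. l \<le> \<bar>u y\<bar>} \<le> 4"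
proof -
  have "ennreal (l\<^sup>2) * emeasure hvol {y. l \<le> \<bar>u y\<bar>} = (\<integral>\<^sup>+y. ennreal (l\<^sup>2) * indicator {y. l \<le> \<bar>u y\<bar>} y \<partial>hvol)"
    by (simp add: nn_integral_cmult)
  also have "\<dots> \<le> (\<integral>\<^sup>+y. ennreal ((u y)\<^sup>2) \<partial>hvol)"
  proof (rule nn_integral_mono)
    fix y show "ennreal (l\<^sup>2) * indicator {y. l \<le> \<bar>u y\<bar>} y \<le> ennreal ((u y)\<^sup>2)"
      using assms power_mono[of l "\<bar>u y\<bar>" 2] by (auto intro!: ennreal_leI split: split_indicator)
  qed
  also note square_integral
  finally show ?thesis .
qed

lemma superlevel_finite:
  assumes "0 < l" shows "emeasure hvol {y. l \<le> \<bar>u y\<bar>} \<noteq> \<infinity>"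
  using chebyshev[of l] assms by (auto simp: ennreal_mult_top top_unique)

lemma level_bdd: "bdd_above (insert 0 {l. 0 \<le> l \<and> ennreal (exp (- real i)) \<le> emeasure hvol {y. l \<le> \<bar>u y\<bar>}})"
proof (rule bdd_aboveI[where M="sqrt (4 * exp (real i))"])
  fix l assume "l \<in> insert 0 {l. 0 \<le> l \<and> ennreal (exp (- real i)) \<le> emeasure hvol {y. l \<le> \<bar>u y\<bar>}}"
  then consider "l = 0" | "0 \<le> l" "ennreal (exp (- real i)) \<le> emeasure hvol {y. l \<le> \<bar>u y\<bar>}" by auto
  then show "l \<le> sqrt (4 * exp (real i))"
  proof cases
    case 2
    have "ennreal (l\<^sup>2) * ennreal (exp (- real i)) \<le> ennreal (l\<^sup>2) * emeasure hvol {y. l \<le> \<bar>u y\<bar>}"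
      using 2 by (intro mult_left_mono) auto
    also have "\<dots> \<le> 4" using 2 by (intro chebyshev)
    finally have "ennreal (l\<^sup>2 * exp (- real i)) \<le> ennreal 4" by (simp add: ennreal_mult')
    then have "l\<^sup>2 * exp (- real i) \<le> 4" by (subst (asm) ennreal_le_iff) auto
    then have "l\<^sup>2 \<le> 4 * exp (real i)" by (simp add: exp_minus field_simps)
    then show ?thesis by (rule real_le_rsqrt)
  qed simp
qed

lemma level_nonneg: "0 \<le> level i"
  unfolding level_def by (rule cSup_upper[OF _ level_bdd]) simp

lemma level_mono: "mono level"
proof (rule monoI)
  fix i j :: nat assume "i \<le> j"
  then have e: "ennreal (exp (- real j)) \<le> ennreal (exp (- real i))" by (intro ennreal_leI) simp
  show "level i \<le> level j"
    unfolding level_def by (rule cSup_subset_mono[OF _ level_bdd]) (use order_trans[OF e] in auto)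
qed

lemma measure_above_level: "emeasure hvol {y. level i < \<bar>u y\<bar>} \<le> ennreal (exp (- real i))"
proof -
  define S where "S = (\<lambda>n. {y. level i + 1 / real (Suc n) \<le> \<bar>u y\<bar>})"
  have eq: "{y. level i < \<bar>u y\<bar>} = (\<Union>n. S n)"
  proof (intro equalityI subsetI)
    fix y assume "y \<in> {y. level i < \<bar>u y\<bar>}"
    then have "0 < \<bar>u y\<bar> - level i" by simp
    then obtain n where "inverse (real (Suc n)) < \<bar>u y\<bar> - level i" using reals_Archimedean by blast
    then show "y \<in> (\<Union>n. S n)" by (auto simp: S_def field_simps intro!: exI[of _ n])
  next
    fix y assume "y \<in> (\<Union>n. S n)"
    then obtain n where "level i + 1 / real (Suc n) \<le> \<bar>u y\<bar>" by (auto simp: S_def)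
    moreover have "0 < 1 / real (Suc n)" by simp
    ultimately show "y \<in> {y. level i < \<bar>u y\<bar>}" unfolding mem_Collect_eq by linarith
  qed
  have "incseq S"
  proof (rule incseq_SucI)
    fix n
    have "1 / real (Suc (Suc n)) \<le> 1 / real (Suc n)" by (simp add: field_simps)
    then show "S n \<subseteq> S (Suc n)" by (auto simp: S_def)
  qed
  then have "emeasure hvol {y. level i < \<bar>u y\<bar>} = (SUP n. emeasure hvol (S n))"
    unfolding eq by (intro SUP_emeasure_incseq[symmetric]) (auto simp: S_def)
  also have "\<dots> \<le> ennreal (exp (- real i))"
  proof (rule SUP_least, rule ccontr)
    fix n assume "\<not> emeasure hvol (S n) \<le> ennreal (exp (- real i))"
    then have "level i + 1 / real (Suc n) \<le> level i"
      unfolding level_def[of i] using level_nonneg[of i, unfolded level_def]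
      by (intro cSup_upper[OF _ level_bdd]) (auto simp: S_def level_def intro: add_nonneg_nonneg)
    moreover have "0 < 1 / real (Suc n)" by simp
    ultimately show False by simp
  qed
  finally show ?thesis .
qed

lemma measure_at_level:
  assumes "0 < level i"
  shows "ennreal (exp (- real i)) \<le> emeasure hvol {y. level i \<le> \<bar>u y\<bar>}"
proof -
  define c where "c = (\<lambda>n. level i * (1 - 1 / real (n + 2)))"
  have c: "0 < c n" "c n < level i" for n
  proof -
    have "0 < 1 - 1 / real (n + 2)" "1 - 1 / real (n + 2) < 1" by (auto simp: field_simps)
    then show "0 < c n" "c n < level i"
      using assms mult_strict_left_mono[of "1 - 1 / real (n + 2)" 1 "level i"] by (auto simp: c_def)
  qed
  define S where "S = (\<lambda>n. {y. c n \<le> \<bar>u y\<bar>})"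
  have "c \<longlonglongrightarrow> level i * (1 - 0)"
    unfolding c_def by (intro tendsto_intros LIMSEQ_ignore_initial_segment[OF lim_1_over_n])
  then have lim: "c \<longlonglongrightarrow> level i" by simp
  have eq: "{y. level i \<le> \<bar>u y\<bar>} = (\<Inter>n. S n)"
  proof (intro equalityI subsetI)
    fix y assume "y \<in> {y. level i \<le> \<bar>u y\<bar>}"
    then show "y \<in> (\<Inter>n. S n)" using c by (fastforce simp: S_def intro: less_imp_le less_le_trans)
  next
    fix y assume "y \<in> (\<Inter>n. S n)"
    then have "\<And>n. c n \<le> \<bar>u y\<bar>" by (auto simp: S_def)
    then show "y \<in> {y. level i \<le> \<bar>u y\<bar>}" using LIMSEQ_le_const2[OF lim] by blast
  qed
  have "decseq S"
  proof (rule decseq_SucI)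
    fix n
    have "1 / real (Suc n + 2) \<le> 1 / real (n + 2)" by (simp add: field_simps)
    then have "c n \<le> c (Suc n)" unfolding c_def using assms by (intro mult_left_mono) auto
    then show "S (Suc n) \<subseteq> S n" by (auto simp: S_def)
  qed
  then have "emeasure hvol {y. level i \<le> \<bar>u y\<bar>} = (INF n. emeasure hvol (S n))"
    unfolding eq using superlevel_finite[OF c(1)] by (intro INF_emeasure_decseq[symmetric]) (auto simp: S_def)
  also have "ennreal (exp (- real i)) \<le> \<dots>"
  proof (rule INF_greatest)
    fix n
    obtain l where l: "l \<in> insert 0 {l. 0 \<le> l \<and> ennreal (exp (- real i)) \<le> emeasure hvol {y. l \<le> \<bar>u y\<bar>}}" "c n < l"
      using less_cSup_iff[OF _ level_bdd, of i "c n"] c(2)[of n] unfolding level_def by auto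
    then have "ennreal (exp (- real i)) \<le> emeasure hvol {y. l \<le> \<bar>u y\<bar>}" using c(1)[of n] by auto
    also have "\<dots> \<le> emeasure hvol (S n)" using l unfolding S_def by (intro emeasure_mono) auto
    finally show "ennreal (exp (- real i)) \<le> emeasure hvol (S n)" .
  qed
  finally show ?thesis .
qed

definition level_energy :: "nat \<Rightarrow> real" where
  "level_energy i = enn2real (\<integral>\<^sup>+y. indicator {y. 0 < \<bar>u y\<bar> \<and> \<bar>u y\<bar> < level i} y * ennreal ((hgrad u y)\<^sup>2) \<partial>hvol)"

lemma level_energy:
  "(\<integral>\<^sup>+y. indicator {y. 0 < \<bar>u y\<bar> \<and> \<bar>u y\<bar> < level i} y * ennreal ((hgrad u y)\<^sup>2) \<partial>hvol) = ennreal (level_energy i)"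
  and level_energy_nonneg: "0 \<le> level_energy i" and level_energy_le_1: "level_energy i \<le> 1"
proof -
  let ?I = "\<integral>\<^sup>+y. indicator {y. 0 < \<bar>u y\<bar> \<and> \<bar>u y\<bar> < level i} y * ennreal ((hgrad u y)\<^sup>2) \<partial>hvol"
  have "?I \<le> (\<integral>\<^sup>+y. ennreal ((hgrad u y)\<^sup>2) \<partial>hvol)"
    by (intro nn_integral_mono) (auto split: split_indicator)
  then have le: "?I \<le> ennreal 1" using energy by simp
  then have "?I \<noteq> \<infinity>" by (auto simp: top_unique)
  then show eq: "?I = ennreal (level_energy i)" by (simp add: level_energy_def less_top)
  show "0 \<le> level_energy i" by (simp add: level_energy_def)
  show "level_energy i \<le> 1" using le unfolding eq by (simp add: ennreal_le_1)
qed

text \<open>Here the lower height is \<open>0\<close>, whose superlevel set may have any area: this is the case \<open>\<beta> = 1\<close>.\<close>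
lemma level_capacity_0: "4 * pi * (level i)\<^sup>2 \<le> level_energy i * (real i + 16 * pi)"
proof (cases "level i = 0")
  case True
  then show ?thesis using level_energy_nonneg[of i] by simp
next
  case False
  then have l: "0 < level i" using level_nonneg[of i] by simp
  have "ennreal (4 * pi * (level i - 0)\<^sup>2) \<le>
      (\<integral>\<^sup>+y. indicator {y. 0 < \<bar>u y\<bar> \<and> \<bar>u y\<bar> < level i} y * ennreal ((hgrad u y)\<^sup>2) \<partial>hvol)
        * ennreal (ln (1 / exp (- real i)) + 16 * pi)"
    using l measure_at_level[OF l] superlevel_finite[OF l] by (intro level_set_capacity) auto
  also have "\<dots> = ennreal (level_energy i * (real i + 16 * pi))"
    unfolding level_energy using level_energy_nonneg by (simp add: ln_div ennreal_mult')
  finally show ?thesis using level_energy_nonneg by (subst (asm) ennreal_le_iff) auto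
qed

lemma level_capacity:
  assumes "i < j"
  shows "4 * pi * (level j - level i)\<^sup>2 \<le> (1 - level_energy i) * (real j - real i + 16 * pi)"
proof (cases "level j = level i")
  case True
  then show ?thesis using level_energy_le_1[of i] assms by simp
next
  case False
  then have l: "level i < level j" using monoD[OF level_mono, of i j] assms by simp
  then have l0: "0 < level j" using level_nonneg[of i] by simp
  let ?E = "\<integral>\<^sup>+y. indicator {y. level i < \<bar>u y\<bar> \<and> \<bar>u y\<bar> < level j} y * ennreal ((hgrad u y)\<^sup>2) \<partial>hvol"
  have "ennreal (level_energy i) + ?E = 
    (\<integral>\<^sup>+y. indicator {y. 0 < \<bar>u y\<bar> \<and> \<bar>u y\<bar> < level i} y * ennreal ((hgrad u y)\<^sup>2)
        + indicator {y. level i < \<bar>u y\<bar> \<and> \<bar>u y\<bar> < level j} y * ennreal ((hgrad u y)\<^sup>2) \<partial>hvol)"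
    unfolding level_energy[symmetric] by (rule nn_integral_add[symmetric]) measurable
  also have "\<dots> \<le> (\<integral>\<^sup>+y. ennreal ((hgrad u y)\<^sup>2) \<partial>hvol)"
    by (intro nn_integral_mono) (auto split: split_indicator)
  also have "\<dots> \<le> ennreal 1" using energy by simp
  also have "\<dots> = ennreal (level_energy i) + ennreal (1 - level_energy i)"
    using level_energy_nonneg level_energy_le_1 by (subst ennreal_plus[symmetric]) auto
  finally have E: "?E \<le> ennreal (1 - level_energy i)"
    by (simp add: ennreal_add_left_cancel_le)
  have "ennreal (4 * pi * (level j - level i)\<^sup>2) \<le> ?E * ennreal (ln (exp (- real i) / exp (- real j)) + 16 * pi)"
    using l l0 level_nonneg measure_above_level measure_at_level[OF l0] superlevel_finite[OF l0] assms
    by (intro level_set_capacity) auto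
  also have "\<dots> \<le> ennreal (1 - level_energy i) * ennreal (real j - real i + 16 * pi)"
    using E by (intro mult_mono) (auto simp: ln_div)
  also have "\<dots> = ennreal ((1 - level_energy i) * (real j - real i + 16 * pi))"
    using level_energy_le_1 by (simp add: ennreal_mult')
  finally show ?thesis using level_energy_le_1 assms by (subst (asm) ennreal_le_iff) (auto intro!: mult_nonneg_nonneg)
qed

lemma level_sum: "(\<Sum>i<n. exp (4 * pi * (level i)\<^sup>2 - real i)) \<le> moser_bound (16 * pi)"
proof -
  have "(\<Sum>i<n. exp ((sqrt (4 * pi) * level i)\<^sup>2 - real i)) \<le> moser_bound (16 * pi)"
  proof (rule moser_sequence[where \<phi>=level_energy])
    show "(sqrt (4 * pi) * level i)\<^sup>2 \<le> level_energy i * (real i + 16 * pi)" for i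
      using level_capacity_0[of i] by (simp add: power_mult_distrib)
    show "(sqrt (4 * pi) * level j - sqrt (4 * pi) * level i)\<^sup>2
        \<le> (1 - level_energy i) * (real j - real i + 16 * pi)" if "i < j" for i j
      using level_capacity[OF that] by (simp add: right_diff_distrib[symmetric] power_mult_distrib)
    show "mono (\<lambda>i. sqrt (4 * pi) * level i)"
      using level_mono by (auto simp: mono_def intro!: mult_left_mono)
  qed (auto simp: level_energy_nonneg level_energy_le_1 level_nonneg)
  then show ?thesis by (simp add: power_mult_distrib)
qed

text \<open>On \<open>{level i < \<bar>u\<bar> \<le> level (i + 1)}\<close>, a set of area at most \<open>exp (- i)\<close>, the integrand is at most
  \<open>exp (4 \<pi> (level (i + 1))\<^sup>2)\<close>; these contributions add up to the sum in \<open>level_sum\<close>. The remaining set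
  \<open>{\<bar>u\<bar> \<le> level 0}\<close> may have large area, but \<open>level 0 \<le> 2\<close>, so there the integrand is at most a multiple of
  \<open>u\<^sup>2\<close>.\<close>
lemma moser_trudinger:
  "(\<integral>\<^sup>+x. ennreal (exp (4 * pi * (u x)\<^sup>2) - 1) \<partial>hvol)
     \<le> ennreal (16 * pi * exp (16 * pi) + exp 1 * moser_bound (16 * pi))"
proof -
  have l0: "4 * pi * (level 0)\<^sup>2 \<le> 16 * pi"
  proof -
    have "4 * pi * (level 0)\<^sup>2 \<le> level_energy 0 * (16 * pi)" using level_capacity_0[of 0] by simp
    also have "\<dots> \<le> 1 * (16 * pi)" using level_energy_le_1 by (intro mult_right_mono) auto
    finally show ?thesis by simp
  qed
  let ?low = "\<lambda>x. ennreal (4 * pi * exp (16 * pi)) * ennreal ((u x)\<^sup>2)"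
  let ?high = "\<lambda>i x. ennreal (exp (4 * pi * (level (Suc i))\<^sup>2)) * indicator {x. level i < \<bar>u x\<bar>} x"
  have "AE x in hvol. \<exists>i. \<bar>u x\<bar> \<le> level i"
  proof (rule AE_I[where N="{x. \<forall>i. level i < \<bar>u x\<bar>}"])
    have "emeasure hvol {x. \<forall>i. level i < \<bar>u x\<bar>} \<le> ennreal (exp (- real i))" for i
      by (rule order_trans[OF emeasure_mono measure_above_level[of i]]) auto
    moreover have "(\<lambda>i. ennreal (exp (- real i))) \<longlonglongrightarrow> ennreal 0"
    proof (rule tendsto_ennrealI)
      show "(\<lambda>i. exp (- real i)) \<longlonglongrightarrow> 0"
        by (rule filterlim_compose[OF exp_at_bot]) (simp add: filterlim_uminus_at_bot filterlim_real_sequentially)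
    qed
    ultimately have "emeasure hvol {x. \<forall>i. level i < \<bar>u x\<bar>} \<le> ennreal 0"
      by (intro LIMSEQ_le_const[where X="\<lambda>i. ennreal (exp (- real i))"]) auto
    then show "emeasure hvol {x. \<forall>i. level i < \<bar>u x\<bar>} = 0" by simp
  qed (auto simp: not_le)
  then have "(\<integral>\<^sup>+x. ennreal (exp (4 * pi * (u x)\<^sup>2) - 1) \<partial>hvol) \<le> (\<integral>\<^sup>+x. ?low x + (\<Sum>i. ?high i x) \<partial>hvol)"
  proof (intro nn_integral_mono_AE, eventually_elim)
    case (elim x)
    show ?case
    proof (cases "\<bar>u x\<bar> \<le> level 0")
      case True
      then have "(u x)\<^sup>2 \<le> (level 0)\<^sup>2" using level_nonneg[of 0] by (simp add: abs_le_square_iff[symmetric])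
      then have "4 * pi * (u x)\<^sup>2 \<le> 16 * pi" using l0 mult_left_mono[of "(u x)\<^sup>2" "(level 0)\<^sup>2" "4 * pi"] by simp
      define t where "t = 4 * pi * (u x)\<^sup>2"
      have "0 \<le> t" "t \<le> 16 * pi" using \<open>4 * pi * (u x)\<^sup>2 \<le> 16 * pi\<close> by (auto simp: t_def)
      have "1 - t \<le> exp (- t)" using exp_ge_add_one_self[of "- t"] by simp
      then have "(1 - t) * exp t \<le> exp (- t) * exp t" by (rule mult_right_mono) simp
      then have "exp t - 1 \<le> t * exp t" by (simp add: exp_add[symmetric] algebra_simps)
      also have "\<dots> \<le> t * exp (16 * pi)" using \<open>0 \<le> t\<close> \<open>t \<le> 16 * pi\<close> by (intro mult_left_mono) auto
      finally have "ennreal (exp t - 1) \<le> ennreal ((4 * pi * exp (16 * pi)) * (u x)\<^sup>2)"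
        by (intro ennreal_leI) (simp add: t_def mult_ac)
      also have "\<dots> = ?low x" by (rule ennreal_mult') simp
      finally show ?thesis unfolding t_def by (rule add_increasing2[rotated]) simp
    next
      case False
      define k where "k = (LEAST i. \<bar>u x\<bar> \<le> level i)"
      have k: "\<bar>u x\<bar> \<le> level k" unfolding k_def by (rule LeastI_ex[OF elim(2)])
      then obtain i where i: "k = Suc i" using False by (cases k) auto
      have "\<not> \<bar>u x\<bar> \<le> level i" using not_less_Least[of i "\<lambda>i. \<bar>u x\<bar> \<le> level i"] i unfolding k_def by simp
      then have xi: "level i < \<bar>u x\<bar>" by simp
      have "(u x)\<^sup>2 \<le> (level (Suc i))\<^sup>2" using k i level_nonneg[of "Suc i"] by (simp add: abs_le_square_iff[symmetric])
      then have "exp (4 * pi * (u x)\<^sup>2) - 1 \<le> exp (4 * pi * (level (Suc i))\<^sup>2)"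
        by (smt (verit) exp_le_cancel_iff mult_left_mono pi_gt_zero)
      then have "ennreal (exp (4 * pi * (u x)\<^sup>2) - 1) \<le> ?high i x" using xi by (simp add: ennreal_leI)
      also have "\<dots> \<le> (\<Sum>i. ?high i x)"
      proof -
        have "f i \<le> suminf f" for f :: "nat \<Rightarrow> ennreal" using sum_le_suminf[of f "{i}"] by simp
        then show ?thesis .
      qed
      finally show ?thesis by (rule add_increasing[rotated]) simp
    qed
  qed
  also have "\<dots> = (\<integral>\<^sup>+x. ?low x \<partial>hvol) + (\<integral>\<^sup>+x. (\<Sum>i. ?high i x) \<partial>hvol)"
    by (rule nn_integral_add) measurable
  also have "(\<integral>\<^sup>+x. (\<Sum>i. ?high i x) \<partial>hvol) = (\<Sum>i. \<integral>\<^sup>+x. ?high i x \<partial>hvol)"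
    by (rule nn_integral_suminf) measurable
  also have "\<dots> \<le> ennreal (exp 1 * moser_bound (16 * pi))"
  proof -
    have shell: "(\<integral>\<^sup>+x. ?high i x \<partial>hvol) \<le> ennreal (exp 1 * exp (4 * pi * (level (Suc i))\<^sup>2 - real (Suc i)))" for i
    proof -
      have "(\<integral>\<^sup>+x. ?high i x \<partial>hvol) = ennreal (exp (4 * pi * (level (Suc i))\<^sup>2)) * emeasure hvol {x. level i < \<bar>u x\<bar>}"
        by (simp add: nn_integral_cmult)
      also have "\<dots> \<le> ennreal (exp (4 * pi * (level (Suc i))\<^sup>2)) * ennreal (exp (- real i))"
        by (intro mult_left_mono measure_above_level) simp
      also have "\<dots> = ennreal (exp 1 * exp (4 * pi * (level (Suc i))\<^sup>2 - real (Suc i)))"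
        by (simp add: ennreal_mult'[symmetric] exp_add[symmetric])
      finally show ?thesis .
    qed
    have "(\<Sum>i<n. \<integral>\<^sup>+x. ?high i x \<partial>hvol) \<le> ennreal (exp 1 * moser_bound (16 * pi))" for n
    proof -
      have "(\<Sum>i<n. \<integral>\<^sup>+x. ?high i x \<partial>hvol) \<le> (\<Sum>i<n. ennreal (exp 1 * exp (4 * pi * (level (Suc i))\<^sup>2 - real (Suc i))))"
        by (rule sum_mono[OF shell])
      also have "\<dots> = ennreal (\<Sum>i<n. exp 1 * exp (4 * pi * (level (Suc i))\<^sup>2 - real (Suc i)))"
        by (rule sum_ennreal) simp
      also have "\<dots> \<le> ennreal (exp 1 * moser_bound (16 * pi))"
      proof (rule ennreal_leI)
        have "(\<Sum>i<n. exp (4 * pi * (level (Suc i))\<^sup>2 - real (Suc i))) \<le> (\<Sum>i<Suc n. exp (4 * pi * (level i)\<^sup>2 - real i))"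
          unfolding sum.lessThan_Suc_shift by simp
        also note level_sum
        finally show "(\<Sum>i<n. exp 1 * exp (4 * pi * (level (Suc i))\<^sup>2 - real (Suc i))) \<le> exp 1 * moser_bound (16 * pi)"
          by (simp add: sum_distrib_left[symmetric])
      qed
      finally show ?thesis .
    qed
    then show ?thesis unfolding suminf_eq_SUP by (rule SUP_least)
  qed
  also have "(\<integral>\<^sup>+x. ?low x \<partial>hvol) \<le> ennreal (16 * pi * exp (16 * pi))"
  proof -
    have "(\<integral>\<^sup>+x. ?low x \<partial>hvol) = ennreal (4 * pi * exp (16 * pi)) * (\<integral>\<^sup>+x. ennreal ((u x)\<^sup>2) \<partial>hvol)"
      by (rule nn_integral_cmult) measurable
    also have "\<dots> \<le> ennreal (4 * pi * exp (16 * pi)) * ennreal 4"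
      using square_integral by (intro mult_left_mono) auto
    also have "\<dots> = ennreal (4 * pi * exp (16 * pi) * 4)" by (rule ennreal_mult''[symmetric]) simp
    finally show ?thesis by (simp add: mult_ac)
  qed
  finally show ?thesis
    by (subst ennreal_plus)
       (auto simp: moser_bound_nonneg)
qed

end

section \<open>Smooth functions\<close>

lemma Ck_on_cong:
  assumes "open S" "\<And>x. x \<in> S \<Longrightarrow> f x = g x" "Ck_on k f S"
  shows "Ck_on k g S"
  using assms(2,3)
proof (induction k arbitrary: f g)
  case 0
  then show ?case by (auto cong: continuous_on_cong)
next
  case (Suc k)
  have d: "(g has_derivative frechet_derivative f (at x)) (at x)" if "x \<in> S" for x
  proof -
    have "(f has_derivative frechet_derivative f (at x)) (at x)"
      using Suc.prems(2) that by (simp add: frechet_derivative_works[symmetric])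
    then show ?thesis
      by (rule has_derivative_transform_within_open[OF _ \<open>open S\<close> that]) (rule Suc.prems(1))
  qed
  show ?case unfolding Ck_on.simps
  proof (intro conjI ballI allI)
    show "g differentiable (at x)" if "x \<in> S" for x
      using d[OF that] by (auto simp: differentiable_def)
    show "Ck_on k (\<lambda>x. frechet_derivative g (at x) v) S" for v
    proof (rule Suc.IH)
      show "frechet_derivative f (at x) v = frechet_derivative g (at x) v" if "x \<in> S" for x
        by (rule fun_cong[OF frechet_derivative_at[OF d[OF that]]])
      show "Ck_on k (\<lambda>x. frechet_derivative f (at x) v) S" using Suc.prems(2) by simp
    qed
  qed
qed

lemma Ck_on_SucI:
  assumes "open S" "\<And>x. x \<in> S \<Longrightarrow> (f has_derivative f' x) (at x)" "\<And>v. Ck_on k (\<lambda>x. f' x v) S"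
  shows "Ck_on (Suc k) f S"
  unfolding Ck_on.simps
proof (intro conjI ballI allI)
  show "f differentiable (at x)" if "x \<in> S" for x
    using assms(2)[OF that] by (auto simp: differentiable_def)
  show "Ck_on k (\<lambda>x. frechet_derivative f (at x) v) S" for v
    by (rule Ck_on_cong[OF assms(1) fun_cong[OF frechet_derivative_at[OF assms(2)]] assms(3)])
qed

lemma Ck_on_has_derivative:
  "Ck_on (Suc k) f S \<Longrightarrow> x \<in> S \<Longrightarrow> (f has_derivative frechet_derivative f (at x)) (at x)"
  by (simp add: frechet_derivative_works[symmetric])

lemma Ck_on_SucD: "Ck_on (Suc k) f S \<Longrightarrow> Ck_on k f S"
proof (induction k arbitrary: f)
  case 0
  then show ?case
    using differentiable_imp_continuous_within by (auto intro!: continuous_at_imp_continuous_on)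
next
  case (Suc k)
  have "f differentiable (at x)" if "x \<in> S" for x using Suc.prems that by simp
  moreover have "Ck_on k (\<lambda>x. frechet_derivative f (at x) v) S" for v
  proof (rule Suc.IH)
    show "Ck_on (Suc k) (\<lambda>x. frechet_derivative f (at x) v) S" using Suc.prems by (simp only: Ck_on.simps) blast
  qed
  ultimately show ?case by simp
qed

lemma Ck_on_const: "Ck_on k (\<lambda>x. c) S"
proof (induction k arbitrary: c)
  case (Suc k)
  have "frechet_derivative (\<lambda>x. c) (at x) = (\<lambda>v. 0)" for x
    by (rule frechet_derivative_at[symmetric]) simp
  then show ?case using Suc by simp
qed simp

lemma Ck_on_bounded_linear:
  assumes "open S" "bounded_linear f" shows "Ck_on k f S"
proof (cases k)
  case 0 then show ?thesis using assms by (simp add: linear_continuous_on)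
next
  case (Suc n)
  then show ?thesis using assms bounded_linear_imp_has_derivative
    by (auto intro!: Ck_on_SucI[where f'="\<lambda>x. f"] Ck_on_const simp del: Ck_on.simps)
qed

lemma Ck_on_add:
  assumes "open S" "Ck_on k f S" "Ck_on k g S" shows "Ck_on k (\<lambda>x. f x + g x) S"
  using assms(2,3)
proof (induction k arbitrary: f g)
  case 0 then show ?case by (auto intro: continuous_intros)
next
  case (Suc k)
  show ?case
  proof (rule Ck_on_SucI[OF assms(1)])
    show "((\<lambda>x. f x + g x) has_derivative
        (\<lambda>v. frechet_derivative f (at x) v + frechet_derivative g (at x) v)) (at x)" if "x \<in> S" for x
      by (rule has_derivative_add[OF Ck_on_has_derivative[OF Suc.prems(1) that] Ck_on_has_derivative[OF Suc.prems(2) that]])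
    show "Ck_on k (\<lambda>x. frechet_derivative f (at x) v + frechet_derivative g (at x) v) S" for v
      using Suc.prems by (intro Suc.IH) simp_all
  qed
qed

lemma Ck_on_mult:
  fixes f g :: "'a::euclidean_space \<Rightarrow> real"
  assumes "open S" "Ck_on k f S" "Ck_on k g S" shows "Ck_on k (\<lambda>x. f x * g x) S"
  using assms(2,3)
proof (induction k arbitrary: f g)
  case 0 then show ?case by (auto intro: continuous_intros)
next
  case (Suc k)
  show ?case
  proof (rule Ck_on_SucI[OF assms(1)])
    show "((\<lambda>x. f x * g x) has_derivative
        (\<lambda>v. f x * frechet_derivative g (at x) v + frechet_derivative f (at x) v * g x)) (at x)" if "x \<in> S" for x
      by (rule has_derivative_mult[OF Ck_on_has_derivative[OF Suc.prems(1) that] Ck_on_has_derivative[OF Suc.prems(2) that]])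
    have "Ck_on k (\<lambda>x. frechet_derivative f (at x) v) S" "Ck_on k (\<lambda>x. frechet_derivative g (at x) v) S" for v
      using Suc.prems by simp_all
    then show "Ck_on k (\<lambda>x. f x * frechet_derivative g (at x) v + frechet_derivative f (at x) v * g x) S" for v
      by (intro Ck_on_add[OF assms(1)] Suc.IH Ck_on_SucD[OF Suc.prems(1)] Ck_on_SucD[OF Suc.prems(2)])
  qed
qed

lemma Ck_on_compose:
  fixes h :: "real \<Rightarrow> real"
  assumes "open S" "Ck_on k h T" "Ck_on k f S" "f ` S \<subseteq> T"
  shows "Ck_on k (\<lambda>x. h (f x)) S"
  using assms(2-4)
proof (induction k arbitrary: h f)
  case 0 then show ?case by (auto intro: continuous_on_compose2)
next
  case (Suc k)
  show ?case
  proof (rule Ck_on_SucI[OF assms(1), where f'="\<lambda>x v. frechet_derivative h (at (f x)) 1 * frechet_derivative f (at x) v"])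
    fix x assume "x \<in> S"
    then have "f x \<in> T" using Suc.prems(3) by auto
    note f = Ck_on_has_derivative[OF Suc.prems(2) \<open>x \<in> S\<close>] and h = Ck_on_has_derivative[OF Suc.prems(1) this]
    have "frechet_derivative h (at (f x)) t = frechet_derivative h (at (f x)) 1 * t" for t
      using linear_cmul[OF has_derivative_linear[OF h], of t 1] by (simp add: mult.commute)
    then have eq: "(\<lambda>v. frechet_derivative h (at (f x)) (frechet_derivative f (at x) v))
        = (\<lambda>v. frechet_derivative h (at (f x)) 1 * frechet_derivative f (at x) v)"
      by (intro ext)
    show "((\<lambda>x. h (f x)) has_derivative (\<lambda>v. frechet_derivative h (at (f x)) 1 * frechet_derivative f (at x) v)) (at x)"
      unfolding eq[symmetric] by (rule has_derivative_compose[OF f h])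
  next
    fix v
    show "Ck_on k (\<lambda>x. frechet_derivative h (at (f x)) 1 * frechet_derivative f (at x) v) S"
    proof (intro Ck_on_mult[OF assms(1)] Suc.IH[where h="\<lambda>y. frechet_derivative h (at y) 1"])
      show "Ck_on k f S" by (rule Ck_on_SucD[OF Suc.prems(2)])
    qed (use Suc.prems in simp_all)
  qed
qed

lemma Ck_on_inverse: "Ck_on k inverse {0::real<..}"
proof (induction k)
  case 0 then show ?case by (auto intro!: continuous_intros)
next
  case (Suc k)
  show ?case
  proof (rule Ck_on_SucI[where f'="\<lambda>x v. (- 1) * (inverse x * inverse x) * v"])
    fix x :: real assume "x \<in> {0<..}"
    then show "(inverse has_derivative (\<lambda>v. (- 1) * (inverse x * inverse x) * v)) (at x)"
      by (auto intro!: derivative_eq_intros simp: fun_eq_iff)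
  qed (intro Ck_on_mult Ck_on_const Suc open_greaterThan)+
qed

lemma Ck_on_ln: "Ck_on k ln {0::real<..}"
proof (cases k)
  case 0 then show ?thesis by (auto intro!: continuous_intros)
next
  case (Suc n)
  have "Ck_on (Suc n) ln {0::real<..}"
  proof (rule Ck_on_SucI[where f'="\<lambda>x v. inverse x * v"])
    fix x :: real assume "x \<in> {0<..}"
    then show "(ln has_derivative (\<lambda>v. inverse x * v)) (at x)"
      by (auto intro!: derivative_eq_intros simp: fun_eq_iff field_simps)
  qed (intro Ck_on_mult Ck_on_const Ck_on_inverse open_greaterThan)+
  then show ?thesis using Suc by simp
qed

text \<open>Derivatives of \<open>exp (- 1/s)\<close> for \<open>s > 0\<close> have this form, with \<open>flat_deriv\<close> acting on the polynomial.\<close>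
definition flat :: "real poly \<Rightarrow> real \<Rightarrow> real" where
  "flat p s = (if s > 0 then poly p (1 / s) * exp (- 1 / s) else 0)"

definition flat_deriv :: "real poly \<Rightarrow> real poly" where
  "flat_deriv p = [:0, 0, 1:] * (p - pderiv p)"

lemma poly_times_exp_tendsto_0: "((\<lambda>t::real. poly p t * exp (- t)) \<longlongrightarrow> 0) at_top"
proof -
  have "((\<lambda>t::real. \<Sum>i\<le>degree p. coeff p i * (t ^ i / exp t)) \<longlongrightarrow> (\<Sum>i\<le>degree p. coeff p i * 0)) at_top"
    by (intro tendsto_intros tendsto_power_div_exp_0)
  then show ?thesis by (simp add: poly_altdef sum_distrib_right exp_minus divide_inverse mult.assoc)
qed

lemma has_real_derivative_flat: "(flat p has_real_derivative flat (flat_deriv p) s) (at s)"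
proof (cases s "0::real" rule: linorder_cases)
  case less
  have "((\<lambda>s. 0) has_real_derivative 0) (at s)" by simp
  then have "(flat p has_real_derivative 0) (at s)"
    by (rule has_field_derivative_transform_within_open[of _ _ _ "{..<0}"]) (use less in \<open>auto simp: flat_def\<close>)
  then show ?thesis using less by (simp add: flat_def)
next
  case greater
  have "((\<lambda>s. poly p (1 / s) * exp (- 1 / s)) has_real_derivative flat (flat_deriv p) s) (at s)"
    using greater
    by (auto intro!: derivative_eq_intros DERIV_chain2[OF poly_DERIV] simp: flat_def flat_deriv_def field_simps power2_eq_square)
  then show ?thesis
    by (rule has_field_derivative_transform_within_open[of _ _ _ "{0<..}"]) (use greater in \<open>auto simp: flat_def\<close>)
next
  case equal
  have "((\<lambda>t. poly (pCons 0 p) t * exp (- t)) \<longlongrightarrow> 0) at_top" by (rule poly_times_exp_tendsto_0)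
  then have "((\<lambda>s. poly (pCons 0 p) (inverse s) * exp (- inverse s)) \<longlongrightarrow> 0) (at_right 0)"
    by (rule filterlim_compose[OF _ filterlim_inverse_at_top_right])
  then have r: "((\<lambda>s. (flat p s - flat p 0) / (s - 0)) \<longlongrightarrow> 0) (at_right 0)"
    by (rule tendsto_cong[THEN iffD1, rotated])
       (auto simp: flat_def eventually_at_filter divide_inverse)
  have l: "((\<lambda>s. (flat p s - flat p 0) / (s - 0)) \<longlongrightarrow> 0) (at_left 0)"
    by (rule tendsto_eventually) (auto simp: flat_def eventually_at_filter)
  have "((\<lambda>s. (flat p s - flat p 0) / (s - 0)) \<longlongrightarrow> 0) (at 0)"
    using r l by (rule filterlim_split_at[rotated])
  then show ?thesis using equal by (simp add: has_field_derivative_iff flat_def)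
qed

lemma Ck_on_flat: "Ck_on k (flat p) UNIV"
proof (induction k arbitrary: p)
  case 0
  have "continuous_on UNIV (flat p)"
    by (rule continuous_at_imp_continuous_on) (meson DERIV_isCont has_real_derivative_flat)
  then show ?case by simp
next
  case (Suc k)
  show ?case
  proof (rule Ck_on_SucI[OF open_UNIV])
    show "(flat p has_derivative (\<lambda>v. flat (flat_deriv p) x * v)) (at x)" for x
      using has_real_derivative_flat[of p x] unfolding has_field_derivative_def .
    show "Ck_on k (\<lambda>x. flat (flat_deriv p) x * v) UNIV" for v
      by (rule Ck_on_mult[OF open_UNIV Suc Ck_on_const])
  qed
qed

section \<open>Smooth versions of Moser's function\<close>

text \<open>A smooth substitute for the positive part: \<open>s exp (- 1/s)\<close> for \<open>s > 0\<close>. Its slope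
  \<open>exp (- 1/s) (1 + 1/s)\<close> does not exceed \<open>1\<close>, so composing with it does not increase the energy, and for
  \<open>s > 0\<close> it stays within \<open>1\<close> of \<open>s\<close>.\<close>
definition ramp :: "real \<Rightarrow> real" where "ramp s = s * flat 1 s"

definition ramp_deriv :: "real \<Rightarrow> real" where
  "ramp_deriv s = (if s > 0 then exp (- 1 / s) * (1 + 1 / s) else 0)"

lemma Ck_on_ramp: "Ck_on k ramp UNIV"
  unfolding ramp_def[abs_def]
  by (rule Ck_on_mult[OF open_UNIV Ck_on_bounded_linear[OF open_UNIV bounded_linear_ident] Ck_on_flat])

lemma has_real_derivative_ramp: "(ramp has_real_derivative ramp_deriv s) (at s)"
proof -
  have "(ramp has_real_derivative (s * flat (flat_deriv 1) s + 1 * flat 1 s)) (at s)"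
    unfolding ramp_def[abs_def]
    using DERIV_mult[OF DERIV_ident has_real_derivative_flat[of 1 s]] by (simp add: algebra_simps)
  moreover have "s * flat (flat_deriv 1) s + 1 * flat 1 s = ramp_deriv s"
    by (simp add: flat_def flat_deriv_def ramp_deriv_def field_simps pderiv_1)
  ultimately show ?thesis by simp
qed

lemma ramp_deriv_bounds: "0 \<le> ramp_deriv s" "ramp_deriv s \<le> 1"
proof -
  show "0 \<le> ramp_deriv s" by (simp add: ramp_deriv_def)
  show "ramp_deriv s \<le> 1"
  proof (cases "s > 0")
    case True
    have "exp (- 1 / s) * (1 + 1 / s) \<le> exp (- 1 / s) * exp (1 / s)"
      by (intro mult_left_mono exp_ge_add_one_self) simp
    then show ?thesis using True by (simp add: ramp_deriv_def exp_add[symmetric])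
  qed (simp add: ramp_deriv_def)
qed

lemma ramp_eq_0: "s \<le> 0 \<Longrightarrow> ramp s = 0" "s \<le> 0 \<Longrightarrow> ramp_deriv s = 0"
  by (auto simp: ramp_def flat_def ramp_deriv_def)

lemma ramp_lower: "s > 0 \<Longrightarrow> s - 1 \<le> ramp s"
proof -
  assume s: "s > 0"
  have "1 + - 1 / s \<le> exp (- 1 / s)" by (rule exp_ge_add_one_self)
  then have "s * (1 + - 1 / s) \<le> s * exp (- 1 / s)" using s by (intro mult_left_mono) auto
  then show ?thesis using s by (simp add: ramp_def flat_def algebra_simps)
qed

lemma GDERIV_norm_le:
  assumes "GDERIV u x :> g" "\<And>h. \<bar>h \<bullet> g\<bar> \<le> M * norm h" "0 \<le> M"
  shows "norm g \<le> M"
proof (cases "g = 0")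
  case False
  have "norm g * norm g \<le> M * norm g"
    using assms(2)[of g] by (simp add: dot_square_norm power2_eq_square)
  then show ?thesis using False by simp
qed (simp add: assms)

lemma has_derivative_psd:
  assumes "a \<in> unit_disc" "x \<in> unit_disc"
  shows "(psd a has_derivative (\<lambda>h. 2 * (disc_moebius a x \<bullet> moebius_deriv a x h))) (at x)"
proof -
  have "((\<lambda>x. disc_moebius a x \<bullet> disc_moebius a x) has_derivative (\<lambda>h. disc_moebius a x \<bullet> moebius_deriv a x h + moebius_deriv a x h \<bullet> disc_moebius a x)) (at x)"
    by (intro has_derivative_inner has_derivative_moebius assms)
  moreover have "(\<lambda>x. disc_moebius a x \<bullet> disc_moebius a x) = psd a"
    by (simp add: fun_eq_iff norm_moebius_sq[symmetric] dot_square_norm)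
  ultimately show ?thesis by (simp add: inner_commute)
qed

text \<open>Moser's function is a truncated logarithm. Replacing \<open>ln (1/t)\<close> by \<open>ln (1 / (2 (t + e)))\<close> removes the
  singularity at \<open>t = 0\<close> without a case distinction, and the factor \<open>2\<close> makes the ramp vanish for
  \<open>t \<ge> 1/2\<close>. The constant in front normalises the energy.\<close>
definition moser_function :: "real^2 \<Rightarrow> real \<Rightarrow> real^2 \<Rightarrow> real" where
  "moser_function a e x = (if x \<in> unit_disc
     then sqrt (1 / (4 * pi * ln (1 / (2 * e)))) * ramp (ln (1 / (2 * (psd a x + e)))) else 0)"

lemma moser_function_smooth:
  assumes a: "a \<in> unit_disc" and e: "0 < e"
  shows "smooth_on (moser_function a e) unit_disc"
proof -
  have op: "open unit_disc" by (simp add: unit_disc_def)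
  define W where "W = (\<lambda>x::real^2. (1 - (norm a)\<^sup>2) * (1 - x \<bullet> x))"
  define N where "N = (\<lambda>x::real^2. x \<bullet> x + ((-2) * (a \<bullet> x) + a \<bullet> a))"
  have N_eq: "N x = (norm (a - x))\<^sup>2" for x
    by (simp add: N_def power2_norm_eq_inner inner_diff_left inner_diff_right inner_commute)
  have W_pos: "0 < W x" if "x \<in> unit_disc" for x
    using a that by (simp add: W_def mem_unit_disc2 power2_norm_eq_inner[symmetric])
  have N_nonneg: "0 \<le> N x" for x by (simp add: N_eq)
  have psd_eq: "psd a x = N x / (N x + W x)" for x
    by (simp add: psd_def N_eq W_def power2_norm_eq_inner[symmetric])
  define D1 where "D1 = (\<lambda>x. N x + W x)"
  define D2 where "D2 = (\<lambda>x. 2 * (N x + e * D1 x))"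
  have D1_pos: "0 < D1 x" if "x \<in> unit_disc" for x
    using W_pos[OF that] N_nonneg[of x] by (simp add: D1_def)
  have D2_pos: "0 < D2 x" if "x \<in> unit_disc" for x
    using D1_pos[OF that] N_nonneg[of x] e by (simp add: D2_def add_nonneg_pos)
  have ln_eq: "ln (1 / (2 * (psd a x + e))) = ln (D1 x) + (-1) * ln (D2 x)" if "x \<in> unit_disc" for x
  proof -
    have "1 / (2 * (psd a x + e)) = D1 x / D2 x"
    proof -
      have "psd a x = N x / D1 x" by (simp add: psd_eq D1_def)
      then have "psd a x + e = (N x + e * D1 x) / D1 x"
        using D1_pos[OF that] by (simp add: add_divide_distrib)
      then show ?thesis using D1_pos[OF that] by (simp add: D2_def)
    qed
    then show ?thesis using D1_pos[OF that] D2_pos[OF that] by (simp add: ln_div)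
  qed
  have "Ck_on k (moser_function a e) unit_disc" for k
  proof -
    have sq: "Ck_on k (\<lambda>x::real^2. x \<bullet> x) unit_disc"
    proof (cases k)
      case 0 then show ?thesis by (auto intro!: continuous_intros)
    next
      case (Suc n)
      have "Ck_on (Suc n) (\<lambda>x::real^2. x \<bullet> x) unit_disc"
      proof (rule Ck_on_SucI[OF op])
        show "((\<lambda>x. x \<bullet> x) has_derivative (\<lambda>v. x \<bullet> v + v \<bullet> x)) (at x)" for x :: "real^2"
          by (intro has_derivative_inner has_derivative_ident)
        show "Ck_on n (\<lambda>x::real^2. x \<bullet> v + v \<bullet> x) unit_disc" for v
          by (intro Ck_on_add op Ck_on_bounded_linear bounded_linear_inner_left bounded_linear_inner_right)
      qed
      then show ?thesis using Suc by simp
    qed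
    have W: "Ck_on k W unit_disc"
    proof -
      have "Ck_on k (\<lambda>x::real^2. (1 - (norm a)\<^sup>2) * (1 + (-1) * (x \<bullet> x))) unit_disc"
        by (intro Ck_on_mult Ck_on_add Ck_on_const sq op)
      then show ?thesis by (simp add: W_def[abs_def])
    qed
    have N: "Ck_on k N unit_disc"
      unfolding N_def
      by (intro Ck_on_mult Ck_on_add Ck_on_const sq op Ck_on_bounded_linear bounded_linear_inner_right)
    have D1: "Ck_on k D1 unit_disc" unfolding D1_def by (intro Ck_on_add op N W)
    have D2: "Ck_on k D2 unit_disc" unfolding D2_def by (intro Ck_on_add Ck_on_mult Ck_on_const op N D1)
    have "Ck_on k (\<lambda>x. ln (D1 x) + (-1) * ln (D2 x)) unit_disc"
      by (intro Ck_on_add Ck_on_mult Ck_on_const op Ck_on_compose[OF op Ck_on_ln D1] Ck_on_compose[OF op Ck_on_ln D2])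
         (use D1_pos D2_pos in auto)
    from Ck_on_compose[OF op Ck_on_ramp this]
    have "Ck_on k (\<lambda>x. sqrt (1 / (4 * pi * ln (1 / (2 * e)))) * ramp (ln (D1 x) + (-1) * ln (D2 x))) unit_disc"
      by (intro Ck_on_mult Ck_on_const op) auto
    then show ?thesis
    proof (rule Ck_on_cong[OF op, rotated])
      fix x assume x: "x \<in> unit_disc"
      show "sqrt (1 / (4 * pi * ln (1 / (2 * e)))) * ramp (ln (D1 x) + (-1) * ln (D2 x)) = moser_function a e x"
        unfolding ln_eq[OF x, symmetric] moser_function_def by (rule if_P[OF x, symmetric])
    qed
  qed
  then show ?thesis by (simp add: smooth_on_def)
qed

lemma moser_function_nonzero:
  assumes a: "a \<in> unit_disc" and e: "0 < e" and nz: "moser_function a e x \<noteq> 0"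
  shows "x \<in> unit_disc" "psd a x < 1 / 2"
proof -
  show x: "x \<in> unit_disc" using nz by (auto simp: moser_function_def split: if_splits)
  show "psd a x < 1 / 2"
  proof (rule ccontr)
    assume "\<not> psd a x < 1 / 2"
    then have "1 \<le> 2 * (psd a x + e)" using e by simp
    then have "ln (1 / (2 * (psd a x + e))) \<le> 0" by (simp add: ln_div)
    then have "ramp (ln (1 / (2 * (psd a x + e)))) = 0" by (rule ramp_eq_0)
    then have "moser_function a e x = 0" unfolding moser_function_def by simp
    then show False using nz by simp
  qed
qed

lemma moser_function_test:
  assumes a: "a \<in> unit_disc" and e: "0 < e"
  shows "moser_function a e \<in> test_functions unit_disc"
proof -
  let ?u = "moser_function a e"
  define K where "K = disc_moebius a ` cball 0 (sqrt (1 / 2))"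
  have sub: "cball 0 (sqrt (1 / 2)) \<subseteq> unit_disc"
  proof
    fix x :: "real^2" assume "x \<in> cball 0 (sqrt (1 / 2))"
    then have "norm x \<le> sqrt (1 / 2)" by simp
    also have "\<dots> < 1" by simp
    finally show "x \<in> unit_disc" by (simp add: mem_unit_disc)
  qed
  have "continuous_on (cball 0 (sqrt (1 / 2))) (disc_moebius a)"
    using has_derivative_moebius[OF a] sub by (meson continuous_on_eq_continuous_within has_derivative_continuous subsetD)
  then have K: "compact K" unfolding K_def by (rule compact_continuous_image) simp
  have KD: "K \<subseteq> unit_disc" unfolding K_def using sub moebius_in_disc[OF a] by auto
  have "support_on UNIV ?u \<subseteq> K"
  proof
    fix x assume "x \<in> support_on UNIV ?u"
    then have x: "x \<in> unit_disc" "psd a x < 1 / 2"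
      using moser_function_nonzero[OF a e] by (auto simp: support_on_def)
    have "(norm (disc_moebius a x))\<^sup>2 \<le> 1 / 2" using x(2) by (simp add: norm_moebius_sq)
    then have "norm (disc_moebius a x) \<le> sqrt (1 / 2)" by (rule real_le_rsqrt)
    then have "disc_moebius a x \<in> cball 0 (sqrt (1 / 2))" by simp
    then have "disc_moebius a (disc_moebius a x) \<in> K" unfolding K_def by (rule imageI)
    then show "x \<in> K" using moebius_moebius[OF a x(1)] by simp
  qed
  then have cl: "closure (support_on UNIV ?u) \<subseteq> K"
    using K by (intro closure_minimal compact_imp_closed)
  then have "compact (closure (support_on UNIV ?u))"
    using K by (meson closed_closure closed_subset compact_Int_closed compact_closure compact_imp_bounded bounded_subset closure_subset order_trans)
  then show ?thesis using cl KD moser_function_smooth[OF a e] by (auto simp: test_functions_def)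
qed

lemma moser_function_hgrad:
  assumes a: "a \<in> unit_disc" and e: "0 < e" "e < 1 / 2" and x: "x \<in> unit_disc"
  shows "(hgrad (moser_function a e) x)\<^sup>2 \<le>
    1 / (4 * pi * ln (1 / (2 * e))) * ((1 - psd a x)\<^sup>2 / (psd a x + e) * indicator {..1 / 2 - e} (psd a x))"
proof -
  let ?u = "moser_function a e"
  define c where "c = sqrt (1 / (4 * pi * ln (1 / (2 * e))))"
  have lnpos: "0 < ln (1 / (2 * e))" using e by simp
  have c: "0 \<le> c" "c\<^sup>2 = 1 / (4 * pi * ln (1 / (2 * e)))" using lnpos by (auto simp: c_def)
  define t where "t = psd a x"
  have t: "0 \<le> t" "t < 1" using psd_nonneg[OF a x] psd_less_1[OF a x] by (auto simp: t_def)
  define l where "l = ln (1 / (2 * (t + e)))"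
  have der: "(?u has_derivative (\<lambda>h. c * (ramp_deriv l * (- (1 / (t + e)) * (2 * (disc_moebius a x \<bullet> moebius_deriv a x h)))))) (at x)"
  proof -
    have "((\<lambda>s. ln (1 / (2 * (s + e)))) has_real_derivative (- (1 / (t + e)))) (at t)"
    proof -
      have "0 < e * (e * 4) + (t * (t * 4) + e * (t * 8))"
        using t e by (intro add_pos_nonneg add_nonneg_nonneg mult_nonneg_nonneg mult_pos_pos) auto
      then show ?thesis using t e by (auto intro!: derivative_eq_intros simp: field_simps)
    qed
    then have 1: "((\<lambda>s. ln (1 / (2 * (s + e)))) has_derivative (\<lambda>h. - (1 / (t + e)) * h)) (at (psd a x))"
      unfolding has_field_derivative_def t_def .
    have 2: "(ramp has_derivative (\<lambda>h. ramp_deriv l * h)) (at (ln (1 / (2 * (psd a x + e)))))"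
      using has_real_derivative_ramp[of l] by (simp add: has_field_derivative_def l_def t_def)
    have "((\<lambda>x. c * ramp (ln (1 / (2 * (psd a x + e))))) has_derivative
       (\<lambda>h. c * (ramp_deriv l * (- (1 / (t + e)) * (2 * (disc_moebius a x \<bullet> moebius_deriv a x h)))))) (at x)"
      by (intro has_derivative_mult_right
           has_derivative_compose[OF has_derivative_compose[OF has_derivative_psd[OF a x] 1] 2])
    then show ?thesis
      by (rule has_derivative_transform_within_open[of _ _ _ _ unit_disc])
         (use x in \<open>auto simp: moser_function_def c_def unit_disc_def\<close>)
  qed
  have G: "GDERIV ?u x :> grad ?u x"
    by (rule GDERIV_grad) (use der in \<open>auto simp: differentiable_def\<close>)
  have eq: "h \<bullet> grad ?u x = c * (ramp_deriv l * (- (1 / (t + e)) * (2 * (disc_moebius a x \<bullet> moebius_deriv a x h))))" for h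
    by (rule fun_cong[OF has_derivative_unique[OF G[unfolded gderiv_def] der]])
  have nx: "0 < 1 - (norm x)\<^sup>2" using x by (simp add: mem_unit_disc2)
  have nm: "norm (disc_moebius a x) = sqrt t"
    using norm_moebius_sq[of a x] unfolding t_def by (metis norm_ge_zero real_sqrt_unique)
  define M where "M = c * (ramp_deriv l * (1 / (t + e) * (2 * (sqrt t * ((1 - t) / (1 - (norm x)\<^sup>2))))))"
  have M0: "0 \<le> M" unfolding M_def using c ramp_deriv_bounds t e nx by simp
  have "norm (grad ?u x) \<le> M"
  proof (rule GDERIV_norm_le[OF G _ M0])
    fix h
    have "\<bar>disc_moebius a x \<bullet> moebius_deriv a x h\<bar> \<le> norm (disc_moebius a x) * norm (moebius_deriv a x h)"
      by (rule Cauchy_Schwarz_ineq2)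
    also have "\<dots> = sqrt t * ((1 - t) / (1 - (norm x)\<^sup>2)) * norm h"
      unfolding norm_moebius_deriv[OF a x] nm using t by simp
    finally have "c * (ramp_deriv l * (1 / (t + e) * (2 * \<bar>disc_moebius a x \<bullet> moebius_deriv a x h\<bar>)))
       \<le> c * (ramp_deriv l * (1 / (t + e) * (2 * (sqrt t * ((1 - t) / (1 - (norm x)\<^sup>2)) * norm h))))"
      using c ramp_deriv_bounds t e by (intro mult_left_mono) auto
    then show "\<bar>h \<bullet> grad ?u x\<bar> \<le> M * norm h"
      unfolding eq M_def using c ramp_deriv_bounds(1)[of l] t e by (simp add: abs_mult mult_ac)
  qed
  then have "hgrad ?u x \<le> M * (1 - (norm x)\<^sup>2) / 2"
    using x nx by (simp add: hgrad_def)
  also have "\<dots> = c * (ramp_deriv l * (sqrt t * (1 - t) / (t + e)))"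
  proof -
    have "A * (B * (1 / C * (2 * (T * ((1 - t) / q))))) * q / 2 = A * (B * (T * (1 - t) / C))"
      if "q \<noteq> 0" "C \<noteq> 0" for A B C T q :: real
      using that by (simp add: field_simps)
    from this[of "1 - (norm x)\<^sup>2" "t + e" c "ramp_deriv l" "sqrt t"] show ?thesis
      unfolding M_def using nx t e by simp
  qed
  finally have h: "hgrad ?u x \<le> c * (ramp_deriv l * (sqrt t * (1 - t) / (t + e)))" .
  have h0: "0 \<le> hgrad ?u x" using x nx by (simp add: hgrad_def)
  have "(hgrad ?u x)\<^sup>2 \<le> (c * (ramp_deriv l * (sqrt t * (1 - t) / (t + e))))\<^sup>2"
    using h h0 by (rule power_mono)
  also have "\<dots> = c\<^sup>2 * ((ramp_deriv l)\<^sup>2 * (t * (1 - t)\<^sup>2 / (t + e)\<^sup>2))"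
    using t by (simp add: power_mult_distrib power_divide)
  also have "\<dots> \<le> c\<^sup>2 * ((1 - t)\<^sup>2 / (t + e) * indicator {..1 / 2 - e} t)"
  proof (rule mult_left_mono)
    show "(ramp_deriv l)\<^sup>2 * (t * (1 - t)\<^sup>2 / (t + e)\<^sup>2) \<le> (1 - t)\<^sup>2 / (t + e) * indicator {..1 / 2 - e} t"
    proof (cases "t \<le> 1 / 2 - e")
      case True
      have "(ramp_deriv l)\<^sup>2 \<le> 1\<^sup>2" using ramp_deriv_bounds by (intro power_mono)
      then have "(ramp_deriv l)\<^sup>2 * (t * (1 - t)\<^sup>2 / (t + e)\<^sup>2) \<le> 1 * (t * (1 - t)\<^sup>2 / (t + e)\<^sup>2)"
        using t by (intro mult_right_mono) auto
      also have "\<dots> = t / (t + e) * ((1 - t)\<^sup>2 / (t + e))" by (simp add: power2_eq_square)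
      also have "\<dots> \<le> 1 * ((1 - t)\<^sup>2 / (t + e))" using t e by (intro mult_right_mono) auto
      finally show ?thesis using True by simp
    next
      case False
      then have "l \<le> 0" using t e unfolding l_def by (simp add: ln_div)
      then show ?thesis using False by (simp add: ramp_eq_0)
    qed
  qed simp
  finally show ?thesis unfolding c(2) t_def .
qed

lemma moser_function_energy:
  assumes a: "a \<in> unit_disc" and e: "0 < e" "e < 1 / 2"
  shows "(\<integral>\<^sup>+x\<in>unit_disc. ennreal ((norm (grad (moser_function a e) x))\<^sup>2) \<partial>lborel) \<le> 1"
proof -
  let ?u = "moser_function a e" and ?L = "ln (1 / (2 * e))"
  have Lpos: "0 < ?L" using e by simp
  obtain R where "disc_function ?u R" using test_function_disc_function[OF moser_function_test[OF a e(1)]] .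
  then have m: "hgrad ?u \<in> borel_measurable borel" by (rule disc_function.measurable_hgrad)
  let ?g = "\<lambda>t. ennreal ((1 - t)\<^sup>2 / (t + e) * indicator {..1 / 2 - e} t)"
  have "(\<integral>\<^sup>+x\<in>unit_disc. ennreal ((norm (grad ?u x))\<^sup>2) \<partial>lborel) = (\<integral>\<^sup>+x. ennreal ((hgrad ?u x)\<^sup>2) \<partial>hvol)"
    by (rule nn_integral_hgrad_square[OF m, symmetric])
  also have "\<dots> \<le> (\<integral>\<^sup>+x. ennreal (1 / (4 * pi * ?L)) * ?g (psd a x) \<partial>hvol)"
  proof (rule nn_integral_hvol_mono)
    fix x assume "x \<in> unit_disc"
    from moser_function_hgrad[OF a e this]
    have "ennreal ((hgrad ?u x)\<^sup>2) \<le> ennreal (1 / (4 * pi * ?L) * ((1 - psd a x)\<^sup>2 / (psd a x + e) * indicator {..1 / 2 - e} (psd a x)))"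
      by (rule ennreal_leI)
    also have "\<dots> = ennreal (1 / (4 * pi * ?L)) * ?g (psd a x)" using Lpos by (intro ennreal_mult') simp
    finally show "ennreal ((hgrad ?u x)\<^sup>2) \<le> ennreal (1 / (4 * pi * ?L)) * ?g (psd a x)" .
  qed
  also have "\<dots> = ennreal (1 / (4 * pi * ?L)) * (\<integral>\<^sup>+x. ?g (psd a x) \<partial>hvol)"
    by (rule nn_integral_cmult) measurable
  also have "(\<integral>\<^sup>+x. ?g (psd a x) \<partial>hvol) = (\<integral>\<^sup>+t. ?g t * ennreal (4 * pi / (1 - t)\<^sup>2) * indicator {0..<1} t \<partial>lborel)"
    by (rule nn_integral_hvol_psd[OF a]) measurable
  also have "\<dots> = (\<integral>\<^sup>+t. ennreal (4 * pi) * (ennreal (1 / (t + e)) * indicator {0..1 / 2 - e} t) \<partial>lborel)"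
  proof (rule nn_integral_cong)
    fix t :: real
    show "?g t * ennreal (4 * pi / (1 - t)\<^sup>2) * indicator {0..<1} t = ennreal (4 * pi) * (ennreal (1 / (t + e)) * indicator {0..1 / 2 - e} t)"
    proof (cases "0 \<le> t \<and> t \<le> 1 / 2 - e")
      case True
      then have t: "0 \<le> t" "t < 1" using e by auto
      have "(1 - t)\<^sup>2 / (t + e) * (4 * pi / (1 - t)\<^sup>2) = 4 * pi * (1 / (t + e))"
      proof -
        have "X / (t + e) * (4 * pi / X) = 4 * pi * (1 / (t + e))" if "X \<noteq> 0" for X :: real
          using that by simp
        then show ?thesis using t by simp
      qed
      moreover have "ennreal ((1 - t)\<^sup>2 / (t + e)) * ennreal (4 * pi / (1 - t)\<^sup>2) = ennreal ((1 - t)\<^sup>2 / (t + e) * (4 * pi / (1 - t)\<^sup>2))"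
        by (rule ennreal_mult''[symmetric]) simp
      moreover have "ennreal (4 * pi) * ennreal (1 / (t + e)) = ennreal (4 * pi * (1 / (t + e)))"
        by (rule ennreal_mult'[symmetric]) simp
      ultimately show ?thesis using True t by simp
    qed (use e in \<open>auto split: split_indicator\<close>)
  qed
  also have "\<dots> = ennreal (4 * pi) * (\<integral>\<^sup>+t. ennreal (1 / (t + e)) * indicator {0..1 / 2 - e} t \<partial>lborel)"
    by (rule nn_integral_cmult) measurable
  also have "(\<integral>\<^sup>+t. ennreal (1 / (t + e)) * indicator {0..1 / 2 - e} t \<partial>lborel) = ennreal (ln (1 / 2 - e + e) - ln (0 + e))"
    using e by (intro nn_integral_FTC_Icc) (auto intro!: derivative_eq_intros)
  also have "ln (1 / 2 - e + e) - ln (0 + e) = ?L" using e by (simp add: ln_div ln_mult)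
  also have "ennreal (1 / (4 * pi * ?L)) * (ennreal (4 * pi) * ennreal ?L) = ennreal (1 / (4 * pi * ?L) * (4 * pi * ?L))"
    using Lpos by (simp add: ennreal_mult'[symmetric])
  also have "1 / (4 * pi * ?L) * (4 * pi * ?L) = 1" using Lpos by simp
  finally show ?thesis by simp
qed

text \<open>With \<open>L = ln (1 / (2 e))\<close> the ramp has at least the height \<open>L - 2\<close>, and
  \<open>(L - 2)\<^sup>2 / L \<ge> L - 4\<close>: the loss against the ideal exponent \<open>L\<close> stays bounded as \<open>e\<close> tends to \<open>0\<close>.\<close>
lemma moser_function_lower:
  assumes x: "x \<in> unit_disc" and e: "0 < e" "e \<le> exp (- 4) / 4" and psd: "psd a x \<le> e"
    and a: "a \<in> unit_disc"
  shows "exp (- 4) / (4 * e) \<le> exp (4 * pi * (moser_function a e x)\<^sup>2) - 1"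
proof -
  define L where "L = ln (1 / (2 * e))"
  have e4: "e \<le> exp (- 4) / 4" by fact
  have "exp 4 \<le> 1 / (2 * e)" using e by (simp add: exp_minus field_simps)
  then have L: "4 \<le> L" unfolding L_def using e by (subst ln_ge_iff) auto
  have ln2: "ln (2::real) \<le> 1" using ln_le_minus_one[of "2::real"] by simp
  let ?l = "ln (1 / (2 * (psd a x + e)))"
  have "1 / (4 * e) \<le> 1 / (2 * (psd a x + e))"
    using psd e psd_nonneg[OF a x] by (intro divide_left_mono) auto
  then have "ln (1 / (4 * e)) \<le> ?l"
    using e psd_nonneg[OF a x] by (subst ln_le_cancel_iff) auto
  moreover have "ln (1 / (4 * e)) = L - ln 2"
  proof -
    have "1 / (4 * e) = (1 / (2 * e)) / 2" by simp
    then show ?thesis unfolding L_def using e by (simp only: ln_div) (simp add: ln_div)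
  qed
  ultimately have l: "L - 1 \<le> ?l" using ln2 by simp
  then have r: "L - 2 \<le> ramp ?l" using ramp_lower[of ?l] L by simp
  have "4 * pi * (moser_function a e x)\<^sup>2 = (ramp ?l)\<^sup>2 / L"
    using x L by (simp add: moser_function_def power_mult_distrib L_def[symmetric])
  moreover have "(L - 2)\<^sup>2 \<le> (ramp ?l)\<^sup>2" using r L by (intro power_mono) auto
  moreover have "L - 4 \<le> (L - 2)\<^sup>2 / L"
    using L by (simp add: pos_le_divide_eq) (simp add: power2_eq_square algebra_simps)
  ultimately have "L - 4 \<le> 4 * pi * (moser_function a e x)\<^sup>2"
    using L divide_right_mono[of "(L - 2)\<^sup>2" "(ramp ?l)\<^sup>2" L] by simp
  then have "exp (L - 4) \<le> exp (4 * pi * (moser_function a e x)\<^sup>2)" by simp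
  moreover have "exp (L - 4) = exp (- 4) / (2 * e)"
    using e by (simp add: L_def exp_diff exp_minus field_simps)
  moreover have "exp (- 4) / (2 * e) - exp (- 4) / (4 * e) = exp (- 4) / (4 * e)" using e by (simp add: field_simps)
  moreover have "1 \<le> exp (- 4) / (4 * e)" using e by (simp add: field_simps)
  ultimately show ?thesis by linarith
qed

lemma nn_integral_conformal_volume:
  assumes \<rho>: "continuous_on unit_disc \<rho>" and [measurable]: "F \<in> borel_measurable borel"
  shows "(\<integral>\<^sup>+x. F x \<partial>conformal_volume unit_disc \<rho>) = (\<integral>\<^sup>+x. indicator unit_disc x * (ennreal (\<rho> x) * F x) \<partial>lborel)"
proof -
  have r: "\<rho> \<in> borel_measurable (restrict_space lborel unit_disc)"
    using borel_measurable_continuous_on_restrict[OF \<rho>]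
    by (simp cong: measurable_cong_sets sets_restrict_space_cong)
  have "(\<integral>\<^sup>+x. F x \<partial>conformal_volume unit_disc \<rho>) = (\<integral>\<^sup>+x. ennreal (\<rho> x) * F x \<partial>restrict_space lborel unit_disc)"
    unfolding conformal_volume_def using r
    by (intro nn_integral_density) (auto intro!: measurable_restrict_space1)
  also have "\<dots> = (\<integral>\<^sup>+x. (ennreal (\<rho> x) * F x) * indicator unit_disc x \<partial>lborel)"
    by (rule nn_integral_restrict_space) simp
  finally show ?thesis by (simp add: mult.commute)
qed

text \<open>A single function per point is enough, but its parameter has to be small in terms of the modulus of
  continuity of \<open>\<rho>\<close> at \<open>a\<close>. The powers of that parameter cancel, which is why the resulting constant does not depend
  on \<open>a\<close>.\<close>
lemma sup_finite_imp_bound: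
  fixes \<rho> :: "real^2 \<Rightarrow> real"
  assumes cont: "continuous_on unit_disc \<rho>" and pos: "\<And>x. x \<in> unit_disc \<Longrightarrow> \<rho> x > 0"
    and S: "0 \<le> S" "\<And>u. u \<in> test_functions unit_disc \<Longrightarrow>
        (\<integral>\<^sup>+x\<in>unit_disc. ennreal ((norm (grad u x))\<^sup>2) \<partial>lborel) \<le> 1 \<Longrightarrow>
        (\<integral>\<^sup>+x. ennreal (exp (4 * pi * (u x)\<^sup>2) - 1) \<partial>conformal_volume unit_disc \<rho>) \<le> ennreal S"
    and a: "a \<in> unit_disc"
  shows "\<rho> a \<le> 4 * exp 4 * S / pi * hyperbolic_factor a"
proof -
  define w where "w = 1 - (norm a)\<^sup>2"
  have w: "0 < w" using a by (simp add: w_def mem_unit_disc2)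
  have op: "open unit_disc" by (simp add: unit_disc_def)
  have "isCont \<rho> a" using cont op a by (simp add: continuous_on_eq_continuous_at)
  then have "((\<lambda>x. \<rho> x) \<longlongrightarrow> \<rho> a) (nhds a)" by (simp add: isCont_def tendsto_nhds_iff)
  then have ev1: "eventually (\<lambda>x. \<rho> a / 2 < \<rho> x) (nhds a)"
    by (rule order_tendstoD) (use pos[OF a] in simp)
  have "((\<lambda>x. 1 - (norm x)\<^sup>2) \<longlongrightarrow> 1 - (norm a)\<^sup>2) (nhds a)"
    by (intro tendsto_intros filterlim_ident)
  then have ev2: "eventually (\<lambda>x. w / 2 < 1 - (norm x)\<^sup>2) (nhds a)"
    unfolding w_def by (rule order_tendstoD) (use w in \<open>simp add: w_def\<close>)
  have ev3: "eventually (\<lambda>x. x \<in> unit_disc) (nhds a)" using op a by (rule eventually_nhds_in_open)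
  obtain d where d: "0 < d" "\<And>x. dist x a < d \<Longrightarrow> \<rho> a / 2 < \<rho> x \<and> w / 2 < 1 - (norm x)\<^sup>2 \<and> x \<in> unit_disc"
    using eventually_conj[OF ev1 eventually_conj[OF ev2 ev3]] unfolding eventually_nhds_metric by auto
  \<comment> \<open>The second bound makes \<open>e\<close> small enough for \<open>moser_function_lower\<close>.\<close>
  define r where "r = min d (w * exp (- 4) / 4)"
  have r: "0 < r" "r \<le> d" "r \<le> w * exp (- 4) / 4" using d w by (auto simp: r_def)
  \<comment> \<open>With this choice the ball of radius \<open>r\<close> around \<open>a\<close> lies in \<open>{x. psd a x \<le> e}\<close>.\<close>
  define e where "e = 2 * r\<^sup>2 / w\<^sup>2"
  have e0: "0 < e" using r w by (simp add: e_def)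
  have e4: "e \<le> exp (- 4) / 4"
  proof -
    have "r / w \<le> exp (- 4) / 4" using r w by (simp add: field_simps)
    then have "(r / w)\<^sup>2 \<le> (exp (- 4) / 4)\<^sup>2" using r w by (intro power_mono) auto
    moreover have "e = 2 * (r / w)\<^sup>2" by (simp add: e_def power_divide)
    ultimately have "e \<le> 2 * (exp (- 4) / 4)\<^sup>2" by linarith
    also have "\<dots> = exp (- 4) / 4 * (exp (- 4) / 2)" by (simp add: power2_eq_square)
    also have "\<dots> \<le> exp (- 4) / 4 * 1" by (intro mult_left_mono) (auto intro: order_trans[of _ 1])
    finally show ?thesis by simp
  qed
  have "exp (- 4) \<le> (1::real)" by simp
  then have e2: "e < 1 / 2" using e4 by linarith
  let ?u = "moser_function a e"
  have psd: "psd a x \<le> e" if x: "x \<in> ball a r" for x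
  proof -
    have dx: "w / 2 < 1 - (norm x)\<^sup>2" "x \<in> unit_disc" using d(2)[of x] x r by (auto simp: dist_commute)
    have "(norm (a - x))\<^sup>2 \<le> r\<^sup>2" using x by (intro power_mono) (auto simp: dist_norm)
    moreover have "w * (w / 2) \<le> (norm (a - x))\<^sup>2 + (1 - (norm a)\<^sup>2) * (1 - (norm x)\<^sup>2)"
    proof -
      have "w * (w / 2) \<le> w * (1 - (norm x)\<^sup>2)" using dx w by (intro mult_left_mono) auto
      then show ?thesis unfolding w_def by (simp add: add_increasing)
    qed
    ultimately have "psd a x \<le> r\<^sup>2 / (w * (w / 2))"
      unfolding psd_def using w by (intro frac_le) auto
    also have "r\<^sup>2 / (w * (w / 2)) = e" using w by (simp add: e_def power2_eq_square field_simps)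
    finally show ?thesis .
  qed
  define m where "m = exp (- 4) / (4 * e) * (\<rho> a / 2)"
  have m0: "0 \<le> m" using e0 pos[OF a] by (simp add: m_def)
  have [measurable]: "?u \<in> borel_measurable borel"
  proof -
    obtain R where "disc_function ?u R" using test_function_disc_function[OF moser_function_test[OF a e0]] .
    then show ?thesis by (rule disc_function.measurable_u)
  qed
  have "ennreal m * emeasure lborel (ball a r) = (\<integral>\<^sup>+x. ennreal m * indicator (ball a r) x \<partial>lborel)"
    by (rule nn_integral_cmult_indicator[symmetric]) simp
  also have "\<dots> \<le> (\<integral>\<^sup>+x. indicator unit_disc x * (ennreal (\<rho> x) * ennreal (exp (4 * pi * (?u x)\<^sup>2) - 1)) \<partial>lborel)"
  proof (rule nn_integral_mono)
    fix x
    show "ennreal m * indicator (ball a r) x \<le> indicator unit_disc x * (ennreal (\<rho> x) * ennreal (exp (4 * pi * (?u x)\<^sup>2) - 1))"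
    proof (cases "x \<in> ball a r")
      case True
      then have dx: "\<rho> a / 2 < \<rho> x" "x \<in> unit_disc" using d(2)[of x] r by (auto simp: dist_commute)
      have "m \<le> \<rho> x * (exp (4 * pi * (?u x)\<^sup>2) - 1)"
        unfolding m_def
        using moser_function_lower[OF dx(2) e0 e4 psd[OF True] a] dx pos[OF a] pos[OF dx(2)] e0
        by (subst mult.commute) (intro mult_mono, auto)
      then have "ennreal m \<le> ennreal (\<rho> x * (exp (4 * pi * (?u x)\<^sup>2) - 1))" by (rule ennreal_leI)
      also have "\<dots> = ennreal (\<rho> x) * ennreal (exp (4 * pi * (?u x)\<^sup>2) - 1)"
        using pos[OF dx(2)] by (intro ennreal_mult') simp
      finally show ?thesis using True dx by simp
    qed simp
  qed
  also have "\<dots> = (\<integral>\<^sup>+x. ennreal (exp (4 * pi * (?u x)\<^sup>2) - 1) \<partial>conformal_volume unit_disc \<rho>)"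
    by (rule nn_integral_conformal_volume[OF cont, symmetric]) measurable
  also have "\<dots> \<le> ennreal S"
    using moser_function_test[OF a e0] moser_function_energy[OF a e0 e2] by (rule S(2))
  also have "emeasure lborel (ball a r) = ennreal (pi * r\<^sup>2)"
    using r by (subst emeasure_ball) (simp_all add: unit_ball_vol_2)
  finally have "ennreal (m * (pi * r\<^sup>2)) \<le> ennreal S" using m0 by (simp add: ennreal_mult')
  then have "m * (pi * r\<^sup>2) \<le> S" using S(1) by (simp add: ennreal_le_iff)
  moreover have "m * (pi * r\<^sup>2) = exp (- 4) * pi * w\<^sup>2 / 16 * \<rho> a"
    using r w by (simp add: m_def e_def field_simps)
  ultimately have "exp (- 4) * pi * w\<^sup>2 / 16 * \<rho> a \<le> S" by simp
  then have "exp 4 * 16 / (pi * w\<^sup>2) * (exp (- 4) * pi * w\<^sup>2 / 16 * \<rho> a) \<le> exp 4 * 16 / (pi * w\<^sup>2) * S"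
    by (rule mult_left_mono) simp
  moreover have "exp 4 * 16 / (pi * w\<^sup>2) * (exp (- 4) * pi * w\<^sup>2 / 16 * \<rho> a) = \<rho> a"
    using w by (simp add: exp_minus)
  moreover have "exp 4 * 16 / (pi * w\<^sup>2) * S = 4 * exp 4 * S / pi * hyperbolic_factor a"
    using w by (simp add: hyperbolic_factor_def w_def[symmetric] power_divide field_simps)
  ultimately show ?thesis by simp
qed

theorem theorem1p1:
  fixes \<rho> :: "real^2 \<Rightarrow> real"
  assumes "Ck_on 2 \<rho> unit_disc"
    and "\<And>x. x \<in> unit_disc \<Longrightarrow> \<rho> x > 0"
  shows "(SUP u \<in> {u \<in> test_functions unit_disc.
                    (\<integral>\<^sup>+x\<in>unit_disc. ennreal ((norm (grad u x))\<^sup>2) \<partial>lborel) \<le> 1}.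
            \<integral>\<^sup>+x. ennreal (exp (4 * pi * (u x)\<^sup>2) - 1) \<partial>conformal_volume unit_disc \<rho>) < \<infinity>
         \<longleftrightarrow> (\<exists>c>0. \<forall>x\<in>unit_disc. \<rho> x \<le> c * hyperbolic_factor x)"
    (is "?S < \<infinity> \<longleftrightarrow> _")
proof -
  have cont: "continuous_on unit_disc \<rho>"
    using assms(1) Ck_on_SucD[of 1 \<rho> unit_disc] Ck_on_SucD[of 0 \<rho> unit_disc] by (simp add: numeral_2_eq_2)
  show ?thesis
  proof
    assume fin: "?S < \<infinity>"
    define S where "S = enn2real ?S"
    have S: "?S = ennreal S" "0 \<le> S" using fin by (auto simp: S_def less_top)
    \<comment> \<open>Adding \<open>1\<close> to the constant below makes it positive.\<close>
    have bound: "\<rho> x \<le> 4 * exp 4 * S / pi * hyperbolic_factor x" if "x \<in> unit_disc" for x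
      by (rule sup_finite_imp_bound[OF cont assms(2) S(2) _ that])
         (auto simp: S(1)[symmetric] intro!: SUP_upper)
    have "\<rho> x \<le> (4 * exp 4 * S / pi + 1) * hyperbolic_factor x" if "x \<in> unit_disc" for x
      using bound[OF that] by (simp add: distrib_right hyperbolic_factor_def add_increasing2)
    moreover have "0 < 4 * exp 4 * S / pi + 1" using S(2) by (intro add_nonneg_pos) auto
    ultimately show "\<exists>c>0. \<forall>x\<in>unit_disc. \<rho> x \<le> c * hyperbolic_factor x" by blast
  next
    assume "\<exists>c>0. \<forall>x\<in>unit_disc. \<rho> x \<le> c * hyperbolic_factor x"
    then obtain c where c: "c > 0" "\<And>x. x \<in> unit_disc \<Longrightarrow> \<rho> x \<le> c * hyperbolic_factor x" by blast
    define K where "K = 16 * pi * exp (16 * pi) + exp 1 * moser_bound (16 * pi)"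
    have "?S \<le> ennreal c * ennreal K"
    proof (rule SUP_least)
      fix u assume "u \<in> {u \<in> test_functions unit_disc.
                    (\<integral>\<^sup>+x\<in>unit_disc. ennreal ((norm (grad u x))\<^sup>2) \<partial>lborel) \<le> 1}"
      then have u: "u \<in> test_functions unit_disc"
        and E: "(\<integral>\<^sup>+x\<in>unit_disc. ennreal ((norm (grad u x))\<^sup>2) \<partial>lborel) \<le> 1" by auto
      obtain R where df: "disc_function u R" using test_function_disc_function[OF u] .
      interpret disc_function u R by (rule df)
      have "unit_energy_function u R"
        using E by unfold_locales (simp add: nn_integral_hgrad_square)
      then interpret unit_energy_function u R .
      have "(\<integral>\<^sup>+x. ennreal (exp (4 * pi * (u x)\<^sup>2) - 1) \<partial>conformal_volume unit_disc \<rho>)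
         = (\<integral>\<^sup>+x. indicator unit_disc x * (ennreal (\<rho> x) * ennreal (exp (4 * pi * (u x)\<^sup>2) - 1)) \<partial>lborel)"
        by (rule nn_integral_conformal_volume[OF cont]) measurable
      also have "\<dots> \<le> (\<integral>\<^sup>+x. ennreal c * (indicator unit_disc x * ennreal (hyperbolic_factor x) * ennreal (exp (4 * pi * (u x)\<^sup>2) - 1)) \<partial>lborel)"
      proof (rule nn_integral_mono)
        fix x
        show "indicator unit_disc x * (ennreal (\<rho> x) * ennreal (exp (4 * pi * (u x)\<^sup>2) - 1))
          \<le> ennreal c * (indicator unit_disc x * ennreal (hyperbolic_factor x) * ennreal (exp (4 * pi * (u x)\<^sup>2) - 1))"
        proof (cases "x \<in> unit_disc")
          case True
          have "ennreal (\<rho> x) \<le> ennreal (c * hyperbolic_factor x)" using c(2)[OF True] by (rule ennreal_leI)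
          also have "\<dots> = ennreal c * ennreal (hyperbolic_factor x)" using c by (intro ennreal_mult') simp
          finally have "ennreal (\<rho> x) * ennreal (exp (4 * pi * (u x)\<^sup>2) - 1)
              \<le> ennreal c * ennreal (hyperbolic_factor x) * ennreal (exp (4 * pi * (u x)\<^sup>2) - 1)"
            by (rule mult_right_mono) simp
          then show ?thesis using True by (simp add: mult.assoc)
        qed simp
      qed
      also have "\<dots> = ennreal c * (\<integral>\<^sup>+x. indicator unit_disc x * ennreal (hyperbolic_factor x) * ennreal (exp (4 * pi * (u x)\<^sup>2) - 1) \<partial>lborel)"
        by (rule nn_integral_cmult) measurable
      also have "(\<integral>\<^sup>+x. indicator unit_disc x * ennreal (hyperbolic_factor x) * ennreal (exp (4 * pi * (u x)\<^sup>2) - 1) \<partial>lborel)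
         = (\<integral>\<^sup>+x. ennreal (exp (4 * pi * (u x)\<^sup>2) - 1) \<partial>hvol)"
        by (rule nn_integral_hvol[symmetric]) measurable
      also have "ennreal c * \<dots> \<le> ennreal c * ennreal K"
        unfolding K_def by (intro mult_left_mono moser_trudinger) simp
      finally show "(\<integral>\<^sup>+x. ennreal (exp (4 * pi * (u x)\<^sup>2) - 1) \<partial>conformal_volume unit_disc \<rho>) \<le> ennreal c * ennreal K" .
    qed
    also have "\<dots> < \<infinity>" by (simp add: ennreal_mult_less_top)
    finally show "?S < \<infinity>" .
  qed
qed

end
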